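(* Let $I$ and $I'$ be finite nonempty subsets of the set of vertices $\mathbb{V}$ of the $(K,d)$-tube, for $K,d\ge2$. Assume that the passage time distribution $P_\tau$, not concentrated at a single point, is such that $P_\tau(\Lambda)=1$ for its set of point masses $\Lambda=\{t\in[0,\infty):P_\tau(\{t\})>0\}$, and that either of the following holds: (a) there are $t_j\in\Lambda$ and integers $n_j$, for $j$ in some finite set of indices $J^\ast$, such that $\sum_{j\in J^\ast}n_j$ is odd and $\sum_{j\in J^\ast}n_jt_j=0$; (b) $\mathrm{dist}(\mathbf{x},\mathbf{y})$ is even for all $\mathbf{x}\in I$, $\mathbf{y}\in I'$. For any $m\ge0$, there exists a coupling of $\{\tau_e\}_{e\in\mathbb{E}_m^c}$ and $\{\tau'_e\}_{e\in\mathbb{E}_m^c}$ such that if $\{\tau_e\}_{e\in\mathbb{E}_m}$ and $\{\tau'_e\}_{e\in\mathbb{E}_m}$ each have distribution $P_\tau^{\mathbb{E}_m}$, then the marginal distributions of $\{\tau_e\}_{e\in\mathbb{E}}$ and $\{\tau'_e\}_{e\in\mathbb{E}}$ are given by the product measure $P_\tau^{\mathbb{E}}$, and such that if first-passage percolation is performed with $(I,\{\tau_e\}_{e\in\mathbb{E}})$ and $(I',\{\tau'_e\}_{e\in\mathbb{E}})$, respectively, then with probability one there exists an $N_c<\infty$ such that $$T(I,v_{n,i})=T'(I',v_{n,i})\quad\text{and}\quad B_t=B'_t$$ for all $i$, all $n\ge N_c$, and all $t\ge N_c$.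
   Context: The $(K,d)$-tube is the nearest neighbour graph $(\mathbb{V},\mathbb{E})$ on $\mathbb{Z}\times\{0,1,\dots,K-1\}^{d-1}$. Vertices with first coordinate $n$ are at level $n$; they are enumerated as $v_{n,i}$, $1\le i\le K^{d-1}$. $\mathrm{dist}$ denotes graph distance. First-passage percolation. $\{\tau_e\}$ and $\{\tau'_e\}$ are families of non-negative passage times; $P_\tau$ is a probability distribution on $[0,\infty)$. A path is an alternating sequence of vertices and edges, each edge joining the preceding and following vertex. $T(\Gamma)=\sum_{e\in\Gamma}\tau_e$ (sum over the set of edges) and $T(U,V)=\inf\{T(\Gamma):\Gamma\text{ a path from }U\text{ to }V\}$ (brackets dropped for singletons); $T'$ is defined in the same way from $\{\tau'_e\}$. $B_t=\{v\in\mathbb{V}:T(I,v)\le t\}$ and $B'_t=\{v\in\mathbb{V}:T'(I',v)\le t\}$. $\mathbb{E}_n$ is the set of edges between level $-n$ and level $n$ (both endpoints at levels in $\{-n,\dots,n\}$), excluding edges with both endpoints at level $-n$ and edges with both endpoints at level $n$; $\mathbb{E}_n^c=\mathbb{E}\setminus\mathbb{E}_n$. A coupling of two random elements is a joint distribution having their laws as marginals (here the families on $\mathbb{E}_m^c$ are coupled, the families on $\mathbb{E}_m$ being given). *)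

theory Defs
  imports "HOL-Probability.Probability"
begin

section \<open>The \<open>(K,d)\<close>-tube\<close>

text \<open>A vertex is a pair (level, cross-section coordinates); the coordinates are an
  extensional function on \<open>{..<d - 1}\<close>.\<close>

type_synonym vertex = "int \<times> (nat \<Rightarrow> nat)"
type_synonym edge = "vertex set"

definition tube_verts :: "nat \<Rightarrow> nat \<Rightarrow> vertex set" where
  "tube_verts K d = UNIV \<times> ({..<d - 1} \<rightarrow>\<^sub>E {..<K})"

definition l1_dist :: "nat \<Rightarrow> vertex \<Rightarrow> vertex \<Rightarrow> int" where
  "l1_dist d u v = \<bar>fst u - fst v\<bar> + (\<Sum>i<d - 1. \<bar>int (snd u i) - int (snd v i)\<bar>)"

definition tube_edges :: "nat \<Rightarrow> nat \<Rightarrow> edge set" where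
  "tube_edges K d =
     {{u, v} | u v. u \<in> tube_verts K d \<and> v \<in> tube_verts K d \<and> l1_dist d u v = 1}"

definition inner_edges :: "nat \<Rightarrow> nat \<Rightarrow> nat \<Rightarrow> edge set" where
  "inner_edges K d n =
     {e \<in> tube_edges K d. fst ` e \<subseteq> {- int n..int n} \<and> fst ` e \<noteq> {- int n} \<and> fst ` e \<noteq> {int n}}"

abbreviation outer_edges :: "nat \<Rightarrow> nat \<Rightarrow> nat \<Rightarrow> edge set" where
  "outer_edges K d n \<equiv> tube_edges K d - inner_edges K d n"

text \<open>The tube has no multiple edges, so a path (repetitions allowed) is determined by the list
  of its vertices.\<close>

definition paths :: "nat \<Rightarrow> nat \<Rightarrow> vertex set \<Rightarrow> vertex set \<Rightarrow> vertex list set" where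
  "paths K d U V =
     {p. p \<noteq> [] \<and> set p \<subseteq> tube_verts K d \<and> successively (\<lambda>u v. {u, v} \<in> tube_edges K d) p \<and>
         hd p \<in> U \<and> last p \<in> V}"

definition path_edges :: "vertex list \<Rightarrow> edge set" where
  "path_edges p = {{p ! i, p ! Suc i} | i. Suc i < length p}"

definition graph_dist :: "nat \<Rightarrow> nat \<Rightarrow> vertex \<Rightarrow> vertex \<Rightarrow> nat" where
  "graph_dist K d u v = (LEAST n. \<exists>p\<in>paths K d {u} {v}. length p = Suc n)"


section \<open>First-passage percolation\<close>

text \<open>\<open>T(U,V)\<close> is an infimum of reals: the set is nonempty when \<open>U\<close> and \<open>V\<close> contain vertices of
  the (connected) tube, and it is bounded below when the passage times are non-negative.\<close>

definition passage_time ::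
    "nat \<Rightarrow> nat \<Rightarrow> (edge \<Rightarrow> real) \<Rightarrow> vertex set \<Rightarrow> vertex set \<Rightarrow> real" where
  "passage_time K d \<tau> U V = (INF p\<in>paths K d U V. \<Sum>e\<in>path_edges p. \<tau> e)"

definition infected :: "nat \<Rightarrow> nat \<Rightarrow> (edge \<Rightarrow> real) \<Rightarrow> vertex set \<Rightarrow> real \<Rightarrow> vertex set" where
  "infected K d \<tau> I t = {v \<in> tube_verts K d. passage_time K d \<tau> I {v} \<le> t}"

definition passage_distribution :: "real measure \<Rightarrow> bool" where
  "passage_distribution P \<longleftrightarrow> prob_space P \<and> sets P = sets borel \<and> measure P {0..} = 1"

definition point_masses :: "real measure \<Rightarrow> real set" where
  "point_masses P = {t. 0 \<le> t \<and> 0 < measure P {t}}"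


section \<open>Couplings\<close>

abbreviation iid_law :: "real measure \<Rightarrow> edge set \<Rightarrow> (edge \<Rightarrow> real) measure" where
  "iid_law P A \<equiv> PiM A (\<lambda>_. P)"

definition coupling :: "'a measure \<Rightarrow> 'b measure \<Rightarrow> ('a \<times> 'b) measure \<Rightarrow> bool" where
  "coupling M N C \<longleftrightarrow>
     prob_space C \<and> sets C = sets (M \<Otimes>\<^sub>M N) \<and> distr C M fst = M \<and> distr C N snd = N"

text \<open>A coupling of the families on \<open>B\<close>, the families on \<open>A\<close> being given, is a probability kernel:
  to every pair of configurations on \<open>A\<close> it assigns a coupling of two i.i.d. families on \<open>B\<close>.\<close>

definition coupling_kernel ::
    "real measure \<Rightarrow> edge set \<Rightarrow> edge set \<Rightarrow>
     ((edge \<Rightarrow> real) \<times> (edge \<Rightarrow> real) \<Rightarrow> ((edge \<Rightarrow> real) \<times> (edge \<Rightarrow> real)) measure) \<Rightarrow> bool" where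
  "coupling_kernel P A B \<kappa> \<longleftrightarrow>
     \<kappa> \<in> iid_law P A \<Otimes>\<^sub>M iid_law P A \<rightarrow>\<^sub>M prob_algebra (iid_law P B \<Otimes>\<^sub>M iid_law P B) \<and>
     (\<forall>\<omega>\<in>space (iid_law P A \<Otimes>\<^sub>M iid_law P A). coupling (iid_law P B) (iid_law P B) (\<kappa> \<omega>))"

text \<open>The joint law of the two families on \<open>A \<union> B\<close>, when the pair of families on \<open>A\<close> has law \<open>Q\<close>
  and the pair on \<open>B\<close> has conditional law \<open>\<kappa>\<close>.\<close>

definition extend_law ::
    "real measure \<Rightarrow> edge set \<Rightarrow> edge set \<Rightarrow> ((edge \<Rightarrow> real) \<times> (edge \<Rightarrow> real)) measure \<Rightarrow>
     ((edge \<Rightarrow> real) \<times> (edge \<Rightarrow> real) \<Rightarrow> ((edge \<Rightarrow> real) \<times> (edge \<Rightarrow> real)) measure) \<Rightarrow>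
     ((edge \<Rightarrow> real) \<times> (edge \<Rightarrow> real)) measure" where
  "extend_law P A B Q \<kappa> =
     Q \<bind> (\<lambda>\<omega>. distr (\<kappa> \<omega>) (iid_law P (A \<union> B) \<Otimes>\<^sub>M iid_law P (A \<union> B))
        (\<lambda>\<eta>. (merge A B (fst \<omega>, fst \<eta>), merge A B (snd \<omega>, snd \<eta>))))"

end

theory Submission
  imports Defs
begin

text \<open>
  The passage time \<open>T(U, \<cdot>)\<close> is the largest function on the vertices that is nonpositive on \<open>U\<close> and
  whose increment along each edge is at most the passage time of the edge. Upper bounds for passage
  times come from following edges, lower bounds from exhibiting such potentials; paths need not be
  cut and pasted (\<open>dT_lip\<close>, \<open>dT_greatest\<close>, \<open>passage_time_eq_dT\<close>).

  Fix two point masses \<open>s < t\<close>. A pad is a long stretch of the tube in which the edges of one line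
  parallel to the axis have passage time \<open>s\<close> and the other edges have a passage time
  \<open>th \<ge> t\<close>, except that the cross edges at its two ends may also be faster. Potentials on the two sides of a pad can be interpolated linearly across it
  (\<open>lip_glue\<close>). Hence an optimal route across a pad may be taken through the whole line
  (\<open>dT_across_pad\<close>), and an optimal route between vertices on one side need not
  cross it (\<open>dT_below_pad\<close>). So pads are regeneration points. Two configurations that have pads at both
  ends of a finite box and agree outside of it have passage times that differ by a constant \<open>D\<close> to
  the right of the box and by a constant \<open>D'\<close> to its left (\<open>regeneration_right\<close> and its mirror image). Both constants are
  differences of sums over walks in a finite box (\<open>dT_attained\<close>). By the alternative in the
  hypothesis they are signed sums of an even number of point masses, that is, sums of terms
  \<open>\<plusminus>(lam + mu)\<close> (\<open>difference_pair_sum\<close>): in the second case because the lengths of the walks have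
  the same parity, in the first case because an odd relation corrects the parity.

  Between two pads on the same side one can place a segment in which the cheap line is straight, or one
  in which it makes a detour through a neighbouring line and uses two cross edges \<open>lam\<close> and \<open>mu\<close>. The
  two segments contain the same passage times in a different order, so they have the same probability,
  and replacing the first by the second delays all vertices beyond it by exactly \<open>lam + mu\<close>
  (\<open>swap_right\<close>).

  The coupling copies \<open>\<tau>\<close> to \<open>\<tau>'\<close> shell by shell until pads have appeared on both sides. It then writes
  \<open>D\<close> and \<open>D'\<close> as a finite list of terms \<open>\<plusminus>(lam + mu)\<close>. From then on, whenever \<open>\<tau>\<close> shows in a shell one of
  the two configurations that belong to the first term of the list, \<open>\<tau>'\<close> receives the other one. All
  other shells are copied. Swapping two equally likely configurations preserves the product measure
  (\<open>run_preserves\<close>). With equal probability the swap cancels the first term or doubles it, so the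
  number of copies of this term performs a lazy symmetric random walk, which is absorbed at \<open>0\<close> because a
  bounded harmonic function on the natural numbers that vanishes at \<open>0\<close> is zero
  (\<open>survival_tendsto_0\<close>). Hence the list is almost surely empty eventually (\<open>unfinished_small\<close>). After that
  all shells are copied, the two passage times agree at all but finitely many vertices, and so do
  the infected sets as soon as \<open>t\<close> exceeds the passage times of the exceptional vertices
  (\<open>coalesce_if_no_debt\<close>).
\<close>

section \<open>Passage times as extremal potentials\<close>

text \<open>Vertices are pairs; quantifiers over vertices are kept intact.\<close>

declare split_paired_All [simp del] split_paired_Ex [simp del]

locale tube =
  fixes K d :: nat
  assumes K2: "2 \<le> K" and d2: "2 \<le> d"
begin

definition origin :: "nat \<Rightarrow> nat" where
  "origin = (\<lambda>i\<in>{..<d - 1}. 0)"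

definition unit1 :: "nat \<Rightarrow> nat" where
  "unit1 = (\<lambda>i\<in>{..<d - 1}. if i = 0 then 1 else 0)"

abbreviation adj :: "vertex \<Rightarrow> vertex \<Rightarrow> bool" where
  "adj u v \<equiv> {u, v} \<in> tube_edges K d"

lemma adj_iff:
  "adj u v \<longleftrightarrow> u \<in> tube_verts K d \<and> v \<in> tube_verts K d \<and> l1_dist d u v = 1"
proof -
  have "l1_dist d u v = l1_dist d v u"
    unfolding l1_dist_def by (simp add: abs_minus_commute)
  then show ?thesis
    unfolding tube_edges_def by (fastforce simp: doubleton_eq_iff)
qed

lemma adj_sym: "adj u v \<Longrightarrow> adj v u"
  by (simp add: insert_commute)

lemma adjD: "adj u v \<Longrightarrow> u \<in> tube_verts K d" "adj u v \<Longrightarrow> v \<in> tube_verts K d"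
  by (auto simp: adj_iff)

lemma tube_edgeE:
  assumes "e \<in> tube_edges K d"
  obtains u v where "e = {u, v}" "adj u v"
proof -
  from assms obtain u v where "e = {u, v}" "u \<in> tube_verts K d" "v \<in> tube_verts K d" "l1_dist d u v = 1"
    unfolding tube_edges_def by blast
  then show thesis using that[of u v] by (simp only: adj_iff simp_thms)
qed

lemma tube_verts_iff: "v \<in> tube_verts K d \<longleftrightarrow> snd v \<in> {..<d - 1} \<rightarrow>\<^sub>E {..<K}"
  unfolding tube_verts_def by (cases v) simp

lemma snd_eqI:
  assumes "u \<in> tube_verts K d" "v \<in> tube_verts K d" "\<And>i. i < d - 1 \<Longrightarrow> snd u i = snd v i"
  shows "snd u = snd v"
  using assms by (intro PiE_ext[of _ "{..<d - 1}" "\<lambda>_. {..<K}"]) (simp_all add: tube_verts_iff)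

lemma adj_cases:
  assumes "adj u v"
  obtains (horizontal) "snd u = snd v" "\<bar>fst u - fst v\<bar> = 1"
    | (vertical) "fst u = fst v" "snd u \<noteq> snd v"
proof -
  let ?S = "\<Sum>i<d - 1. \<bar>int (snd u i) - int (snd v i)\<bar>"
  have uv: "u \<in> tube_verts K d" "v \<in> tube_verts K d" "\<bar>fst u - fst v\<bar> + ?S = 1"
    using assms by (auto simp: adj_iff l1_dist_def)
  show thesis
  proof (cases "fst u = fst v")
    case True
    then have "?S = 1" using uv by simp
    then have "snd u \<noteq> snd v" by auto
    then show thesis using True vertical by simp
  next
    case False
    then have "\<bar>fst u - fst v\<bar> \<ge> 1" by simp
    moreover have "?S \<ge> 0" by (rule sum_nonneg) simp
    ultimately have *: "\<bar>fst u - fst v\<bar> = 1" "?S = 0" using uv by linarith+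
    then have "\<forall>i\<in>{..<d - 1}. \<bar>int (snd u i) - int (snd v i)\<bar> = 0"
      by (subst (asm) sum_nonneg_eq_0_iff) auto
    then have "snd u = snd v" by (intro snd_eqI uv) auto
    then show thesis using * horizontal by simp
  qed
qed

lemma origin_vert: "(n, origin) \<in> tube_verts K d"
  using K2 by (simp add: tube_verts_iff origin_def)

lemma unit1_vert: "(n, unit1) \<in> tube_verts K d"
  using K2 by (simp add: tube_verts_iff unit1_def)

lemma shift_vert: "(n, w) \<in> tube_verts K d \<Longrightarrow> (n', w) \<in> tube_verts K d"
  by (simp add: tube_verts_iff)

lemma adj_horizontal: "(n, w) \<in> tube_verts K d \<Longrightarrow> adj (n, w) (n + 1, w)"
  by (simp add: adj_iff l1_dist_def tube_verts_iff)

lemma adj_origin_unit1: "adj (n, origin) (n, unit1)"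
proof -
  have "(\<Sum>i<d - 1. \<bar>int (origin i) - int (unit1 i)\<bar>) = (\<Sum>i<d - 1. if i = 0 then 1 else 0)"
    by (intro sum.cong refl) (simp add: origin_def unit1_def)
  also have "\<dots> = 1" using d2 by simp
  finally show ?thesis by (simp add: adj_iff l1_dist_def origin_vert unit1_vert)
qed

lemma origin_neq_unit1: "origin \<noteq> unit1"
proof
  assume "origin = unit1"
  then have "origin 0 = unit1 0" by simp
  then show False using d2 by (simp add: origin_def unit1_def)
qed

lemma finite_tube_levels:
  assumes "finite R" shows "finite {v \<in> tube_verts K d. fst v \<in> R}"
proof -
  have "{v \<in> tube_verts K d. fst v \<in> R} = R \<times> ({..<d - 1} \<rightarrow>\<^sub>E {..<K})"
    by (simp add: set_eq_iff tube_verts_iff mem_Times_iff conj_commute)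
  then show ?thesis using assms by (simp add: finite_PiE)
qed

text \<open>Walks are recorded by the passage times that they collect, repetitions included: such sums
  are additive under concatenation, unlike the sum over the set of edges of a path.\<close>

inductive walk :: "(edge \<Rightarrow> real) \<Rightarrow> int set \<Rightarrow> vertex set \<Rightarrow> vertex \<Rightarrow> real list \<Rightarrow> bool"
  for \<tau> R U where
  walk_start: "u \<in> U \<Longrightarrow> u \<in> tube_verts K d \<Longrightarrow> fst u \<in> R \<Longrightarrow> walk \<tau> R U u []"
| walk_step: "walk \<tau> R U u ts \<Longrightarrow> adj u v \<Longrightarrow> fst v \<in> R \<Longrightarrow> walk \<tau> R U v (\<tau> {u, v} # ts)"

definition dT :: "(edge \<Rightarrow> real) \<Rightarrow> int set \<Rightarrow> vertex set \<Rightarrow> vertex \<Rightarrow> real" where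
  "dT \<tau> R U v = Inf (sum_list ` {ts. walk \<tau> R U v ts})"

definition lip :: "(edge \<Rightarrow> real) \<Rightarrow> int set \<Rightarrow> (vertex \<Rightarrow> real) \<Rightarrow> bool" where
  "lip \<tau> R h \<longleftrightarrow> (\<forall>u v. adj u v \<longrightarrow> fst u \<in> R \<longrightarrow> fst v \<in> R \<longrightarrow> h v \<le> h u + \<tau> {u, v})"

lemma lipD: "lip \<tau> R h \<Longrightarrow> adj u v \<Longrightarrow> fst u \<in> R \<Longrightarrow> fst v \<in> R \<Longrightarrow> h v \<le> h u + \<tau> {u, v}"
  by (simp add: lip_def)

lemma lip_mono: "lip \<tau> R h \<Longrightarrow> R' \<subseteq> R \<Longrightarrow> lip \<tau> R' h"
  unfolding lip_def by blast

lemma lip_diff: "lip \<tau> R h \<Longrightarrow> lip \<tau> R (\<lambda>v. h v - c)"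
  unfolding lip_def by simp

lemma lip_add: "lip \<tau> R h \<Longrightarrow> lip \<tau> R (\<lambda>v. c + h v)"
  unfolding lip_def by simp

lemma walk_vert: "walk \<tau> R U v ts \<Longrightarrow> v \<in> tube_verts K d \<and> fst v \<in> R"
  by (induction rule: walk.induct) (auto simp: adj_iff)

lemma walk_sum_nonneg:
  assumes "walk \<tau> R U v ts" "\<forall>e\<in>tube_edges K d. 0 \<le> \<tau> e"
  shows "0 \<le> sum_list ts"
  using assms by (induction rule: walk.induct) auto

lemma walk_mono:
  assumes "walk \<tau> R U v ts" "R \<subseteq> R'" "U \<subseteq> U'"
  shows "walk \<tau> R' U' v ts"
  using assms by (induction rule: walk.induct) (auto intro: walk.intros)

lemma walk_cong:
  assumes "walk \<tau> R U v ts" "\<And>u v. adj u v \<Longrightarrow> fst u \<in> R \<Longrightarrow> fst v \<in> R \<Longrightarrow> \<tau> {u, v} = \<tau>' {u, v}"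
  shows "walk \<tau>' R U v ts"
  using assms(1)
proof (induction rule: walk.induct)
  case (walk_step u ts v)
  then have "\<tau> {u, v} = \<tau>' {u, v}" using assms(2) walk_vert by blast
  then show ?case using walk_step walk.walk_step[of \<tau>' R U u ts v] by simp
qed (auto intro: walk.intros)

lemma dT_cong:
  assumes "\<And>u v. adj u v \<Longrightarrow> fst u \<in> R \<Longrightarrow> fst v \<in> R \<Longrightarrow> \<tau> {u, v} = \<tau>' {u, v}"
  shows "dT \<tau> R U v = dT \<tau>' R U v"
proof -
  have "walk \<tau> R U v ts \<longleftrightarrow> walk \<tau>' R U v ts" for ts
    by (rule iffI; erule walk_cong) (simp_all add: assms)
  then show ?thesis by (simp add: dT_def)
qed

lemma lip_walk:
  assumes "walk \<tau> R U v ts" "lip \<tau> R h" "\<And>u. u \<in> U \<Longrightarrow> u \<in> tube_verts K d \<Longrightarrow> fst u \<in> R \<Longrightarrow> h u \<le> 0"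
  shows "h v \<le> sum_list ts"
  using assms(1)
proof (induction rule: walk.induct)
  case (walk_step u ts v)
  then show ?case using lipD[OF assms(2), of u v] walk_vert by fastforce
qed (use assms(3) in auto)

text \<open>Hence every band of consecutive levels is connected. The number of steps needed is the
  \<open>l1\<close>-distance, which is bounded within one level; this controls how much a potential varies there.\<close>

lemma l1_step:
  assumes u: "u \<in> tube_verts K d" and v: "v \<in> tube_verts K d" and "u \<noteq> v"
  obtains u' where "adj u u'" "l1_dist d u' v = l1_dist d u v - 1"
    "fst u' \<in> {min (fst u) (fst v)..max (fst u) (fst v)}"
proof (cases "fst u = fst v")
  case False
  define u' where "u' = (fst u + sgn (fst v - fst u), snd u)"
  have "u' \<in> tube_verts K d" using u by (simp add: u'_def tube_verts_iff)
  then have "adj u u'" using u False by (auto simp: adj_iff l1_dist_def u'_def sgn_if)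
  moreover have "l1_dist d u' v = l1_dist d u v - 1"
    using False by (auto simp: l1_dist_def u'_def sgn_if)
  moreover have "fst u' \<in> {min (fst u) (fst v)..max (fst u) (fst v)}"
    using False by (auto simp: u'_def sgn_if)
  ultimately show thesis by (rule that)
next
  case True
  then have "snd u \<noteq> snd v" using \<open>u \<noteq> v\<close> by (auto simp: prod_eq_iff)
  then obtain i where i: "i < d - 1" "snd u i \<noteq> snd v i" using snd_eqI[OF u v] by blast
  define x where "x = (if snd u i < snd v i then snd u i + 1 else snd u i - 1)"
  define u' where "u' = (fst u, (snd u)(i := x))"
  have "snd v i < K" "snd u i < K" using u v i by (simp_all add: tube_verts_iff PiE_iff)
  then have xK: "x < K" by (auto simp: x_def)
  have "u' \<in> tube_verts K d"
    using u i xK by (simp add: u'_def tube_verts_iff PiE_iff extensional_def)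
  have x1: "\<bar>int (snd u i) - int x\<bar> = 1" using i by (auto simp: x_def)
  have x2: "\<bar>int x - int (snd v i)\<bar> = \<bar>int (snd u i) - int (snd v i)\<bar> - 1" using i by (auto simp: x_def)
  have "(\<Sum>j<d - 1. \<bar>int (snd u j) - int (snd u' j)\<bar>) = (\<Sum>j<d - 1. if j = i then 1 else 0)"
    using x1 by (intro sum.cong) (auto simp: u'_def)
  then have "l1_dist d u u' = 1" using i by (simp add: l1_dist_def u'_def)
  then have a: "adj u u'" using u \<open>u' \<in> _\<close> by (simp add: adj_iff)
  have "(\<Sum>j<d - 1. \<bar>int (snd u' j) - int (snd v j)\<bar>)
      = (\<Sum>j<d - 1. \<bar>int (snd u j) - int (snd v j)\<bar> - (if j = i then 1 else 0))"
    using x2 by (intro sum.cong) (auto simp: u'_def)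
  also have "\<dots> = (\<Sum>j<d - 1. \<bar>int (snd u j) - int (snd v j)\<bar>) - 1"
    using i by (simp add: sum_subtractf)
  finally have "l1_dist d u' v = l1_dist d u v - 1" by (simp add: l1_dist_def u'_def)
  then show thesis using a that[of u'] True by (simp add: u'_def)
qed

lemma l1_zero:
  assumes "u \<in> tube_verts K d" "v \<in> tube_verts K d" "l1_dist d u v \<le> 0" shows "u = v"
proof -
  have S: "0 \<le> (\<Sum>i<d - 1. \<bar>int (snd u i) - int (snd v i)\<bar>)" by (rule sum_nonneg) simp
  then have "fst u = fst v" "(\<Sum>i<d - 1. \<bar>int (snd u i) - int (snd v i)\<bar>) = 0"
    using assms(3) unfolding l1_dist_def by linarith+
  moreover from this(2) have "\<forall>i\<in>{..<d - 1}. \<bar>int (snd u i) - int (snd v i)\<bar> = 0"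
    by (subst (asm) sum_nonneg_eq_0_iff) auto
  then have "snd u = snd v" by (intro snd_eqI assms(1,2)) auto
  ultimately show ?thesis by (simp add: prod_eq_iff)
qed

lemma walk_l1:
  assumes "u \<in> tube_verts K d" "v \<in> tube_verts K d" "{min (fst u) (fst v)..max (fst u) (fst v)} \<subseteq> R"
  shows "\<exists>ts. walk \<tau> R {v} u ts \<and> int (length ts) = l1_dist d u v"
  using assms
proof (induction "nat (l1_dist d u v)" arbitrary: u)
  case 0
  then have "u = v" using l1_zero by simp
  then show ?case using 0 by (intro exI[of _ "[]"]) (auto simp: l1_dist_def intro: walk_start)
next
  case (Suc n)
  then have "u \<noteq> v" by (auto simp: l1_dist_def)
  then obtain u' where u': "adj u u'" "l1_dist d u' v = l1_dist d u v - 1"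
    "fst u' \<in> {min (fst u) (fst v)..max (fst u) (fst v)}"
    using l1_step Suc.prems by metis
  have "\<exists>ts. walk \<tau> R {v} u' ts \<and> int (length ts) = l1_dist d u' v"
  proof (rule Suc.hyps(1))
    have "{min (fst u') (fst v)..max (fst u') (fst v)} \<subseteq> {min (fst u) (fst v)..max (fst u) (fst v)}"
      using u'(3) by auto
    then show "{min (fst u') (fst v)..max (fst u') (fst v)} \<subseteq> R" using Suc.prems(3) by blast
  qed (use u' Suc.hyps(2) Suc.prems in \<open>auto simp: adj_iff\<close>)
  then obtain ts where ts: "walk \<tau> R {v} u' ts" "int (length ts) = l1_dist d u' v" by blast
  have "walk \<tau> R {v} u (\<tau> {u', u} # ts)"
    using u' Suc.prems(3) by (intro walk_step[OF ts(1)]) (auto simp: insert_commute)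
  then show ?case using ts(2) u'(2) by (intro exI) auto
qed

definition interval :: "int set \<Rightarrow> bool" where
  "interval R \<longleftrightarrow> (\<forall>x\<in>R. \<forall>y\<in>R. {x..y} \<subseteq> R)"

lemma interval_simps [simp]: "interval UNIV" "interval {..a}" "interval {a..}" "interval {a..b}"
  by (auto simp: interval_def)

lemma interval_Int: "interval R \<Longrightarrow> interval R' \<Longrightarrow> interval (R \<inter> R')"
  unfolding interval_def by blast

lemma walk_exists:
  assumes "interval R" "u \<in> U" "u \<in> tube_verts K d" "fst u \<in> R" "v \<in> tube_verts K d" "fst v \<in> R"
  shows "\<exists>ts. walk \<tau> R U v ts"
proof -
  have "{min (fst v) (fst u)..max (fst v) (fst u)} \<subseteq> R"
    using assms unfolding interval_def min_def max_def by auto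
  from walk_l1[OF assms(5,3) this] show ?thesis
    using walk_mono[of \<tau> R "{u}" v _ R U] assms(2) by blast
qed

end

text \<open>The two laws that characterise a passage time: it is a potential whose increments are bounded
  by the passage times of the edges, and it dominates every such potential that is nonpositive on
  the source. Passage times are computed below by exhibiting potentials, which avoids the cutting
  and pasting of paths.\<close>

locale fpp_config = tube +
  fixes \<tau> :: "edge \<Rightarrow> real"
  assumes nonneg: "\<forall>e\<in>tube_edges K d. 0 \<le> \<tau> e"
begin

lemma bdd: "bdd_below (sum_list ` {ts. walk \<tau> R U v ts})"
proof (rule bdd_belowI)
  fix x assume "x \<in> sum_list ` {ts. walk \<tau> R U v ts}"
  then show "0 \<le> x" using walk_sum_nonneg nonneg by blast
qed

lemma dT_le: "walk \<tau> R U v ts \<Longrightarrow> dT \<tau> R U v \<le> sum_list ts"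
  unfolding dT_def by (intro cInf_lower bdd) auto

lemma dT_lip:
  assumes "interval R" "\<exists>u\<in>U. u \<in> tube_verts K d \<and> fst u \<in> R"
  shows "lip \<tau> R (dT \<tau> R U)"
  unfolding lip_def
proof (intro allI impI)
  fix u v assume uv: "adj u v" "fst u \<in> R" "fst v \<in> R"
  have ne: "{ts. walk \<tau> R U u ts} \<noteq> {}"
    using assms(2) walk_exists[OF assms(1) _ _ _ adjD(1)[OF uv(1)] uv(2)] by blast
  have "dT \<tau> R U v - \<tau> {u, v} \<le> dT \<tau> R U u"
    unfolding dT_def[of _ _ _ u]
  proof (rule cInf_greatest)
    fix x assume "x \<in> sum_list ` {ts. walk \<tau> R U u ts}"
    then obtain ts where ts: "walk \<tau> R U u ts" "x = sum_list ts" by auto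
    show "dT \<tau> R U v - \<tau> {u, v} \<le> x" using dT_le[OF walk_step[OF ts(1) uv(1,3)]] ts(2) by simp
  qed (use ne in auto)
  then show "dT \<tau> R U v \<le> dT \<tau> R U u + \<tau> {u, v}" by simp
qed

lemma dT_greatest:
  assumes "interval R" "\<exists>u\<in>U. u \<in> tube_verts K d \<and> fst u \<in> R"
    and "lip \<tau> R h" "\<And>u. u \<in> U \<Longrightarrow> u \<in> tube_verts K d \<Longrightarrow> fst u \<in> R \<Longrightarrow> h u \<le> 0"
    and v: "v \<in> tube_verts K d" "fst v \<in> R"
  shows "h v \<le> dT \<tau> R U v"
  unfolding dT_def
proof (rule cInf_greatest)
  show "sum_list ` {ts. walk \<tau> R U v ts} \<noteq> {}" using assms(2) walk_exists[OF assms(1) _ _ _ v] by blast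
qed (use lip_walk[of \<tau> R U v] assms in auto)

lemma dT_nonneg:
  assumes "interval R" "\<exists>u\<in>U. u \<in> tube_verts K d \<and> fst u \<in> R" "v \<in> tube_verts K d" "fst v \<in> R"
  shows "0 \<le> dT \<tau> R U v"
  using nonneg by (intro dT_greatest[where h = "\<lambda>_. 0"] assms) (auto simp: lip_def)

lemma dT_source:
  assumes "u \<in> U" "u \<in> tube_verts K d" "fst u \<in> R"
  shows "dT \<tau> R U u \<le> 0"
  using dT_le[OF walk_start[OF assms]] by simp

end

lemma path_edges_single [simp]: "path_edges [x] = {}"
  by (simp add: path_edges_def)

lemma path_edges_Cons: "path_edges (x # y # p) = insert {x, y} (path_edges (y # p))"
proof -
  have "{i. Suc i < length (x # y # p)} = insert 0 (Suc ` {i. Suc i < length (y # p)})"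
  proof (rule set_eqI)
    fix i show "i \<in> {i. Suc i < length (x # y # p)} \<longleftrightarrow> i \<in> insert 0 (Suc ` {i. Suc i < length (y # p)})"
      by (cases i) auto
  qed
  then show ?thesis unfolding path_edges_def by (auto simp: setcompr_eq_image image_image)
qed

lemma path_edges_snoc:
  assumes "p \<noteq> []" shows "path_edges (p @ [v]) = insert {last p, v} (path_edges p)"
  using assms
proof (induction p)
  case (Cons x p)
  then show ?case
    by (cases p) (auto simp: path_edges_Cons)
qed simp

lemma finite_path_edges [simp]: "finite (path_edges p)"
proof (induction p)
  case (Cons x p)
  then show ?case by (cases p) (auto simp: path_edges_Cons)
qed (simp add: path_edges_def)

lemma path_edges_subset_set: "e \<in> path_edges p \<Longrightarrow> e \<subseteq> set p"
  unfolding path_edges_def by auto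

text \<open>A repeated edge counts once in the weight of a path but twice along a walk. Erasing loops
  removes the discrepancy without enlarging the set of edges.\<close>

lemma distinct_path:
  assumes "successively R p" "p \<noteq> []"
  shows "\<exists>q. q \<noteq> [] \<and> successively R q \<and> distinct q \<and> hd q = hd p \<and> last q = last p \<and>
    path_edges q \<subseteq> path_edges p"
  using assms
proof (induction p)
  case (Cons x p)
  show ?case
  proof (cases "p = []")
    case True
    then show ?thesis by (intro exI[of _ "[x]"]) auto
  next
    case False
    then obtain y p' where p: "p = y # p'" by (cases p) auto
    then obtain q where q: "q \<noteq> []" "successively R q" "distinct q" "hd q = y" "last q = last p"
      "path_edges q \<subseteq> path_edges p" and xy: "R x y"
      using Cons by auto
    have pe: "path_edges p \<subseteq> path_edges (x # p)" using p by (auto simp: path_edges_Cons)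
    show ?thesis
    proof (cases "x \<in> set q")
      case True
      then obtain q1 q2 where q12: "q = q1 @ x # q2" by (meson split_list)
      have "path_edges (x # q2) \<subseteq> path_edges (q1 @ x # q2)"
      proof (induction q1)
        case (Cons z q1)
        then show ?case by (cases q1) (auto simp: path_edges_Cons)
      qed simp
      then show ?thesis using q pe q12 p
        by (intro exI[of _ "x # q2"]) (auto simp: successively_append_iff)
    next
      case False
      obtain q' where q': "q = y # q'" using q by (cases q) auto
      show ?thesis using q False xy pe p q'
        by (intro exI[of _ "x # q"]) (auto simp: path_edges_Cons)
    qed
  qed
qed simp

context tube begin

definition parity :: "vertex \<Rightarrow> int" where
  "parity v = fst v + (\<Sum>i<d - 1. int (snd v i))"

lemma even_l1_dist: "even (l1_dist d u v) \<longleftrightarrow> even (parity u + parity v)"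
proof -
  let ?f = "\<lambda>i. int (snd u i) - int (snd v i)"
  have "even (\<Sum>i<d - 1. \<bar>?f i\<bar> - ?f i)" by (intro dvd_sum) auto
  then have "even ((\<Sum>i<d - 1. \<bar>?f i\<bar>) - (\<Sum>i<d - 1. ?f i))" by (simp only: sum_subtractf)
  moreover have "even (\<bar>fst u - fst v\<bar> - (fst u - fst v))" by auto
  ultimately have "even ((\<bar>fst u - fst v\<bar> - (fst u - fst v)) + ((\<Sum>i<d - 1. \<bar>?f i\<bar>) - (\<Sum>i<d - 1. ?f i)))"
    by (rule dvd_add[rotated])
  also have "(\<bar>fst u - fst v\<bar> - (fst u - fst v)) + ((\<Sum>i<d - 1. \<bar>?f i\<bar>) - (\<Sum>i<d - 1. ?f i))
      = l1_dist d u v - (parity u - parity v)"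
    by (simp add: l1_dist_def parity_def sum_subtractf)
  finally show ?thesis by (metis even_diff even_add)
qed

lemma parity_adj: "adj u v \<Longrightarrow> even (parity u) \<longleftrightarrow> odd (parity v)"
  using even_l1_dist[of u v] by (auto simp: adj_iff)

lemma walk_parity:
  assumes "walk \<tau> R U v ts"
  shows "\<exists>u\<in>U. u \<in> tube_verts K d \<and> (even (parity u + parity v) \<longleftrightarrow> even (length ts))"
  using assms
proof (induction rule: walk.induct)
  case (walk_step u ts v)
  then show ?case using parity_adj[of u v] by auto
qed auto

lemma walk_path:
  assumes "walk \<tau> R U v ts" "\<forall>e\<in>tube_edges K d. 0 \<le> \<tau> e"
  shows "\<exists>p\<in>paths K d U {v}. (\<Sum>e\<in>path_edges p. \<tau> e) \<le> sum_list ts"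
  using assms(1)
proof (induction rule: walk.induct)
  case (walk_start u)
  then show ?case by (intro bexI[of _ "[u]"]) (auto simp: paths_def)
next
  case (walk_step u ts v)
  then obtain p where p: "p \<in> paths K d U {u}" "(\<Sum>e\<in>path_edges p. \<tau> e) \<le> sum_list ts" by blast
  have ne: "p \<noteq> []" "last p = u" using p by (auto simp: paths_def)
  have "p @ [v] \<in> paths K d U {v}"
    using p(1) walk_step(2) adjD(2)[OF walk_step(2)] by (auto simp: paths_def successively_append_iff)
  moreover have "(\<Sum>e\<in>path_edges (p @ [v]). \<tau> e) \<le> \<tau> {u, v} + (\<Sum>e\<in>path_edges p. \<tau> e)"
    using assms(2) walk_step(2) ne by (simp add: path_edges_snoc sum.insert_if)
  ultimately show ?case using p(2) by (intro bexI) auto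
qed

lemma path_parity:
  assumes "successively adj p" "p \<noteq> []"
  shows "even (parity (hd p) + parity (last p)) \<longleftrightarrow> odd (length p)"
  using assms
proof (induction p)
  case (Cons x p)
  show ?case
  proof (cases p)
    case (Cons y p')
    then have "adj x y" using Cons.prems by simp
    then show ?thesis using Cons.IH Cons.prems Cons parity_adj[of x y] by auto
  qed simp
qed simp

lemma even_graph_dist:
  assumes "u \<in> tube_verts K d" "v \<in> tube_verts K d"
  shows "even (graph_dist K d u v) \<longleftrightarrow> even (parity u + parity v)"
proof -
  obtain ts where "walk (\<lambda>_. 0) UNIV {u} v ts"
    using walk_exists[of UNIV u "{u}" v] assms by auto
  then obtain p where p: "p \<in> paths K d {u} {v}" using walk_path by fastforce
  then have "length p = Suc (length p - 1)" by (auto simp: paths_def)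
  then have "\<exists>n. \<exists>p\<in>paths K d {u} {v}. length p = Suc n" using p by blast
  from LeastI_ex[OF this] obtain q where "q \<in> paths K d {u} {v}" "length q = Suc (graph_dist K d u v)"
    unfolding graph_dist_def by blast
  then show ?thesis using path_parity[of q] by (auto simp: paths_def)
qed

lemma lip_distinct_path:
  assumes "lip \<tau> UNIV h" "successively adj q" "distinct q" "q \<noteq> []"
  shows "h (last q) \<le> h (hd q) + (\<Sum>e\<in>path_edges q. \<tau> e)"
  using assms(2-)
proof (induction q)
  case (Cons x q)
  show ?case
  proof (cases q)
    case (Cons y q')
    have "{x, y} \<notin> path_edges q" using path_edges_subset_set[of "{x, y}" q] Cons.prems by auto
    then have "(\<Sum>e\<in>path_edges (x # q). \<tau> e) = \<tau> {x, y} + (\<Sum>e\<in>path_edges q. \<tau> e)"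
      using Cons by (simp add: path_edges_Cons)
    moreover have "h y \<le> h x + \<tau> {x, y}" using lipD[OF assms(1)] Cons Cons.prems by simp
    moreover have "h (last q) \<le> h (hd q) + (\<Sum>e\<in>path_edges q. \<tau> e)"
      using Cons.IH Cons.prems Cons by simp
    ultimately show ?thesis using Cons by simp
  qed simp
qed simp

end

context fpp_config begin

lemma passage_time_eq_dT:
  assumes U: "\<exists>u\<in>U. u \<in> tube_verts K d" and v: "v \<in> tube_verts K d"
  shows "passage_time K d \<tau> U {v} = dT \<tau> UNIV U v"
proof (rule antisym)
  obtain ts where ts: "walk \<tau> UNIV U v ts" using U v walk_exists[of UNIV _ U v] by (metis UNIV_I interval_simps(1))
  have sub: "path_edges p \<subseteq> tube_edges K d" if "p \<in> paths K d U {v}" for p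
    using that unfolding paths_def path_edges_def by (auto simp: successively_conv_nth)
  have b: "bdd_below ((\<lambda>p. \<Sum>e\<in>path_edges p. \<tau> e) ` paths K d U {v})"
    using sub nonneg by (intro bdd_belowI2[of _ 0] sum_nonneg) blast
  show "passage_time K d \<tau> U {v} \<le> dT \<tau> UNIV U v"
    unfolding dT_def
  proof (rule cInf_greatest)
    fix x assume "x \<in> sum_list ` {ts. walk \<tau> UNIV U v ts}"
    then obtain ts where "walk \<tau> UNIV U v ts" "x = sum_list ts" by auto
    then obtain p where p: "p \<in> paths K d U {v}" "(\<Sum>e\<in>path_edges p. \<tau> e) \<le> x"
      using walk_path nonneg by blast
    show "passage_time K d \<tau> U {v} \<le> x"
      unfolding passage_time_def by (rule cINF_lower2[OF b p])
  qed (use ts in auto)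
  obtain p0 where p0: "p0 \<in> paths K d U {v}" using walk_path[OF ts nonneg] by blast
  show "dT \<tau> UNIV U v \<le> passage_time K d \<tau> U {v}"
    unfolding passage_time_def
  proof (rule cINF_greatest)
    fix p assume p: "p \<in> paths K d U {v}"
    then have "successively adj p" "p \<noteq> []" by (auto simp: paths_def)
    then obtain q where q: "q \<noteq> []" "successively adj q" "distinct q" "hd q = hd p" "last q = last p"
      "path_edges q \<subseteq> path_edges p" using distinct_path by blast
    have hd: "hd p \<in> U" "hd p \<in> tube_verts K d" "last p = v" using p by (auto simp: paths_def)
    have "dT \<tau> UNIV U v \<le> dT \<tau> UNIV U (hd p) + (\<Sum>e\<in>path_edges q. \<tau> e)"
      using lip_distinct_path[OF dT_lip[of UNIV U] q(2,3,1)] q(4,5) U hd by simp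
    also have "\<dots> \<le> 0 + (\<Sum>e\<in>path_edges p. \<tau> e)"
      using sub[OF p] q(6) nonneg hd by (intro add_mono dT_source sum_mono2) auto
    finally show "dT \<tau> UNIV U v \<le> (\<Sum>e\<in>path_edges p. \<tau> e)" by simp
  qed (use p0 in auto)
qed

end

text \<open>Zero summands do not matter, and each of the others is at least the least positive element of \<open>F\<close>,
  which bounds their number.\<close>

lemma finite_bounded_sums:
  fixes F :: "real set"
  assumes "finite F" "F \<subseteq> {0..}"
  shows "finite {x \<in> sum_list ` lists F. x \<le> C}"
proof (cases "F - {0} = {}")
  case True
  have "sum_list ts = 0" if "ts \<in> lists F" for ts
    using that True by (induction ts) auto
  then have "{x \<in> sum_list ` lists F. x \<le> C} \<subseteq> {0}" by auto
  then show ?thesis using finite_subset by blast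
next
  case False
  define a where "a = Min (F - {0})"
  have "a \<in> F - {0}" unfolding a_def by (rule Min_in) (use False assms in auto)
  then have a: "a > 0" using assms(2) by force
  have le: "a \<le> x" if "x \<in> F - {0}" for x
    unfolding a_def by (rule Min_le) (use assms(1) that in auto)
  let ?N = "nat \<lceil>C / a\<rceil>"
  have "{x \<in> sum_list ` lists F. x \<le> C} \<subseteq> sum_list ` {ts. set ts \<subseteq> F \<and> length ts \<le> ?N}"
  proof
    fix x assume "x \<in> {x \<in> sum_list ` lists F. x \<le> C}"
    then obtain ts where ts: "set ts \<subseteq> F" "x = sum_list ts" "x \<le> C" by auto
    let ?ts = "filter (\<lambda>t. t \<noteq> 0) ts"
    have s: "sum_list ?ts = x" unfolding ts(2) by (induction ts) auto
    have "real (length us) * a \<le> sum_list us" if "set us \<subseteq> F - {0}" for us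
      using that
    proof (induction us)
      case (Cons u us)
      then show ?case using le[of u] by (simp add: algebra_simps)
    qed simp
    moreover have "set ?ts \<subseteq> F - {0}" using ts(1) by auto
    ultimately have "real (length ?ts) * a \<le> sum_list ?ts" by blast
    then have "real (length ?ts) * a \<le> C" using s ts(3) by linarith
    then have "real (length ?ts) \<le> C / a" using a by (simp add: field_simps)
    then have "length ?ts \<le> ?N" by linarith
    then show "x \<in> sum_list ` {ts. set ts \<subseteq> F \<and> length ts \<le> ?N}"
      using s ts(1) by (intro image_eqI[of _ _ ?ts]) auto
  qed
  then show ?thesis using finite_lists_length_le[OF assms(1)] finite_subset by blast
qed

context fpp_config begin

text \<open>Between finitely many levels only finitely many sums lie below a given bound, so the infimum
  is attained.\<close>

lemma dT_attained:
  assumes R: "finite R" "interval R" and U: "\<exists>u\<in>U. u \<in> tube_verts K d \<and> fst u \<in> R"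
    and v: "v \<in> tube_verts K d" "fst v \<in> R"
  obtains ts where "walk \<tau> R U v ts" "dT \<tau> R U v = sum_list ts"
proof -
  let ?V = "{v \<in> tube_verts K d. fst v \<in> R}"
  let ?F = "(\<lambda>(u, v). \<tau> {u, v}) ` {(u, v) \<in> ?V \<times> ?V. adj u v}"
  let ?S = "sum_list ` {ts. walk \<tau> R U v ts}"
  have "{(u, v) \<in> ?V \<times> ?V. adj u v} \<subseteq> ?V \<times> ?V" by clarify
  then have fin: "finite ?F"
    using finite_cartesian_product[OF finite_tube_levels[OF R(1)] finite_tube_levels[OF R(1)]]
    by (intro finite_imageI) (rule finite_subset)
  have "ts \<in> lists ?F" if "walk \<tau> R U v ts" for v ts
    using that
  proof (induction rule: walk.induct)
    case (walk_step u ts v)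
    then have "(u, v) \<in> {(u, v) \<in> ?V \<times> ?V. adj u v}"
      using walk_vert[OF walk_step(1)] adjD[OF walk_step(2)] by simp
    then have "\<tau> {u, v} \<in> ?F" by (rule rev_image_eqI) simp
    then show ?case using walk_step by auto
  qed auto
  then have S: "?S \<subseteq> sum_list ` lists ?F" by blast
  obtain ts0 where ts0: "walk \<tau> R U v ts0" using U walk_exists[OF R(2) _ _ _ v] by blast
  let ?S' = "{x \<in> ?S. x \<le> sum_list ts0}"
  have "finite ?S'"
    by (rule finite_subset[OF _ finite_bounded_sums[OF fin, of "sum_list ts0"]]) (use S nonneg in auto)
  moreover have "sum_list ts0 \<in> ?S'" using ts0 by simp
  ultimately have m: "Min ?S' \<in> ?S'" "\<forall>x\<in>?S'. Min ?S' \<le> x" using Min_in[of ?S'] by (blast, simp)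
  have "Inf ?S = Min ?S'"
  proof (rule cInf_eq_minimum)
    show "Min ?S' \<le> x" if "x \<in> ?S" for x
      using m that by (cases "x \<le> sum_list ts0") auto
  qed (use m in blast)
  then show thesis using m(1) that unfolding dT_def by fastforce
qed

end

text \<open>Reflection exchanges the two ends of the tube, so that the estimates below are only needed for
  the right end.\<close>

definition flip :: "vertex \<Rightarrow> vertex" where
  "flip v = (- fst v, snd v)"

lemma flip_simps [simp]: "flip (flip v) = v" "fst (flip v) = - fst v" "snd (flip v) = snd v"
  by (auto simp: flip_def)

lemma flip_image [simp]: "flip ` flip ` A = A"
  by (simp add: image_image)

context tube begin

lemma flip_vert [simp]: "flip v \<in> tube_verts K d \<longleftrightarrow> v \<in> tube_verts K d"
  by (simp add: tube_verts_iff)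

lemma flip_adj [simp]: "adj (flip u) (flip v) \<longleftrightarrow> adj u v"
  by (simp add: adj_iff l1_dist_def abs_minus_commute)

lemma walk_flip:
  assumes "walk \<tau> R U v ts"
  shows "walk (\<lambda>e. \<tau> (flip ` e)) (uminus ` R) (flip ` U) (flip v) ts"
  using assms
proof (induction rule: walk.induct)
  case (walk_step u ts v)
  then show ?case
    using walk.walk_step[of "\<lambda>e. \<tau> (flip ` e)" "uminus ` R" "flip ` U" "flip u" ts "flip v"] by simp
qed (auto intro!: walk.walk_start)

lemma dT_flip: "dT (\<lambda>e. \<tau> (flip ` e)) (uminus ` R) (flip ` U) v = dT \<tau> R U (flip v)"
proof -
  have "walk (\<lambda>e. \<tau> (flip ` e)) (uminus ` R) (flip ` U) v ts \<longleftrightarrow> walk \<tau> R U (flip v) ts" for ts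
    using walk_flip[of "\<lambda>e. \<tau> (flip ` e)" "uminus ` R" "flip ` U" v ts] walk_flip[of \<tau> R U "flip v" ts]
    by (auto simp: image_image)
  then show ?thesis by (simp add: dT_def)
qed

end

section \<open>Pads: stretches that force regeneration\<close>

context tube begin

text \<open>On a pad the cheap edges are those of the line through the origin of the cross-section.
  The cross-section edges at the two end levels are only bounded from above, so that a pad may be
  adjacent to a segment that prescribes some of them.\<close>

definition pad :: "(edge \<Rightarrow> real) \<Rightarrow> int \<Rightarrow> nat \<Rightarrow> real \<Rightarrow> real \<Rightarrow> bool" where
  "pad \<tau> a L s th \<longleftrightarrow> (\<forall>u v. adj u v \<longrightarrow> fst u \<in> {a..a + int L} \<longrightarrow> fst v \<in> {a..a + int L} \<longrightarrow>
     (fst u \<noteq> fst v \<longrightarrow> \<tau> {u, v} = (if snd u = origin then s else th)) \<and>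
     (fst u = fst v \<longrightarrow> \<tau> {u, v} \<le> th \<and> (a < fst u \<and> fst u < a + int L \<longrightarrow> \<tau> {u, v} = th)))"

lemma pad_horizontal:
  "pad \<tau> a L s th \<Longrightarrow> adj u v \<Longrightarrow> fst u \<in> {a..a + int L} \<Longrightarrow> fst v \<in> {a..a + int L} \<Longrightarrow> fst u \<noteq> fst v \<Longrightarrow>
    \<tau> {u, v} = (if snd u = origin then s else th)"
  unfolding pad_def by blast

lemma pad_vertical:
  "pad \<tau> a L s th \<Longrightarrow> adj u v \<Longrightarrow> fst u \<in> {a..a + int L} \<Longrightarrow> fst u = fst v \<Longrightarrow> \<tau> {u, v} \<le> th"
  unfolding pad_def by simp

lemma pad_vertical_inner:
  "pad \<tau> a L s th \<Longrightarrow> adj u v \<Longrightarrow> a < fst u \<Longrightarrow> fst u < a + int L \<Longrightarrow> fst u = fst v \<Longrightarrow> \<tau> {u, v} = th"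
  unfolding pad_def by (metis atLeastAtMost_iff less_le_not_le)

lemma adj_vertical_shift:
  assumes "adj u v" "fst u = fst v" shows "adj (n, snd u) (n, snd v)"
  using assms by (simp add: adj_iff l1_dist_def tube_verts_iff)

lemma l1_dist_same_level:
  assumes "u \<in> tube_verts K d" "v \<in> tube_verts K d" "fst u = fst v"
  shows "l1_dist d u v \<le> int ((d - 1) * K)"
proof -
  have "(\<Sum>i<d - 1. \<bar>int (snd u i) - int (snd v i)\<bar>) \<le> (\<Sum>i<d - 1. int K)"
  proof (rule sum_mono)
    fix i assume "i \<in> {..<d - 1}"
    then have "snd u i < K" "snd v i < K" using assms by (auto simp: tube_verts_iff PiE_iff)
    then show "\<bar>int (snd u i) - int (snd v i)\<bar> \<le> int K" by auto
  qed
  then show ?thesis using assms(3) by (simp add: l1_dist_def)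
qed

lemma lip_vertical_bound:
  assumes h: "lip \<tau> {n} h" and th: "0 \<le> th"
    and le: "\<And>u v. adj u v \<Longrightarrow> fst u = n \<Longrightarrow> fst v = n \<Longrightarrow> \<tau> {u, v} \<le> th"
    and uv: "u \<in> tube_verts K d" "v \<in> tube_verts K d" "fst u = n" "fst v = n"
  shows "h u \<le> h v + real ((d - 1) * K) * th"
proof -
  obtain ts where ts: "walk \<tau> {n} {v} u ts" "int (length ts) = l1_dist d u v"
    using walk_l1[of u v "{n}" \<tau>] uv by auto
  from ts(1) have "sum_list ts \<le> real (length ts) * th"
  proof (induction rule: walk.induct)
    case (walk_step u ts v)
    then have "\<tau> {u, v} \<le> th" using le[OF walk_step(2)] walk_vert[OF walk_step(1)] by auto
    then show ?case using walk_step by (simp add: algebra_simps)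
  qed auto
  moreover have "int (length ts) \<le> int ((d - 1) * K)"
    unfolding ts(2) by (rule l1_dist_same_level) (use uv in auto)
  then have "real (length ts) * th \<le> real ((d - 1) * K) * th" using th by (intro mult_right_mono) linarith+
  moreover have "h u - h v \<le> sum_list ts" by (rule lip_walk[OF ts(1) lip_diff[OF h]]) auto
  ultimately show ?thesis by simp
qed

lemma lip_line:
  assumes h: "lip \<tau> R h" and R: "{a..a + int k} \<subseteq> R" and w: "(a, w) \<in> tube_verts K d"
    and le: "\<And>i. i \<in> {a..<a + int k} \<Longrightarrow> \<tau> {(i, w), (i + 1, w)} \<le> s"
  shows "h (a + int k, w) \<le> h (a, w) + real k * s"
  using R le
proof (induction k)
  case (Suc k)
  have "h (a + int k, w) \<le> h (a, w) + real k * s" by (rule Suc.IH) (use Suc.prems in auto)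
  moreover have "h (a + int k + 1, w) \<le> h (a + int k, w) + \<tau> {(a + int k, w), (a + int k + 1, w)}"
    using Suc.prems(1) by (intro lipD[OF h] adj_horizontal shift_vert[OF w]) auto
  moreover have "\<tau> {(a + int k, w), (a + int k + 1, w)} \<le> s" using Suc.prems(2)[of "a + int k"] by auto
  ultimately show ?case by (simp add: algebra_simps)
qed simp

end

text \<open>The length of a pad outweighs all detours within a cross-section.\<close>

locale pads = fpp_config +
  fixes L :: nat and s th :: real
  assumes s0: "0 \<le> s" and s_th: "s < th"
    and L_large: "2 * real ((d - 1) * K) * th \<le> real L * (th - s)"
begin

lemma th_pos: "0 < th" using s0 s_th by simp

lemma L_pos: "0 < L"
proof (rule ccontr)
  assume "\<not> 0 < L"
  then have "real L * (th - s) = 0" by simp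
  moreover have "0 < 2 * real ((d - 1) * K) * th"
    using d2 K2 th_pos by (intro mult_pos_pos) auto
  ultimately show False using L_large by linarith
qed

definition glue :: "int \<Rightarrow> (vertex \<Rightarrow> real) \<Rightarrow> (vertex \<Rightarrow> real) \<Rightarrow> vertex \<Rightarrow> real" where
  "glue a f g v = (if fst v \<le> a then f v else if a + int L \<le> fst v then g v
     else (1 - real_of_int (fst v - a) / real L) * f (a, snd v)
       + real_of_int (fst v - a) / real L * g (a + int L, snd v))"

lemma glue_left: "fst v \<le> a \<Longrightarrow> glue a f g v = f v"
  by (simp add: glue_def)

lemma glue_right: "a + int L \<le> fst v \<Longrightarrow> glue a f g v = g v"
  using L_pos by (simp add: glue_def)

text \<open>Across a pad any two potentials can be joined, as long as their values at the two ends of the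
  cheap line are compatible with it: linear interpolation changes slowly enough in the direction of
  the tube because the pad is long.\<close>

lemma lip_glue:
  assumes pad: "pad \<tau> a L s th" and f: "lip \<tau> (R \<inter> {..a}) f" and g: "lip \<tau> (R \<inter> {a + int L..}) g"
    and R: "{a..a + int L} \<subseteq> R"
    and le: "\<bar>g (a + int L, origin) - f (a, origin)\<bar> \<le> real L * s"
  shows "lip \<tau> R (glue a f g)"
  unfolding lip_def
proof (intro allI impI)
  fix u v assume uv: "adj u v" "fst u \<in> R" "fst v \<in> R"
  let ?b = "a + int L" and ?D = "real ((d - 1) * K)"
  have inner: "glue a f g x = (1 - real_of_int (fst x - a) / real L) * f (a, snd x)
       + real_of_int (fst x - a) / real L * g (?b, snd x)"
    if "fst x \<in> {a..?b}" for x
  proof (cases "fst x = a \<or> fst x = ?b")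
    case True
    then show ?thesis using L_pos by (cases x) (auto simp: glue_def)
  qed (use that in \<open>auto simp: glue_def\<close>)
  have fb: "f (a, w) \<le> f (a, w') + ?D * th" if "(a, w) \<in> tube_verts K d" "(a, w') \<in> tube_verts K d" for w w'
    by (rule lip_vertical_bound[of \<tau> a])
      (use that th_pos R L_pos in \<open>auto intro!: lip_mono[OF f] pad_vertical[OF pad]\<close>)
  have gb: "g (?b, w) \<le> g (?b, w') + ?D * th" if "(a, w) \<in> tube_verts K d" "(a, w') \<in> tube_verts K d" for w w'
    by (rule lip_vertical_bound[of \<tau> ?b])
      (use that th_pos R L_pos shift_vert in \<open>auto intro!: lip_mono[OF g] pad_vertical[OF pad]\<close>)
  consider "fst u \<le> a" "fst v \<le> a" | "?b \<le> fst u" "?b \<le> fst v"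
    | "fst u \<in> {a..?b}" "fst v \<in> {a..?b}" "a < fst u \<or> a < fst v" "fst u < ?b \<or> fst v < ?b"
    using L_pos by (cases rule: adj_cases[OF uv(1)]) (fastforce, fastforce)
  then show "glue a f g v \<le> glue a f g u + \<tau> {u, v}"
  proof cases
    case 1
    then show ?thesis using lipD[OF f uv(1)] uv by (simp add: glue_def)
  next
    case 2
    then show ?thesis using lipD[OF g uv(1)] uv L_pos by (auto simp: glue_def)
  next
    case 3
    from uv(1) show ?thesis
    proof (cases rule: adj_cases)
      case horizontal
      define w where "w = snd u"
      have w: "(a, w) \<in> tube_verts K d" using adjD(1)[OF uv(1)] by (simp add: w_def tube_verts_iff)
      have neq: "fst u \<noteq> fst v" using horizontal(2) by auto
      have "\<bar>g (?b, w) - f (a, w)\<bar> \<le> real L * \<tau> {u, v}"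
      proof (cases "w = origin")
        case True
        then show ?thesis using pad_horizontal[OF pad uv(1) 3(1,2) neq] le by (simp add: w_def)
      next
        case False
        \<comment> \<open>Off the cheap line the total increment exceeds that of the line by at most the variation of
          \<open>f\<close> and \<open>g\<close> within the two end levels, and it is spread over \<open>L\<close> steps.\<close>
        have "\<bar>g (?b, w) - f (a, w)\<bar> \<le> real L * s + 2 * ?D * th"
          using le fb[OF w origin_vert] fb[OF origin_vert w] gb[OF w origin_vert] gb[OF origin_vert w]
          by linarith
        also have "\<dots> \<le> real L * th" using L_large by (simp add: algebra_simps)
        finally show ?thesis using pad_horizontal[OF pad uv(1) 3(1,2) neq] False by (simp add: w_def)
      qed
      moreover define x where "x = (g (?b, w) - f (a, w)) / L"
      moreover have "g (?b, w) - f (a, w) = real L * x" using L_pos by (simp add: x_def)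
      ultimately have "real L * \<bar>x\<bar> \<le> real L * \<tau> {u, v}" by (metis abs_mult abs_of_nat)
      then have x: "\<bar>x\<bar> \<le> \<tau> {u, v}" by (rule mult_left_le_imp_le) (use L_pos in simp)
      have "glue a f g v - glue a f g u = (real_of_int (fst v - fst u)) * x"
        using horizontal(1) L_pos unfolding inner[OF 3(1)] inner[OF 3(2)] w_def x_def
        by (simp add: field_simps)
      moreover have "real_of_int (fst v - fst u) = 1 \<or> real_of_int (fst v - fst u) = - 1"
        using horizontal(2) by linarith
      ultimately have "glue a f g v - glue a f g u = x \<or> glue a f g v - glue a f g u = - x" by auto
      then show ?thesis using x by linarith
    next
      case vertical
      define t where "t = real_of_int (fst u - a) / real L"
      have t: "0 \<le> t" "t \<le> 1" using 3 L_pos by (auto simp: t_def field_simps)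
      have "f (a, snd v) \<le> f (a, snd u) + \<tau> {(a, snd u), (a, snd v)}"
        using adj_vertical_shift[OF uv(1) vertical(1)] R L_pos by (intro lipD[OF f]) auto
      moreover have "\<tau> {(a, snd u), (a, snd v)} \<le> th"
        using adj_vertical_shift[OF uv(1) vertical(1)] by (intro pad_vertical[OF pad]) auto
      ultimately have 1: "f (a, snd v) \<le> f (a, snd u) + th" by simp
      have "g (?b, snd v) \<le> g (?b, snd u) + \<tau> {(?b, snd u), (?b, snd v)}"
        using adj_vertical_shift[OF uv(1) vertical(1)] R L_pos by (intro lipD[OF g]) auto
      moreover have "\<tau> {(?b, snd u), (?b, snd v)} \<le> th"
        using adj_vertical_shift[OF uv(1) vertical(1)] by (intro pad_vertical[OF pad]) auto
      ultimately have 2: "g (?b, snd v) \<le> g (?b, snd u) + th" by simp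
      have "(1 - t) * f (a, snd v) + t * g (?b, snd v) \<le> (1 - t) * (f (a, snd u) + th) + t * (g (?b, snd u) + th)"
        using t 1 2 by (intro add_mono mult_left_mono) auto
      moreover have "\<tau> {u, v} = th"
        using 3 vertical by (intro pad_vertical_inner[OF pad uv(1)]) auto
      moreover have "(1 - t) * (f (a, snd u) + th) + t * (g (?b, snd u) + th)
          = (1 - t) * f (a, snd u) + t * g (?b, snd u) + th" by (simp add: algebra_simps)
      moreover have "glue a f g u = (1 - t) * f (a, snd u) + t * g (?b, snd u)"
        "glue a f g v = (1 - t) * f (a, snd v) + t * g (?b, snd v)"
        using vertical(1) by (simp_all add: inner[OF 3(1)] inner[OF 3(2)] t_def)
      ultimately show ?thesis by linarith
    qed
  qed
qed

text \<open>An excursion into the pad gains nothing: the restricted passage time stays a potential when it is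
  interpolated to its value at the beginning of the cheap line and kept constant beyond the pad.\<close>

lemma dT_below_pad:
  assumes pad: "pad \<tau> a L s th" and R: "interval R" "{a..a + int L} \<subseteq> R"
    and U: "\<exists>u\<in>U. u \<in> tube_verts K d \<and> fst u \<in> R" "\<And>u. u \<in> U \<Longrightarrow> fst u \<le> a"
    and v: "v \<in> tube_verts K d" "fst v \<in> R" "fst v \<le> a"
  shows "dT \<tau> R U v = dT \<tau> (R \<inter> {..a}) U v"
proof (rule antisym)
  have R': "interval (R \<inter> {..a})" using R(1) by (intro interval_Int) auto
  have U': "\<exists>u\<in>U. u \<in> tube_verts K d \<and> fst u \<in> R \<inter> {..a}" using U by auto
  show "dT \<tau> R U v \<le> dT \<tau> (R \<inter> {..a}) U v"
    using v dT_source by (intro dT_greatest R' U' lip_mono[OF dT_lip[OF R(1) U(1)]]) auto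
  let ?f = "dT \<tau> (R \<inter> {..a}) U"
  let ?h = "glue a ?f (\<lambda>_. ?f (a, origin))"
  have "lip \<tau> (R \<inter> {a + int L..}) (\<lambda>_. ?f (a, origin))" using nonneg by (simp add: lip_def)
  then have lip: "lip \<tau> R ?h" using s0 by (intro lip_glue pad dT_lip R' U' R(2)) auto
  have "?h v \<le> dT \<tau> R U v"
    by (rule dT_greatest[OF R(1) U(1) lip]) (use v U(2) dT_source in \<open>auto simp: glue_left\<close>)
  then show "?f v \<le> dT \<tau> R U v" using v by (simp add: glue_left)
qed

lemma dT_above_pad:
  assumes pad: "pad \<tau> a L s th" and R: "interval R" "{a..a + int L} \<subseteq> R"
    and U: "\<exists>u\<in>U. u \<in> tube_verts K d \<and> fst u \<in> R" "\<And>u. u \<in> U \<Longrightarrow> a + int L \<le> fst u"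
    and v: "v \<in> tube_verts K d" "fst v \<in> R" "a + int L \<le> fst v"
  shows "dT \<tau> R U v = dT \<tau> (R \<inter> {a + int L..}) U v"
proof (rule antisym)
  let ?b = "a + int L"
  have R': "interval (R \<inter> {?b..})" using R(1) by (intro interval_Int) auto
  have U': "\<exists>u\<in>U. u \<in> tube_verts K d \<and> fst u \<in> R \<inter> {?b..}" using U by auto
  show "dT \<tau> R U v \<le> dT \<tau> (R \<inter> {?b..}) U v"
    using v dT_source by (intro dT_greatest R' U' lip_mono[OF dT_lip[OF R(1) U(1)]]) auto
  let ?g = "dT \<tau> (R \<inter> {?b..}) U"
  let ?h = "glue a (\<lambda>_. ?g (?b, origin)) ?g"
  have "lip \<tau> (R \<inter> {..a}) (\<lambda>_. ?g (?b, origin))" using nonneg by (simp add: lip_def)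
  then have lip: "lip \<tau> R ?h" using s0 by (intro lip_glue pad dT_lip R' U' R(2)) auto
  have "?h v \<le> dT \<tau> R U v"
    by (rule dT_greatest[OF R(1) U(1) lip]) (use v U(2) dT_source in \<open>auto simp: glue_right\<close>)
  then show "?g v \<le> dT \<tau> R U v" using v by (simp add: glue_right)
qed

text \<open>An optimal route across a pad may be taken through the whole cheap line: for the lower bound, the
  passage times on the two sides, the second one shifted by the cost of that line, are glued.\<close>

lemma dT_across_pad:
  assumes pad: "pad \<tau> a L s th" and R: "interval R" "{a..a + int L} \<subseteq> R"
    and U: "\<exists>u\<in>U. u \<in> tube_verts K d \<and> fst u \<in> R" "\<And>u. u \<in> U \<Longrightarrow> fst u \<le> a"
    and v: "v \<in> tube_verts K d" "fst v \<in> R" "a + int L \<le> fst v"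
  shows "dT \<tau> R U v = dT \<tau> (R \<inter> {..a}) U (a, origin) + real L * s
      + dT \<tau> (R \<inter> {a + int L..}) {(a + int L, origin)} v"
proof (rule antisym)
  let ?b = "a + int L"
  let ?z = "(?b, origin)"
  have a: "a \<in> R" "?b \<in> R" using R(2) by auto
  have R1: "interval (R \<inter> {..a})" and R2: "interval (R \<inter> {?b..})" using R(1) by (auto intro!: interval_Int)
  have U1: "\<exists>u\<in>U. u \<in> tube_verts K d \<and> fst u \<in> R \<inter> {..a}" using U by auto
  have U2: "\<exists>u\<in>{?z}. u \<in> tube_verts K d \<and> fst u \<in> R \<inter> {?b..}" using a origin_vert by auto
  let ?h = "dT \<tau> R U"
  have h: "lip \<tau> R ?h" by (rule dT_lip[OF R(1) U(1)])
  have "?h v - ?h ?z \<le> dT \<tau> (R \<inter> {?b..}) {?z} v"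
    using v by (intro dT_greatest R2 U2 lip_diff lip_mono[OF h]) auto
  moreover have "?h ?z \<le> ?h (a, origin) + real L * s"
  proof (rule lip_line[OF h R(2) origin_vert])
    fix i assume "i \<in> {a..<?b}"
    then have "\<tau> {(i, origin), (i + 1, origin)} = s"
      using pad_horizontal[OF pad adj_horizontal[OF origin_vert], of i] by auto
    then show "\<tau> {(i, origin), (i + 1, origin)} \<le> s" by simp
  qed
  moreover have "?h (a, origin) \<le> dT \<tau> (R \<inter> {..a}) U (a, origin)"
    using a dT_source by (intro dT_greatest R1 U1 lip_mono[OF h] origin_vert) auto
  ultimately show "?h v \<le> dT \<tau> (R \<inter> {..a}) U (a, origin) + real L * s + dT \<tau> (R \<inter> {?b..}) {?z} v"
    by linarith
  let ?f = "dT \<tau> (R \<inter> {..a}) U"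
  define c where "c = ?f (a, origin) + real L * s"
  let ?g = "\<lambda>v. c + dT \<tau> (R \<inter> {?b..}) {?z} v"
  have "dT \<tau> (R \<inter> {?b..}) {?z} ?z = 0"
    by (intro antisym dT_source dT_nonneg R2 U2 origin_vert) (use a origin_vert in auto)
  then have lip: "lip \<tau> R (glue a ?f ?g)"
    using lip_glue[OF pad dT_lip[OF R1 U1] lip_add[OF dT_lip[OF R2 U2]] R(2)] s0 by (simp add: c_def)
  have "glue a ?f ?g v \<le> ?h v"
    by (rule dT_greatest[OF R(1) U(1) lip]) (use v U(2) dT_source in \<open>auto simp: glue_left\<close>)
  then show "?f (a, origin) + real L * s + dT \<tau> (R \<inter> {?b..}) {?z} v \<le> ?h v"
    using v by (simp add: glue_right c_def)
qed

end

section \<open>Segments and the effect of a swap\<close>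

context tube begin

definition straight :: "(edge \<Rightarrow> real) \<Rightarrow> int \<Rightarrow> nat \<Rightarrow> real \<Rightarrow> bool" where
  "straight \<tau> a L s \<longleftrightarrow> (\<forall>u v. adj u v \<longrightarrow> fst u \<in> {a..a + int L} \<longrightarrow> fst v \<in> {a..a + int L} \<longrightarrow>
     fst u \<noteq> fst v \<longrightarrow> s \<le> \<tau> {u, v} \<and> (snd u = origin \<longrightarrow> \<tau> {u, v} = s))"

definition detour :: "(edge \<Rightarrow> real) \<Rightarrow> int \<Rightarrow> nat \<Rightarrow> real \<Rightarrow> real \<Rightarrow> real \<Rightarrow> real \<Rightarrow> bool" where
  "detour \<tau> a L s th lam mu \<longleftrightarrow>
     (\<forall>u v. adj u v \<longrightarrow> fst u \<in> {a..a + int L} \<longrightarrow> fst v \<in> {a..a + int L} \<longrightarrow>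
       (fst u \<noteq> fst v \<longrightarrow> \<tau> {u, v} = (if snd u = unit1 then s else th)) \<and>
       (fst u = fst v \<longrightarrow> \<tau> {u, v} =
          (if {snd u, snd v} = {origin, unit1} \<and> fst u = a then lam
           else if {snd u, snd v} = {origin, unit1} \<and> fst u = a + int L then mu else th)))"

end

context pads begin

lemma dT_straight:
  assumes seg: "straight \<tau> a L s"
  shows "dT \<tau> {a..a + int L} {(a, origin)} (a + int L, origin) = real L * s"
proof (rule antisym)
  let ?R = "{a..a + int L}" and ?U = "{(a, origin)}"
  have R: "interval ?R" by simp
  have U: "\<exists>u\<in>?U. u \<in> tube_verts K d \<and> fst u \<in> ?R" using origin_vert by simp
  have "dT \<tau> ?R ?U (a + int L, origin) \<le> dT \<tau> ?R ?U (a, origin) + real L * s"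
  proof (rule lip_line[OF dT_lip[OF R U] subset_refl origin_vert])
    fix i assume "i \<in> {a..<a + int L}"
    then show "\<tau> {(i, origin), (i + 1, origin)} \<le> s"
      using seg adj_horizontal[OF origin_vert, of i] unfolding straight_def by force
  qed
  moreover have "dT \<tau> ?R ?U (a, origin) \<le> 0" by (rule dT_source) (use origin_vert in auto)
  ultimately show "dT \<tau> ?R ?U (a + int L, origin) \<le> real L * s" by simp
  let ?h = "\<lambda>v. s * real_of_int (fst v - a)"
  have lip: "lip \<tau> ?R ?h"
    unfolding lip_def
  proof (intro allI impI)
    fix u v assume uv: "adj u v" "fst u \<in> ?R" "fst v \<in> ?R"
    from uv(1) show "?h v \<le> ?h u + \<tau> {u, v}"
    proof (cases rule: adj_cases)
      case horizontal
      then have "fst u \<noteq> fst v" by auto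
      then have "s \<le> \<tau> {u, v}" using seg uv unfolding straight_def by blast
      moreover have "real_of_int (fst v - a) = real_of_int (fst u - a) + 1
          \<or> real_of_int (fst v - a) = real_of_int (fst u - a) - 1" using horizontal(2) by linarith
      then have "?h v = ?h u + s \<or> ?h v = ?h u - s"
        by (elim disjE) (simp_all only: distrib_left right_diff_distrib mult_1_right simp_thms)
      ultimately show ?thesis using s0 by linarith
    next
      case vertical
      then show ?thesis using nonneg uv by simp
    qed
  qed
  have "?h (a + int L, origin) \<le> dT \<tau> ?R ?U (a + int L, origin)"
    by (rule dT_greatest[OF R U lip]) (use origin_vert in auto)
  then show "real L * s \<le> dT \<tau> ?R ?U (a + int L, origin)" by (simp add: mult.commute)
qed

text \<open>The lower bound comes from a potential that climbs by the extra amount \<open>lam + mu\<close> evenly along the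
  segment, except on the neighbouring line, where it is ahead by \<open>lam\<close> throughout. Then the cross edge \<open>lam\<close> is tight
  at the beginning and the cross edge \<open>mu\<close> at the end, and the length of the segment makes the slope
  admissible on the expensive lines.\<close>

lemma dT_detour:
  assumes seg: "detour \<tau> a L s th lam mu" and lam: "0 \<le> lam" "lam \<le> th" and mu: "0 \<le> mu" "mu \<le> th"
  shows "dT \<tau> {a..a + int L} {(a, origin)} (a + int L, origin) = real L * s + lam + mu"
proof (rule antisym)
  let ?b = "a + int L"
  let ?R = "{a..?b}" and ?U = "{(a, origin)}"
  have R: "interval ?R" by simp
  have U: "\<exists>u\<in>?U. u \<in> tube_verts K d \<and> fst u \<in> ?R" using origin_vert by simp
  let ?h = "dT \<tau> ?R ?U"
  have h: "lip \<tau> ?R ?h" by (rule dT_lip[OF R U])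
  have hor: "\<tau> {u, v} = (if snd u = unit1 then s else th)"
    if "adj u v" "fst u \<in> ?R" "fst v \<in> ?R" "fst u \<noteq> fst v" for u v
    using seg that unfolding detour_def by blast
  have ver: "\<tau> {u, v} = (if {snd u, snd v} = {origin, unit1} \<and> fst u = a then lam
           else if {snd u, snd v} = {origin, unit1} \<and> fst u = ?b then mu else th)"
    if "adj u v" "fst u \<in> ?R" "fst u = fst v" for u v
    using seg that unfolding detour_def by (metis (no_types, lifting))
  have "?h (a, unit1) \<le> ?h (a, origin) + \<tau> {(a, origin), (a, unit1)}"
    by (rule lipD[OF h adj_origin_unit1]) auto
  also have "\<tau> {(a, origin), (a, unit1)} = lam"
    by (subst ver[OF adj_origin_unit1]) auto
  finally have 1: "?h (a, unit1) \<le> lam"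
    using dT_source[of "(a, origin)" ?U ?R] origin_vert by simp
  have 2: "?h (?b, unit1) \<le> ?h (a, unit1) + real L * s"
  proof (rule lip_line[OF h subset_refl unit1_vert])
    fix i assume "i \<in> {a..<?b}"
    then show "\<tau> {(i, unit1), (i + 1, unit1)} \<le> s"
      using hor[OF adj_horizontal[OF unit1_vert], of i] by force
  qed
  have "?h (?b, origin) \<le> ?h (?b, unit1) + \<tau> {(?b, unit1), (?b, origin)}"
    by (rule lipD[OF h adj_sym[OF adj_origin_unit1]]) auto
  also have "\<tau> {(?b, unit1), (?b, origin)} = mu"
    using L_pos by (subst ver[OF adj_sym[OF adj_origin_unit1]]) auto
  finally show "?h (?b, origin) \<le> real L * s + lam + mu" using 1 2 by simp

  have "1 \<le> (d - 1) * K" using d2 K2 by simp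
  then have "1 \<le> real ((d - 1) * K)" by (metis of_nat_1 of_nat_le_iff)
  then have "1 * th \<le> real ((d - 1) * K) * th" by (rule mult_right_mono) (use th_pos in simp)
  then have "lam + mu \<le> real L * (th - s)" using L_large lam mu by linarith
  moreover define q where "q = (lam + mu) / L"
  ultimately have "q \<le> th - s" using L_pos by (simp add: pos_divide_le_eq mult.commute)
  then have slope: "s + q \<le> th" by simp
  have q: "0 \<le> q" "q * L = lam + mu" using lam mu L_pos by (simp_all add: q_def)
  let ?j = "\<lambda>v. real_of_int (fst v - a)"
  let ?p = "\<lambda>v. s * ?j v + (if snd v = unit1 then lam else q * ?j v)"
  have lip: "lip \<tau> ?R ?p"
    unfolding lip_def
  proof (intro allI impI)
    fix u v assume uv: "adj u v" "fst u \<in> ?R" "fst v \<in> ?R"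
    from uv(1) show "?p v \<le> ?p u + \<tau> {u, v}"
    proof (cases rule: adj_cases)
      case horizontal
      then have t: "\<tau> {u, v} = (if snd u = unit1 then s else th)" using uv by (intro hor) auto
      have "?j v = ?j u + 1 \<or> ?j v = ?j u - 1" using horizontal(2) by linarith
      then have "s * ?j v = s * ?j u + s \<and> q * ?j v = q * ?j u + q
          \<or> s * ?j v = s * ?j u - s \<and> q * ?j v = q * ?j u - q"
        by (elim disjE) (simp_all only: distrib_left right_diff_distrib mult_1_right simp_thms)
      then show ?thesis using horizontal(1) t slope s0 q(1) by (cases "snd u = unit1") (simp; linarith)+
    next
      case vertical
      define x where "x = q * ?j v"
      have "0 \<le> ?j v" "?j v \<le> L" using uv(3) by auto
      then have "x \<le> q * L" "0 \<le> x"
        unfolding x_def using q(1) by (intro mult_left_mono mult_nonneg_nonneg; simp)+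
      then have x: "0 \<le> x" "x \<le> lam + mu" using q(2) by auto
      have t: "\<tau> {u, v} = (if {snd u, snd v} = {origin, unit1} \<and> fst u = a then lam
           else if {snd u, snd v} = {origin, unit1} \<and> fst u = ?b then mu else th)"
        using ver[OF uv(1,2) vertical(1)] .
      have xa: "x = 0" if "fst u = a" using that vertical(1) by (simp add: x_def)
      have xb: "x = lam + mu" if "fst u = ?b" using that vertical(1) q(2) by (simp add: x_def)
      have pv: "?p v = s * ?j v + (if snd v = unit1 then lam else x)"
        and pu: "?p u = s * ?j v + (if snd u = unit1 then lam else x)"
        using vertical(1) by (simp_all add: x_def)
      have n: "0 \<le> \<tau> {u, v}" using nonneg uv(1) by blast
      show ?thesis unfolding pv pu using t x xa xb lam mu vertical(2) n by (auto split: if_splits)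
    qed
  qed
  have "?p (?b, origin) \<le> ?h (?b, origin)"
    by (rule dT_greatest[OF R U lip]) (use origin_vert origin_neq_unit1 in auto)
  then show "real L * s + lam + mu \<le> ?h (?b, origin)"
    using origin_neq_unit1 q(2) by (simp add: mult.commute)
qed

lemma dT_right_block:
  assumes pad1: "pad \<tau> n L s th" and pad2: "pad \<tau> (n + 2 * int L) L s th"
    and U: "\<exists>u\<in>U. u \<in> tube_verts K d" "\<And>u. u \<in> U \<Longrightarrow> fst u \<le> n"
    and v: "v \<in> tube_verts K d" "n + 3 * int L \<le> fst v"
  shows "dT \<tau> UNIV U v = dT \<tau> {..n} U (n, origin) + 2 * real L * s
      + dT \<tau> {n + int L..n + int L + int L} {(n + int L, origin)} (n + int L + int L, origin)
      + dT \<tau> {n + 3 * int L..} {(n + 3 * int L, origin)} v"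
proof -
  have "dT \<tau> UNIV U v = dT \<tau> (UNIV \<inter> {..n}) U (n, origin) + real L * s
      + dT \<tau> (UNIV \<inter> {n + int L..}) {(n + int L, origin)} v"
    using U v by (intro dT_across_pad pad1) auto
  moreover have "dT \<tau> {n + int L..} {(n + int L, origin)} v =
      dT \<tau> ({n + int L..} \<inter> {..n + 2 * int L}) {(n + int L, origin)} (n + 2 * int L, origin) + real L * s
      + dT \<tau> ({n + int L..} \<inter> {n + 2 * int L + int L..}) {(n + 2 * int L + int L, origin)} v"
    using v origin_vert by (intro dT_across_pad pad2) auto
  moreover have "{n + int L..} \<inter> {..n + 2 * int L} = {n + int L..n + int L + int L}"
    "{n + int L..} \<inter> {n + 2 * int L + int L..} = {n + 3 * int L..}"
    "n + 2 * int L = n + int L + int L" "n + 2 * int L + int L = n + 3 * int L" by auto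
  ultimately show ?thesis by (simp add: algebra_simps)
qed

end

text \<open>By regeneration at the two pads, only the cost of the segment itself changes.\<close>

lemma swap_right:
  assumes P: "pads K d \<tau> L s th" and P': "pads K d \<tau>' L s th"
    and pad: "tube.pad K d \<tau> n L s th" "tube.pad K d \<tau> (n + 2 * int L) L s th"
    and pad': "tube.pad K d \<tau>' n L s th" "tube.pad K d \<tau>' (n + 2 * int L) L s th"
    and seg: "tube.straight K d \<tau> (n + int L) L s" and seg': "tube.detour K d \<tau>' (n + int L) L s th lam mu"
    and lam: "0 \<le> lam" "lam \<le> th" and mu: "0 \<le> mu" "mu \<le> th"
    and eq: "\<And>e. e \<in> tube_edges K d \<Longrightarrow> \<not> fst ` e \<subseteq> {n + int L..n + 2 * int L} \<Longrightarrow> \<tau> e = \<tau>' e"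
    and U: "\<exists>u\<in>U. u \<in> tube_verts K d" "\<And>u. u \<in> U \<Longrightarrow> fst u \<le> n"
    and v: "v \<in> tube_verts K d"
  shows "n + 3 * int L \<le> fst v \<Longrightarrow> tube.dT K d \<tau>' UNIV U v = tube.dT K d \<tau> UNIV U v + (lam + mu)"
    and "fst v \<le> n \<Longrightarrow> tube.dT K d \<tau>' UNIV U v = tube.dT K d \<tau> UNIV U v"
proof -
  interpret p: pads K d \<tau> L s th by (rule P)
  interpret p': pads K d \<tau>' L s th by (rule P')
  have left: "p.dT \<tau>' {..n} U x = p.dT \<tau> {..n} U x" for x
    using p.L_pos by (intro p.dT_cong eq[symmetric]) auto
  {
    assume v3: "n + 3 * int L \<le> fst v"
    have "p.dT \<tau>' {n + 3 * int L..} W x = p.dT \<tau> {n + 3 * int L..} W x" for W x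
      using p.L_pos by (intro p.dT_cong eq[symmetric]) auto
    then show "p.dT \<tau>' UNIV U v = p.dT \<tau> UNIV U v + (lam + mu)"
      using p.dT_right_block[OF pad U v v3] p'.dT_right_block[OF pad' U v v3] left
        p.dT_straight[OF seg] p'.dT_detour[OF seg' lam mu] by simp
  }
  assume "fst v \<le> n"
  then have "p.dT \<tau> UNIV U v = p.dT \<tau> (UNIV \<inter> {..n}) U v" "p.dT \<tau>' UNIV U v = p.dT \<tau>' (UNIV \<inter> {..n}) U v"
    by (intro p.dT_below_pad[OF pad(1)] p'.dT_below_pad[OF pad'(1)]; use U v in simp)+
  then show "p.dT \<tau>' UNIV U v = p.dT \<tau> UNIV U v" using left by simp
qed

text \<open>The left pad confines the first part of a route to the box; the part beyond the right pad costs the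
  same in both configurations and cancels.\<close>

lemma regeneration_right:
  assumes P: "pads K d \<tau> L s th" and P': "pads K d \<tau>' L s th"
    and pad: "tube.pad K d \<tau> n L s th" "tube.pad K d \<tau> (- n - int L) L s th"
    and pad': "tube.pad K d \<tau>' n L s th" "tube.pad K d \<tau>' (- n - int L) L s th"
    and eq: "\<And>e. e \<in> tube_edges K d \<Longrightarrow> fst ` e \<subseteq> {n + int L..} \<Longrightarrow> \<tau> e = \<tau>' e"
    and U: "\<exists>u\<in>U. u \<in> tube_verts K d" "\<And>u. u \<in> U \<Longrightarrow> fst u \<in> {- n..n}"
    and U': "\<exists>u\<in>U'. u \<in> tube_verts K d" "\<And>u. u \<in> U' \<Longrightarrow> fst u \<in> {- n..n}"
    and v: "v \<in> tube_verts K d" "n + int L \<le> fst v"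
  shows "tube.dT K d \<tau> UNIV U v - tube.dT K d \<tau>' UNIV U' v =
    tube.dT K d \<tau> {- n..n} U (n, tube.origin d) - tube.dT K d \<tau>' {- n..n} U' (n, tube.origin d)"
proof -
  interpret p: pads K d \<tau> L s th by (rule P)
  interpret p': pads K d \<tau>' L s th by (rule P')
  obtain u where u: "u \<in> U" "u \<in> tube_verts K d" using U by blast
  then have n: "- n \<le> n" using U(2)[OF u(1)] by auto
  have box: "{..n} \<inter> {- n - int L + int L..} = {- n..n}" by auto
  have "p.dT \<tau> UNIV U v = p.dT \<tau> (UNIV \<inter> {..n}) U (n, p.origin) + real L * s
      + p.dT \<tau> (UNIV \<inter> {n + int L..}) {(n + int L, p.origin)} v"
    using U v by (intro p.dT_across_pad pad) auto
  moreover have "p.dT \<tau> {..n} U (n, p.origin) = p.dT \<tau> ({..n} \<inter> {- n - int L + int L..}) U (n, p.origin)"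
    using U n by (intro p.dT_above_pad pad) (auto simp: p.origin_vert)
  moreover have "p.dT \<tau>' UNIV U' v = p.dT \<tau>' (UNIV \<inter> {..n}) U' (n, p.origin) + real L * s
      + p.dT \<tau>' (UNIV \<inter> {n + int L..}) {(n + int L, p.origin)} v"
    using U' v by (intro p'.dT_across_pad pad') auto
  moreover have "p.dT \<tau>' {..n} U' (n, p.origin) = p.dT \<tau>' ({..n} \<inter> {- n - int L + int L..}) U' (n, p.origin)"
    using U' n by (intro p'.dT_above_pad pad') (auto simp: p.origin_vert)
  moreover have "p.dT \<tau> {n + int L..} W x = p.dT \<tau>' {n + int L..} W x" for W x
    by (intro p.dT_cong eq) auto
  ultimately show ?thesis unfolding box by simp
qed

section \<open>Signed sums of an even number of point masses\<close>

definition signed_sum :: "(bool \<times> real) list \<Rightarrow> real" where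
  "signed_sum zs = (\<Sum>(b, r)\<leftarrow>zs. if b then r else - r)"

definition pair_sum :: "(bool \<times> real \<times> real) list \<Rightarrow> real" where
  "pair_sum ps = (\<Sum>(b, x, y)\<leftarrow>ps. if b then x + y else - (x + y))"

lemma signed_sum_simps [simp]:
  "signed_sum [] = 0" "signed_sum (z # zs) = (if fst z then snd z else - snd z) + signed_sum zs"
  "signed_sum (zs @ zs') = signed_sum zs + signed_sum zs'"
  by (auto simp: signed_sum_def split_beta)

lemma pair_sum_simps [simp]:
  "pair_sum [] = 0"
  "pair_sum ((b, x, y) # ps) = (if b then x + y else - (x + y)) + pair_sum ps"
  by (auto simp: pair_sum_def)

text \<open>Opposite signs are paired by \<open>x - y = (x + y) - (y + y)\<close>.\<close>

lemma signed_sum_pairs: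
  assumes "even (length zs)" "set zs \<subseteq> UNIV \<times> A"
  shows "\<exists>ps. set ps \<subseteq> UNIV \<times> A \<times> A \<and> signed_sum zs = pair_sum ps"
  using assms
proof (induction zs rule: induct_list012)
  case 1
  then show ?case by (intro exI[of _ "[]"]) simp
next
  case (3 z z' zs)
  then obtain ps where ps: "set ps \<subseteq> UNIV \<times> A \<times> A" "signed_sum zs = pair_sum ps" by auto
  obtain b x b' y where z: "z = (b, x)" "z' = (b', y)" by (metis surj_pair)
  have A: "x \<in> A" "y \<in> A" using 3 z by auto
  show ?case
    by (rule exI[of _ "if b = b' then (b, x, y) # ps else (b, x, y) # (b', y, y) # ps"])
      (use ps z A in auto)
qed simp

lemma odd_relation:
  fixes J :: "nat set" and n :: "nat \<Rightarrow> int" and t :: "nat \<Rightarrow> real"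
  assumes "finite J" "\<forall>j\<in>J. t j \<in> A"
  shows "\<exists>zs. set zs \<subseteq> UNIV \<times> A \<and> signed_sum zs = (\<Sum>j\<in>J. of_int (n j) * t j) \<and>
    (even (length zs) \<longleftrightarrow> even (\<Sum>j\<in>J. n j))"
  using assms
proof (induction rule: finite_induct)
  case empty
  then show ?case by (intro exI[of _ "[]"]) simp
next
  case (insert j J)
  then obtain zs where zs: "set zs \<subseteq> UNIV \<times> A" "signed_sum zs = (\<Sum>j\<in>J. of_int (n j) * t j)"
    "even (length zs) \<longleftrightarrow> even (\<Sum>j\<in>J. n j)" by auto
  have rep: "signed_sum (replicate k z) = real k * (if fst z then snd z else - snd z)" for k z
    by (induction k) (auto simp: algebra_simps)
  let ?r = "replicate (nat \<bar>n j\<bar>) (0 \<le> n j, t j)"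
  have "signed_sum ?r = of_int (n j) * t j" by (simp add: rep abs_if)
  moreover have "even (length ?r) \<longleftrightarrow> even (n j)" by (simp add: even_nat_iff)
  moreover have "set ?r \<subseteq> UNIV \<times> A" using insert by (auto simp: set_replicate_conv_if)
  ultimately show ?case using zs insert by (intro exI[of _ "?r @ zs"]) auto
qed

section \<open>Shells and the coupling map\<close>

type_synonym config = "edge \<Rightarrow> real"

text \<open>An item prescribes a side of the tube, a sign and two point masses. It stands for the amount
  \<open>\<plusminus>(lam + mu)\<close> that the difference of the two passage times on that side still has to lose.\<close>

type_synonym item = "bool \<times> bool \<times> real \<times> real"

definition debt :: "bool \<Rightarrow> item list \<Rightarrow> real" where
  "debt sd is = (\<Sum>(sd', sg, lam, mu)\<leftarrow>is. if sd' = sd then (if sg then lam + mu else - (lam + mu)) else 0)"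

lemma debt_simps [simp]:
  "debt sd [] = 0"
  "debt sd ((sd', sg, lam, mu) # is) =
    (if sd' = sd then (if sg then lam + mu else - (lam + mu)) else 0) + debt sd is"
  by (auto simp: debt_def)

lemma debt_append [simp]: "debt sd (xs @ ys) = debt sd xs + debt sd ys"
  by (simp add: debt_def)

lemma debt_map_pairs:
  "debt sd (map (Pair sd') ps) = (if sd = sd' then pair_sum ps else 0)"
  by (induction ps) auto

locale scheme = tube +
  fixes Lam :: "real set" and s t :: real and L m M :: nat and I I' :: "vertex set"
  assumes Lam_nonneg: "Lam \<subseteq> {0..}" and s_Lam: "s \<in> Lam" and t_Lam: "t \<in> Lam" and s_t: "s < t"
    and L_large: "2 * real ((d - 1) * K) * t \<le> real L * (t - s)"
    and I: "I \<noteq> {}" "I \<subseteq> tube_verts K d" "fst ` I \<subseteq> {- int M..int M}"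
    and I': "I' \<noteq> {}" "I' \<subseteq> tube_verts K d" "fst ` I' \<subseteq> {- int M..int M}"
    and arith: "(\<exists>(J :: nat set) (t :: nat \<Rightarrow> real) (n :: nat \<Rightarrow> int).
            finite J \<and> (\<forall>j\<in>J. t j \<in> Lam) \<and>
            odd (\<Sum>j\<in>J. n j) \<and> (\<Sum>j\<in>J. of_int (n j) * t j) = 0)
         \<or> (\<forall>x\<in>I. \<forall>y\<in>I'. even (graph_dist K d x y))"
begin

text \<open>The boxes \<open>A k\<close> exhaust the edges, starting from the edges that are given; the shell \<open>S k\<close> is what the
  next box adds. Each end of a shell consists of three stretches of length \<open>L\<close> and one more level, since the
  cross-section edges of the outermost level belong to the next shell.\<close>

definition lev :: "nat \<Rightarrow> nat" where
  "lev k = m + k * (3 * L + 1)"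

definition A :: "nat \<Rightarrow> edge set" where
  "A k = inner_edges K d (lev k)"

definition S :: "nat \<Rightarrow> edge set" where
  "S k = A (Suc k) - A k"

fun in_seg :: "nat \<Rightarrow> bool option \<Rightarrow> edge \<Rightarrow> bool" where
  "in_seg n None e = False"
| "in_seg n (Some True) e = (fst ` e \<subseteq> {int n + int L..int n + 2 * int L})"
| "in_seg n (Some False) e = (fst ` e \<subseteq> {- (int n + 2 * int L)..- (int n + int L)})"

text \<open>The passage time of the expensive edges must dominate both cross edges of a detour.\<close>

definition thick :: "real \<Rightarrow> real \<Rightarrow> real" where
  "thick lam mu = max t (max lam mu)"

text \<open>Both ends of a shell carry a pad, a segment and a pad. On the side named by the second argument
  the cheap line makes a detour through the neighbouring line; this costs the two cross edges \<open>lam\<close>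
  and \<open>mu\<close>.\<close>

definition cfg :: "nat \<Rightarrow> bool option \<Rightarrow> real \<Rightarrow> real \<Rightarrow> config" where
  "cfg n sw lam mu e =
     (if snd ` e = {origin} then (if in_seg n sw e then thick lam mu else s)
      else if snd ` e = {unit1} then (if in_seg n sw e then s else thick lam mu)
      else if snd ` e = {origin, unit1} \<and> (fst ` e = {int n + int L} \<or> fst ` e = {- (int n + int L)}) then lam
      else if snd ` e = {origin, unit1} \<and> (fst ` e = {int n + 2 * int L} \<or> fst ` e = {- (int n + 2 * int L)}) then mu
      else thick lam mu)"

definition matches :: "config \<Rightarrow> nat \<Rightarrow> bool option \<Rightarrow> real \<Rightarrow> real \<Rightarrow> bool" where
  "matches x k sw lam mu \<longleftrightarrow> (\<forall>e\<in>S k. x e = cfg (lev k) sw lam mu e)"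

definition admissible :: "config \<Rightarrow> bool" where
  "admissible x \<longleftrightarrow> (\<forall>e\<in>tube_edges K d. x e \<in> Lam)"

lemma t_pos: "0 < t" using s_t s_Lam Lam_nonneg by auto

lemma L_pos: "0 < L"
proof (rule ccontr)
  assume "\<not> 0 < L"
  then have "real L * (t - s) = 0" by simp
  moreover have "0 < 2 * real ((d - 1) * K) * t"
    using d2 K2 t_pos by (intro mult_pos_pos) auto
  ultimately show False using L_large by linarith
qed

lemma thick_in: "lam \<in> Lam \<Longrightarrow> mu \<in> Lam \<Longrightarrow> thick lam mu \<in> Lam"
  using t_Lam by (auto simp: thick_def max_def)

lemma cfg_Lam: "lam \<in> Lam \<Longrightarrow> mu \<in> Lam \<Longrightarrow> cfg n sw lam mu e \<in> Lam"
  using s_Lam thick_in by (auto simp: cfg_def)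

text \<open>Raising the expensive passage time from \<open>t\<close> does not require longer pads, because \<open>L\<close> is at least
  \<open>2 * (d - 1) * K\<close>.\<close>

lemma L_large_thick:
  "2 * real ((d - 1) * K) * thick lam mu \<le> real L * (thick lam mu - s)"
proof -
  have "2 * real ((d - 1) * K) * t \<le> real L * t - real L * s" using L_large by (simp add: algebra_simps)
  also have "\<dots> \<le> real L * t" using s_Lam Lam_nonneg by auto
  finally have "2 * real ((d - 1) * K) \<le> real L" using t_pos by (rule mult_right_le_imp_le)
  then have "2 * real ((d - 1) * K) * (thick lam mu - t) \<le> real L * (thick lam mu - t)"
    by (rule mult_right_mono) (simp add: thick_def)
  then show ?thesis using L_large by (simp only: right_diff_distrib)
qed

lemma padsI:
  assumes "\<forall>e\<in>tube_edges K d. 0 \<le> x e" shows "pads K d x L s (thick lam mu)"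
  using assms s_Lam Lam_nonneg s_t L_large_thick
  by unfold_locales (auto simp: thick_def)

lemma admissible_nonneg: "admissible x \<Longrightarrow> \<forall>e\<in>tube_edges K d. 0 \<le> x e"
  using Lam_nonneg by (auto simp: admissible_def)

lemma lev_Suc: "int (lev (Suc k)) = int (lev k) + 3 * int L + 1"
  by (simp add: lev_def)

lemma lev_mono: "j \<le> k \<Longrightarrow> lev j \<le> lev k"
  unfolding lev_def by (intro add_left_mono mult_le_mono1)

lemma inner_edges_mono: "n \<le> n' \<Longrightarrow> inner_edges K d n \<subseteq> inner_edges K d n'"
proof
  fix e assume n: "n \<le> n'" and e: "e \<in> inner_edges K d n"
  have "fst ` e \<noteq> {int n'}" "fst ` e \<noteq> {- int n'}"
    using e n unfolding inner_edges_def by (cases "n = n'"; auto)+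
  moreover have "fst ` e \<subseteq> {- int n'..int n'}" using e n unfolding inner_edges_def by fastforce
  ultimately show "e \<in> inner_edges K d n'" using e by (simp add: inner_edges_def)
qed

lemma A_mono: "j \<le> k \<Longrightarrow> A j \<subseteq> A k"
  unfolding A_def by (intro inner_edges_mono lev_mono)

lemma A_subset: "A k \<subseteq> tube_edges K d"
  by (auto simp: A_def inner_edges_def)

lemma A_Suc: "A (Suc k) = A k \<union> S k" "A k \<inter> S k = {}"
  using A_mono[of k "Suc k"] by (auto simp: S_def)

lemma S_subset: "S k \<subseteq> tube_edges K d"
  using A_subset by (auto simp: S_def)

lemma A_exhausts:
  assumes "e \<in> tube_edges K d" shows "\<exists>k. e \<in> A k"
proof -
  obtain u v where e: "e = {u, v}" using assms by (rule tube_edgeE)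
  define k where "k = nat \<bar>fst u\<bar> + nat \<bar>fst v\<bar> + 1"
  have "k \<le> lev k" by (simp add: lev_def)
  then have "\<bar>fst u\<bar> < int (lev k)" "\<bar>fst v\<bar> < int (lev k)" unfolding k_def by linarith+
  then have "e \<in> A k" using assms unfolding A_def inner_edges_def e by auto
  then show ?thesis ..
qed

lemma finite_A: "finite (A k)"
proof -
  let ?V = "{v \<in> tube_verts K d. fst v \<in> {- int (lev k)..int (lev k)}}"
  have "A k \<subseteq> Pow ?V"
  proof
    fix e assume e: "e \<in> A k"
    then obtain u v where "e = {u, v}" "adj u v" using A_subset tube_edgeE by blast
    then show "e \<in> Pow ?V" using e adjD[of u v] by (auto simp: A_def inner_edges_def)
  qed
  then show ?thesis using finite_tube_levels[of "{- int (lev k)..int (lev k)}"] finite_subset by auto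
qed

lemma finite_S: "finite (S k)"
  using finite_A by (simp add: S_def)

lemma edge_in_S:
  assumes "adj u v" "fst u \<in> {int (lev k)..int (lev k) + 3 * int L}" "fst v \<in> {int (lev k)..int (lev k) + 3 * int L}"
  shows "{u, v} \<in> S k"
proof -
  have "{u, v} \<in> A (Suc k)" using assms by (auto simp: A_def inner_edges_def lev_Suc)
  moreover have "{u, v} \<notin> A k"
  proof
    assume "{u, v} \<in> A k"
    then have "fst u \<le> int (lev k)" "fst v \<le> int (lev k)" "{fst u, fst v} \<noteq> {int (lev k)}"
      by (auto simp: A_def inner_edges_def)
    then show False using assms by auto
  qed
  ultimately show ?thesis by (simp add: S_def)
qed

lemma in_seg_iff:
  "in_seg n sw e \<longleftrightarrow> sw = Some True \<and> fst ` e \<subseteq> {int n + int L..int n + 2 * int L} \<or>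
     sw = Some False \<and> fst ` e \<subseteq> {- (int n + 2 * int L)..- (int n + int L)}"
  by (cases "(n, sw, e)" rule: in_seg.cases) auto

lemma vertical_iff:
  assumes "adj u v" shows "fst u = fst v \<longleftrightarrow> snd u \<noteq> snd v"
  using assms by (cases rule: adj_cases) auto

lemma cfg_horizontal:
  assumes "adj u v" "fst u \<noteq> fst v"
  shows "cfg n sw lam mu {u, v} = (if snd u = origin then (if in_seg n sw {u, v} then thick lam mu else s)
     else if snd u = unit1 then (if in_seg n sw {u, v} then s else thick lam mu) else thick lam mu)"
  using vertical_iff[OF assms(1)] assms(2) origin_neq_unit1 unfolding cfg_def by auto

lemma cfg_vertical:
  assumes "adj u v" "fst u = fst v"
  shows "cfg n sw lam mu {u, v} =
    (if {snd u, snd v} = {origin, unit1} \<and> \<bar>fst u\<bar> = int n + int L then lam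
     else if {snd u, snd v} = {origin, unit1} \<and> \<bar>fst u\<bar> = int n + 2 * int L then mu else thick lam mu)"
proof -
  have "snd u \<noteq> snd v" using vertical_iff[OF assms(1)] assms(2) by simp
  then have "{snd u, snd v} \<noteq> {origin}" "{snd u, snd v} \<noteq> {unit1}" by auto
  moreover have "fst ` {u, v} = {fst u}" using assms(2) by simp
  moreover have "snd ` {u, v} = {snd u, snd v}" by simp
  moreover have "(fst u = c \<or> fst u = - c) = (\<bar>fst u\<bar> = c)" if "0 \<le> c" for c using that by linarith
  ultimately show ?thesis unfolding cfg_def by (simp only: singleton_inject if_False of_nat_0_le_iff
      add_nonneg_nonneg mult_nonneg_nonneg zero_le_numeral singleton_insert_inj_eq' simp_thms empty_subsetI)
qed

lemma matches_pads:
  assumes x: "matches x k sw lam mu"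
  shows "pad x (int (lev k)) L s (thick lam mu)" "pad x (int (lev k) + 2 * int L) L s (thick lam mu)"
proof -
  have th: "lam \<le> thick lam mu" "mu \<le> thick lam mu" by (auto simp: thick_def)
  let ?n = "int (lev k)"
  have "pad x a L s (thick lam mu)" if a: "a = ?n \<or> a = ?n + 2 * int L" for a
    unfolding pad_def
  proof (intro allI impI)
    fix u v assume uv: "adj u v" "fst u \<in> {a..a + int L}" "fst v \<in> {a..a + int L}"
    then have e: "{u, v} \<in> S k" using a by (intro edge_in_S) auto
    have xe: "x {u, v} = cfg (lev k) sw lam mu {u, v}" using x e by (auto simp: matches_def)
    have "\<not> in_seg (lev k) sw {u, v}" if "fst u \<noteq> fst v"
    proof
      assume "in_seg (lev k) sw {u, v}"
      then have "fst u \<in> {?n + int L..?n + 2 * int L} \<and> fst v \<in> {?n + int L..?n + 2 * int L}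
          \<or> fst u \<le> - (?n + int L)" unfolding in_seg_iff by auto
      then show False using that uv a L_pos by auto
    qed
    then show "(fst u \<noteq> fst v \<longrightarrow> x {u, v} = (if snd u = origin then s else thick lam mu)) \<and>
       (fst u = fst v \<longrightarrow> x {u, v} \<le> thick lam mu \<and>
         (a < fst u \<and> fst u < a + int L \<longrightarrow> x {u, v} = thick lam mu))"
      using uv a L_pos th unfolding xe by (auto simp: cfg_horizontal cfg_vertical)
  qed
  then show "pad x ?n L s (thick lam mu)" "pad x (?n + 2 * int L) L s (thick lam mu)" by auto
qed

lemma matches_straight:
  assumes x: "matches x k sw lam mu" and sw: "sw \<noteq> Some True"
  shows "straight x (int (lev k) + int L) L s"
  unfolding straight_def
proof (intro allI impI)
  fix u v assume uv: "adj u v" "fst u \<in> {int (lev k) + int L..int (lev k) + int L + int L}"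
    "fst v \<in> {int (lev k) + int L..int (lev k) + int L + int L}" "fst u \<noteq> fst v"
  then have "{u, v} \<in> S k" by (intro edge_in_S) auto
  then have xe: "x {u, v} = cfg (lev k) sw lam mu {u, v}" using x by (auto simp: matches_def)
  have "\<not> in_seg (lev k) sw {u, v}"
    using sw uv(2) L_pos unfolding in_seg_iff by auto
  then show "s \<le> x {u, v} \<and> (snd u = origin \<longrightarrow> x {u, v} = s)"
    using s_t unfolding xe by (auto simp: cfg_horizontal[OF uv(1,4)] thick_def)
qed

lemma matches_detour:
  assumes x: "matches x k (Some True) lam mu"
  shows "detour x (int (lev k) + int L) L s (thick lam mu) lam mu"
  unfolding detour_def
proof (intro allI impI)
  fix u v assume uv: "adj u v" "fst u \<in> {int (lev k) + int L..int (lev k) + int L + int L}"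
    "fst v \<in> {int (lev k) + int L..int (lev k) + int L + int L}"
  then have "{u, v} \<in> S k" by (intro edge_in_S) auto
  then have xe: "x {u, v} = cfg (lev k) (Some True) lam mu {u, v}" using x by (auto simp: matches_def)
  have seg: "in_seg (lev k) (Some True) {u, v}" using uv by auto
  then show "(fst u \<noteq> fst v \<longrightarrow> x {u, v} = (if snd u = unit1 then s else thick lam mu)) \<and>
       (fst u = fst v \<longrightarrow> x {u, v} =
          (if {snd u, snd v} = {origin, unit1} \<and> fst u = int (lev k) + int L then lam
           else if {snd u, snd v} = {origin, unit1} \<and> fst u = int (lev k) + int L + int L then mu
           else thick lam mu))"
  proof (intro conjI impI)
    assume "fst u \<noteq> fst v"
    then show "x {u, v} = (if snd u = unit1 then s else thick lam mu)"
      using seg origin_neq_unit1 unfolding xe cfg_horizontal[OF uv(1) \<open>fst u \<noteq> fst v\<close>] by simp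
  next
    assume eq: "fst u = fst v"
    have "\<bar>fst u\<bar> = fst u" using uv(2) by auto
    then show "x {u, v} = (if {snd u, snd v} = {origin, unit1} \<and> fst u = int (lev k) + int L then lam
           else if {snd u, snd v} = {origin, unit1} \<and> fst u = int (lev k) + int L + int L then mu
           else thick lam mu)"
      unfolding xe cfg_vertical[OF uv(1) eq] by (simp add: algebra_simps)
  qed
qed

end

context tube begin

lemma pad_flip:
  assumes "pad (\<lambda>e. x (flip ` e)) a L s th" shows "pad x (- a - int L) L s th"
  unfolding pad_def
proof (intro allI impI)
  fix u v assume uv: "adj u v" "fst u \<in> {- a - int L..- a - int L + int L}"
    "fst v \<in> {- a - int L..- a - int L + int L}"
  have "flip ` {flip u, flip v} = {u, v}" by simp
  moreover have "fst (flip u) \<in> {a..a + int L}" "fst (flip v) \<in> {a..a + int L}" using uv by auto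
  moreover have "adj (flip u) (flip v)" using uv by simp
  ultimately show "(fst u \<noteq> fst v \<longrightarrow> x {u, v} = (if snd u = origin then s else th)) \<and>
       (fst u = fst v \<longrightarrow> x {u, v} \<le> th \<and> (- a - int L < fst u \<and> fst u < - a - int L + int L \<longrightarrow> x {u, v} = th))"
    using assms[unfolded pad_def, rule_format, of "flip u" "flip v"] by auto
qed

lemma flip_tube_edges [simp]: "flip ` e \<in> tube_edges K d \<longleftrightarrow> e \<in> tube_edges K d"
proof -
  have "flip ` e \<in> tube_edges K d" if e: "e \<in> tube_edges K d" for e
  proof -
    obtain u v where "e = {u, v}" "adj u v" using e by (rule tube_edgeE)
    then show ?thesis by simp
  qed
  from this[of e] this[of "flip ` e"] show ?thesis by auto
qed

end

context scheme begin

abbreviation T :: "config \<Rightarrow> vertex set \<Rightarrow> vertex \<Rightarrow> real" where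
  "T x U v \<equiv> dT x UNIV U v"

definition mirror :: "config \<Rightarrow> config" where
  "mirror x = (\<lambda>e. x (flip ` e))"

lemma T_mirror: "T (mirror x) (flip ` U) v = T x U (flip v)"
  using dT_flip[of x UNIV U v] by (simp add: mirror_def)

lemma dT_mirror_box: "dT (mirror x) {- n..n} (flip ` U) v = dT x {- n..n} U (flip v)"
  using dT_flip[of x "{- n..n}" U v] by (simp add: mirror_def)

lemma fst_flip: "fst ` flip ` e = uminus ` fst ` e" "snd ` flip ` e = snd ` e"
  by (simp_all add: image_image)

lemma neg_image_eq: "uminus ` X = {c} \<longleftrightarrow> X = {- c :: int}"
  using inj_image_eq_iff[of uminus X "{- c}"] by simp

lemma neg_image_subset: "uminus ` X \<subseteq> {a..b} \<longleftrightarrow> X \<subseteq> {- b..- a :: int}"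
proof -
  have "- x \<in> {a..b} \<longleftrightarrow> x \<in> {- b..- a}" for x :: int by auto
  then show ?thesis unfolding image_subset_iff by blast
qed

lemma flip_A [simp]: "flip ` e \<in> A k \<longleftrightarrow> e \<in> A k"
  unfolding A_def inner_edges_def by (simp add: fst_flip neg_image_eq neg_image_subset conj_commute)

lemma flip_S [simp]: "flip ` e \<in> S k \<longleftrightarrow> e \<in> S k"
  by (simp add: S_def)

lemma cfg_flip: "cfg n sw lam mu (flip ` e) = cfg n (map_option Not sw) lam mu e"
proof -
  have "in_seg n sw (flip ` e) = in_seg n (map_option Not sw) e"
    unfolding in_seg_iff fst_flip neg_image_subset by (cases sw) auto
  then show ?thesis unfolding cfg_def fst_flip neg_image_eq by (simp only: minus_minus disj_commute)
qed

lemma matches_mirror: "matches x k sw lam mu \<Longrightarrow> matches (mirror x) k (map_option Not sw) lam mu"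
  unfolding matches_def mirror_def using cfg_flip by (metis flip_S flip_image)

lemma mirror_nonneg: "\<forall>e\<in>tube_edges K d. 0 \<le> x e \<Longrightarrow> \<forall>e\<in>tube_edges K d. 0 \<le> mirror x e"
  by (simp add: mirror_def)

lemma swap_shell_right:
  assumes x: "\<forall>e\<in>tube_edges K d. 0 \<le> x e" and y: "\<forall>e\<in>tube_edges K d. 0 \<le> y e"
    and mx: "matches x k None lam mu" and my: "matches y k (Some True) lam mu"
    and eq: "\<And>e. e \<in> tube_edges K d \<Longrightarrow> e \<notin> S k \<Longrightarrow> x e = y e"
    and lam: "lam \<in> Lam" "mu \<in> Lam"
    and U: "U \<noteq> {}" "U \<subseteq> tube_verts K d" "fst ` U \<subseteq> {- int (lev k)..int (lev k)}"
    and v: "v \<in> tube_verts K d"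
  shows "int (lev (Suc k)) \<le> fst v \<Longrightarrow> T y U v = T x U v + (lam + mu)"
    and "fst v \<le> - int (lev (Suc k)) \<Longrightarrow> T y U v = T x U v"
proof -
  let ?n = "int (lev k)"
  have lam': "0 \<le> lam" "lam \<le> thick lam mu" "0 \<le> mu" "mu \<le> thick lam mu"
    using lam Lam_nonneg by (auto simp: thick_def)
  have eq': "x e = y e" if e: "e \<in> tube_edges K d" "\<not> fst ` e \<subseteq> {?n + int L..?n + 2 * int L}" for e
  proof (cases "e \<in> S k")
    case True
    have "\<not> in_seg (lev k) (Some True) e" using e(2) by simp
    then have "cfg (lev k) None lam mu e = cfg (lev k) (Some True) lam mu e" by (simp add: cfg_def)
    then show ?thesis using True mx my by (simp add: matches_def)
  qed (use eq e in auto)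
  have U1: "\<exists>u\<in>U. u \<in> tube_verts K d" "\<And>u. u \<in> U \<Longrightarrow> fst u \<le> ?n" using U by auto
  note sw = swap_right[OF padsI[OF x] padsI[OF y] matches_pads[OF mx] matches_pads[OF my]
      matches_straight[OF mx] matches_detour[OF my] lam' eq' U1 v, simplified]
  show "T y U v = T x U v + (lam + mu)" if "int (lev (Suc k)) \<le> fst v"
    using that sw(1) by (simp add: lev_Suc)
  show "T y U v = T x U v" if "fst v \<le> - int (lev (Suc k))"
    using that sw(2) by (simp add: lev_Suc)
qed

text \<open>For the left end the lemma above is applied to the reflected configurations, since the two
  segments of a shell are mirror images of each other.\<close>

lemma swap_shell:
  assumes x: "\<forall>e\<in>tube_edges K d. 0 \<le> x e" and y: "\<forall>e\<in>tube_edges K d. 0 \<le> y e"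
    and mx: "matches x k None lam mu" and my: "matches y k (Some sd) lam mu"
    and eq: "\<And>e. e \<in> tube_edges K d \<Longrightarrow> e \<notin> S k \<Longrightarrow> x e = y e"
    and lam: "lam \<in> Lam" "mu \<in> Lam"
    and U: "U \<noteq> {}" "U \<subseteq> tube_verts K d" "fst ` U \<subseteq> {- int (lev k)..int (lev k)}"
    and v: "v \<in> tube_verts K d"
  shows "int (lev (Suc k)) \<le> fst v \<Longrightarrow> T y U v = T x U v + (if sd then lam + mu else 0)"
    and "fst v \<le> - int (lev (Suc k)) \<Longrightarrow> T y U v = T x U v + (if sd then 0 else lam + mu)"
proof -
  have "(int (lev (Suc k)) \<le> fst v \<longrightarrow> T y U v = T x U v + (if sd then lam + mu else 0)) \<and>
    (fst v \<le> - int (lev (Suc k)) \<longrightarrow> T y U v = T x U v + (if sd then 0 else lam + mu))"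
  proof (cases sd)
    case True
    then show ?thesis using swap_shell_right[OF x y mx _ eq lam U v] my by simp
  next
    case False
    have "flip ` U \<noteq> {}" "flip ` U \<subseteq> tube_verts K d" "fst ` flip ` U \<subseteq> {- int (lev k)..int (lev k)}"
      using U by (auto simp: image_subset_iff)
    note U' = this
    have my': "matches (mirror y) k (Some True) lam mu" using matches_mirror[OF my] False by simp
    have eq': "mirror x e = mirror y e" if "e \<in> tube_edges K d" "e \<notin> S k" for e
      using eq[of "flip ` e"] that by (simp add: mirror_def)
    have v': "flip v \<in> tube_verts K d" using v by simp
    note sw = swap_shell_right[OF mirror_nonneg[OF x] mirror_nonneg[OF y] matches_mirror[OF mx, simplified]
        my' eq' lam U' v', unfolded T_mirror, simplified]
    show ?thesis using False sw by auto
  qed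
  then show "int (lev (Suc k)) \<le> fst v \<Longrightarrow> T y U v = T x U v + (if sd then lam + mu else 0)"
    "fst v \<le> - int (lev (Suc k)) \<Longrightarrow> T y U v = T x U v + (if sd then 0 else lam + mu)" by auto
qed

text \<open>The state of the coupling: the items account for the difference of the two passage times far out on
  either side.\<close>

definition gap :: "config \<Rightarrow> config \<Rightarrow> nat \<Rightarrow> item list \<Rightarrow> bool" where
  "gap x y n is \<longleftrightarrow> (\<forall>v\<in>tube_verts K d.
     (int n \<le> fst v \<longrightarrow> T x I v - T y I' v = debt True is) \<and>
     (fst v \<le> - int n \<longrightarrow> T x I v - T y I' v = debt False is))"

lemma gap_mono: "gap x y n is \<Longrightarrow> n \<le> n' \<Longrightarrow> gap x y n' is"
  unfolding gap_def by fastforce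

definition items :: "item set" where
  "items = UNIV \<times> UNIV \<times> Lam \<times> Lam"

lemma box_levels:
  assumes "M \<le> n"
  shows "\<And>u. u \<in> I \<Longrightarrow> fst u \<in> {- int n..int n}" "\<And>u. u \<in> I' \<Longrightarrow> fst u \<in> {- int n..int n}"
proof -
  have "{- int M..int M} \<subseteq> {- int n..int n}" using assms by auto
  then show "\<And>u. u \<in> I \<Longrightarrow> fst u \<in> {- int n..int n}" "\<And>u. u \<in> I' \<Longrightarrow> fst u \<in> {- int n..int n}"
    using I(3) I'(3) by (meson image_subset_iff subsetD)+
qed

text \<open>Differences of passage times between finitely many levels are even signed sums of point
  masses: under the second alternative of the hypothesis the numbers of edges of two optimal walks
  have the same parity, under the first one the parity can be corrected by an odd relation.\<close>

lemma difference_pair_sum: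
  assumes x: "admissible x" and y: "admissible y" and v: "v \<in> tube_verts K d" "fst v \<in> {- int n..int n}"
    and M: "M \<le> n"
  shows "\<exists>ps. set ps \<subseteq> UNIV \<times> Lam \<times> Lam \<and>
    dT x {- int n..int n} I v - dT y {- int n..int n} I' v = pair_sum ps"
proof -
  let ?R = "{- int n..int n}"
  interpret x: fpp_config K d x by unfold_locales (rule admissible_nonneg[OF x])
  interpret y: fpp_config K d y by unfold_locales (rule admissible_nonneg[OF y])
  have U: "\<exists>u\<in>I. u \<in> tube_verts K d \<and> fst u \<in> ?R" and U': "\<exists>u\<in>I'. u \<in> tube_verts K d \<and> fst u \<in> ?R"
    using box_levels[OF M] I(1,2) I'(1,2) by blast+
  obtain ts where ts: "walk x ?R I v ts" "dT x ?R I v = sum_list ts"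
    by (rule x.dT_attained[OF _ _ U v]) auto
  obtain ts' where ts': "walk y ?R I' v ts'" "dT y ?R I' v = sum_list ts'"
    by (rule y.dT_attained[OF _ _ U' v]) auto
  have vals: "set ts \<subseteq> Lam" if "walk x R U v ts" "admissible x" for x R U v ts
    using that by (induction rule: walk.induct) (auto simp: admissible_def)
  let ?zs = "map (Pair True) ts @ map (Pair False) ts'"
  have zs: "set ?zs \<subseteq> UNIV \<times> Lam" using vals[OF ts(1) x] vals[OF ts'(1) y] by auto
  have sgn: "signed_sum (map (Pair b) us) = (if b then sum_list us else - sum_list us)" for b us
    by (induction us) auto
  have sum: "signed_sum ?zs = dT x ?R I v - dT y ?R I' v" by (simp add: sgn ts(2) ts'(2))
  have "\<exists>zs. set zs \<subseteq> UNIV \<times> Lam \<and> signed_sum zs = signed_sum ?zs \<and> even (length zs)"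
  proof (cases "even (length ?zs)")
    case True
    then show ?thesis using zs by blast
  next
    case False
    obtain u where u: "u \<in> I" "u \<in> tube_verts K d" "even (parity u + parity v) \<longleftrightarrow> even (length ts)"
      using walk_parity[OF ts(1)] by blast
    obtain u' where u': "u' \<in> I'" "u' \<in> tube_verts K d" "even (parity u' + parity v) \<longleftrightarrow> even (length ts')"
      using walk_parity[OF ts'(1)] by blast
    have "odd (graph_dist K d u u')" using False u(3) u'(3) even_graph_dist[OF u(2) u'(2)] by auto
    then obtain J :: "nat set" and t :: "nat \<Rightarrow> real" and n :: "nat \<Rightarrow> int"
      where J: "finite J" "\<forall>j\<in>J. t j \<in> Lam" "odd (\<Sum>j\<in>J. n j)" "(\<Sum>j\<in>J. of_int (n j) * t j) = 0"
      using arith u(1) u'(1) by blast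
    obtain ws where "set ws \<subseteq> UNIV \<times> Lam" "signed_sum ws = (\<Sum>j\<in>J. of_int (n j) * t j)"
      "even (length ws) \<longleftrightarrow> even (\<Sum>j\<in>J. n j)"
      using odd_relation[OF J(1,2), of n] by blast
    then have "set (ws @ ?zs) \<subseteq> UNIV \<times> Lam" "signed_sum (ws @ ?zs) = signed_sum ?zs" "even (length (ws @ ?zs))"
      using zs False J by auto
    then show ?thesis by blast
  qed
  then show ?thesis using signed_sum_pairs[of _ Lam] sum by metis
qed

text \<open>The items that describe the current difference depend on the two configurations only through
  their values on the finite box.\<close>

definition extends :: "config \<Rightarrow> config \<Rightarrow> nat \<Rightarrow> config \<Rightarrow> config \<Rightarrow> bool" where
  "extends x y k c c' \<longleftrightarrow> admissible x \<and> admissible y \<and>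
     (\<forall>e\<in>A k. x e = c e \<and> y e = c' e) \<and> (\<forall>e\<in>tube_edges K d - A k. x e = y e) \<and> matches x k None t t"

lemma shell_regeneration_right:
  assumes x: "\<forall>e\<in>tube_edges K d. 0 \<le> x e" and y: "\<forall>e\<in>tube_edges K d. 0 \<le> y e"
    and mx: "matches x k None lam mu" and my: "matches y k None lam mu"
    and eq: "\<And>e. e \<in> tube_edges K d - A k \<Longrightarrow> x e = y e"
    and U: "U \<noteq> {}" "U \<subseteq> tube_verts K d" "\<And>u. u \<in> U \<Longrightarrow> fst u \<in> {- int (lev k)..int (lev k)}"
    and U': "U' \<noteq> {}" "U' \<subseteq> tube_verts K d" "\<And>u. u \<in> U' \<Longrightarrow> fst u \<in> {- int (lev k)..int (lev k)}"
    and v: "v \<in> tube_verts K d" "int (lev (Suc k)) \<le> fst v"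
  shows "T x U v - T y U' v =
    dT x {- int (lev k)..int (lev k)} U (int (lev k), origin) -
    dT y {- int (lev k)..int (lev k)} U' (int (lev k), origin)"
proof -
  have left: "pad z (- int (lev k) - int L) L s (thick lam mu)" if "matches z k None lam mu" for z
    using matches_pads(1)[OF matches_mirror[OF that]] pad_flip unfolding mirror_def by blast
  have "x e = y e" if e: "e \<in> tube_edges K d" "fst ` e \<subseteq> {int (lev k) + int L..}" for e
  proof -
    have "e \<notin> A k"
    proof
      assume "e \<in> A k"
      then have "fst ` e \<subseteq> {..int (lev k)}" by (auto simp: A_def inner_edges_def)
      then have "fst ` e = {}" using e(2) L_pos by force
      then show False using e(1) by (auto elim: tube_edgeE)
    qed
    then show ?thesis using eq e(1) by simp
  qed
  then show ?thesis
    by (rule regeneration_right[OF padsI[OF x] padsI[OF y] matches_pads(1)[OF mx] left[OF mx]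
          matches_pads(1)[OF my] left[OF my]]) (use U U' v in \<open>auto simp: lev_Suc\<close>)
qed

lemma plan_exists:
  assumes M: "M \<le> lev k"
  shows "\<exists>is. set is \<subseteq> items \<and> (\<forall>x y. extends x y k c c' \<longrightarrow> gap x y (lev (Suc k)) is)"
proof (cases "\<exists>x y. extends x y k c c'")
  case False
  then show ?thesis by (intro exI[of _ "[]"]) auto
next
  case True
  then obtain x0 y0 where xy0: "extends x0 y0 k c c'" by blast
  let ?n = "int (lev k)"
  let ?R = "{- ?n..?n}"
  define D where "D x y v = dT x ?R I v - dT y ?R I' v" for x y v
  have edge_cases: "e \<in> A k \<or> e \<in> S k" if "e \<in> tube_edges K d" "fst ` e \<subseteq> ?R" for e
    using that unfolding S_def A_def inner_edges_def by (auto simp: lev_Suc)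
  have y_eq: "y e = x e" if "extends x y k c c'" "e \<in> S k" for x y e
  proof -
    have "e \<in> tube_edges K d - A k" using that(2) S_subset A_Suc(2) by blast
    then show ?thesis using that(1) unfolding extends_def by auto
  qed
  have D_eq: "D x y v = D x0 y0 v" if xy: "extends x y k c c'" for x y v
  proof -
    have "x {u, w} = x0 {u, w} \<and> y {u, w} = y0 {u, w}" if uw: "adj u w" "fst u \<in> ?R" "fst w \<in> ?R" for u w
    proof -
      have "{u, w} \<in> A k \<or> {u, w} \<in> S k" using uw by (intro edge_cases) auto
      then show ?thesis
      proof
        assume "{u, w} \<in> A k"
        then show ?thesis using xy xy0 by (simp add: extends_def)
      next
        assume "{u, w} \<in> S k"
        then show ?thesis
          using xy xy0 y_eq[OF xy] y_eq[OF xy0] by (simp add: extends_def matches_def)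
      qed
    qed
    then show ?thesis unfolding D_def
      using dT_cong[of ?R x x0 I v] dT_cong[of ?R y y0 I' v] by presburger
  qed
  have adm: "admissible x0" "admissible y0" using xy0 by (auto simp: extends_def)
  obtain pr where pr: "set pr \<subseteq> UNIV \<times> Lam \<times> Lam" "D x0 y0 (?n, origin) = pair_sum pr"
    using difference_pair_sum[OF adm origin_vert _ M, of ?n] unfolding D_def by auto
  obtain pl where pl: "set pl \<subseteq> UNIV \<times> Lam \<times> Lam" "D x0 y0 (- ?n, origin) = pair_sum pl"
    using difference_pair_sum[OF adm origin_vert _ M, of "- ?n"] unfolding D_def by auto
  note IR = box_levels[OF M]
  have flipR: "fst u \<in> ?R" if u: "u \<in> flip ` W" and W: "\<And>u. u \<in> W \<Longrightarrow> fst u \<in> ?R" for u W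
  proof -
    obtain w where w: "u = flip w" "w \<in> W" using u by blast
    show ?thesis using W[OF w(2)] w(1) by auto
  qed
  have main: "int (lev (Suc k)) \<le> fst v \<Longrightarrow> T x I v - T y I' v = D x y (?n, origin)"
    "fst v \<le> - int (lev (Suc k)) \<Longrightarrow> T x I v - T y I' v = D x y (- ?n, origin)"
    if xy: "extends x y k c c'" and v: "v \<in> tube_verts K d" for x y v
  proof -
    have mx: "matches x k None t t" and my: "matches y k None t t"
      using xy y_eq[OF xy] by (auto simp: extends_def matches_def)
    note mmx = matches_mirror[OF mx, simplified] and mmy = matches_mirror[OF my, simplified]
    have nn: "\<forall>e\<in>tube_edges K d. 0 \<le> x e" "\<forall>e\<in>tube_edges K d. 0 \<le> y e"
      using xy by (auto simp: extends_def admissible_nonneg)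
    have eq: "x e = y e" if "e \<in> tube_edges K d - A k" for e
      using xy that by (simp add: extends_def)
    have meq: "mirror x e = mirror y e" if "e \<in> tube_edges K d - A k" for e
      using eq[of "flip ` e"] that by (simp add: mirror_def)
    show "T x I v - T y I' v = D x y (?n, origin)" if "int (lev (Suc k)) \<le> fst v"
      unfolding D_def by (rule shell_regeneration_right[OF nn mx my eq I(1,2) IR(1) I'(1,2) IR(2) v that])
    assume v2: "fst v \<le> - int (lev (Suc k))"
    have "T (mirror x) (flip ` I) (flip v) - T (mirror y) (flip ` I') (flip v) =
      dT (mirror x) ?R (flip ` I) (?n, origin) - dT (mirror y) ?R (flip ` I') (?n, origin)"
    proof (rule shell_regeneration_right[OF mirror_nonneg[OF nn(1)] mirror_nonneg[OF nn(2)] mmx mmy meq])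
      show "fst u \<in> ?R" if "u \<in> flip ` I" for u by (rule flipR[OF that IR(1)])
      show "fst u \<in> ?R" if "u \<in> flip ` I'" for u by (rule flipR[OF that IR(2)])
    qed (use I I' v v2 in \<open>auto simp: image_subset_iff\<close>)
    then show "T x I v - T y I' v = D x y (- ?n, origin)"
      unfolding T_mirror D_def dT_mirror_box by (simp add: flip_def)
  qed
  let ?is = "map (Pair True) pr @ map (Pair False) pl"
  have "set ?is \<subseteq> items" using pr(1) pl(1) by (auto simp: items_def)
  moreover have "gap x y (lev (Suc k)) ?is" if "extends x y k c c'" for x y
    unfolding gap_def using main[OF that] D_eq[OF that] pr(2) pl(2) by (simp add: debt_map_pairs)
  ultimately show ?thesis by blast
qed

end

context scheme begin

definition plan :: "nat \<Rightarrow> config \<Rightarrow> config \<Rightarrow> item list" where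
  "plan k c c' = (SOME xs. set xs \<subseteq> items \<and> (\<forall>x y. extends x y k c c' \<longrightarrow> gap x y (lev (Suc k)) xs))"

lemma plan:
  assumes "M \<le> lev k"
  shows "set (plan k c c') \<subseteq> items" "extends x y k c c' \<Longrightarrow> gap x y (lev (Suc k)) (plan k c c')"
  using someI_ex[OF plan_exists[OF assms, of c c']] unfolding plan_def by blast+

fun side_cfg :: "bool \<Rightarrow> nat \<Rightarrow> item \<Rightarrow> config" where
  "side_cfg b k (sd, sg, lam, mu) =
     restrict (cfg (lev k) (if sg = b then None else Some sd) lam mu) (S k)"

text \<open>If the first configuration shows \<open>side_cfg True\<close> for the leading item, the swap pays the debt of
  that item; if it shows \<open>side_cfg False\<close>, the swap doubles it.\<close>

fun next_items :: "nat \<Rightarrow> item list \<Rightarrow> config \<Rightarrow> item list" where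
  "next_items k [] z = []"
| "next_items k (i # xs) z =
     (if z = side_cfg True k i then xs else if z = side_cfg False k i then i # i # xs else i # xs)"

fun swap_cfg :: "nat \<Rightarrow> item list option \<Rightarrow> config \<Rightarrow> config" where
  "swap_cfg k (Some (i # xs)) z = Transposition.transpose (side_cfg True k i) (side_cfg False k i) z"
| "swap_cfg k st z = z"

fun next_state :: "nat \<Rightarrow> config \<Rightarrow> config \<Rightarrow> item list option \<Rightarrow> config \<Rightarrow> item list option" where
  "next_state k c c' (Some xs) z = Some (next_items k xs z)"
| "next_state k c c' None z =
     (if M \<le> lev k \<and> z = restrict (cfg (lev k) None t t) (S k) then Some (plan k c c') else None)"

text \<open>The second configuration on the first boxes, together with the items still to be worked off;
  the state is \<open>None\<close> until pads have appeared on both sides.\<close>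

primrec process :: "config \<Rightarrow> config \<Rightarrow> nat \<Rightarrow> config \<times> item list option" where
  "process x b 0 = (restrict b (A 0), None)"
| "process x b (Suc k) = (let (c', st) = process x b k; z = restrict x (S k) in
     (merge (A k) (S k) (c', swap_cfg k st z), next_state k (restrict x (A k)) c' st z))"

text \<open>The second configuration that would result if all further shells were copied. Only this
  configuration can be compared with the first one after \<open>k\<close> steps, because passage times
  depend on all edges.\<close>

definition copy_from :: "config \<Rightarrow> config \<Rightarrow> nat \<Rightarrow> config" where
  "copy_from x b k = (\<lambda>e. if e \<in> A k then fst (process x b k) e else x e)"

definition couple :: "config \<Rightarrow> config \<Rightarrow> config" where
  "couple x b = (\<lambda>e. fst (process x b (LEAST k. e \<in> A k)) e)"

lemma process_Suc_fst:
  "fst (process x b (Suc k)) = merge (A k) (S k) (fst (process x b k), swap_cfg k (snd (process x b k)) (restrict x (S k)))"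
  by (simp add: Let_def split_beta)

lemma process_Suc_snd:
  "snd (process x b (Suc k)) =
     next_state k (restrict x (A k)) (fst (process x b k)) (snd (process x b k)) (restrict x (S k))"
  by (simp add: Let_def split_beta)

lemma process_stable:
  assumes "e \<in> A j" "j \<le> k" shows "fst (process x b k) e = fst (process x b j) e"
  using assms(2)
proof (induction k rule: dec_induct)
  case (step n)
  then have "e \<in> A n" using assms(1) A_mono by blast
  then show ?case using step A_Suc(2)[of n] unfolding process_Suc_fst by simp
qed simp

lemma couple_eq: "e \<in> A k \<Longrightarrow> couple x b e = fst (process x b k) e"
  unfolding couple_def using process_stable[of e "LEAST k. e \<in> A k" k x b] LeastI[of "\<lambda>k. e \<in> A k" k]
  by (simp add: Least_le)

lemma process_cong:
  assumes "\<And>e. e \<in> A k \<Longrightarrow> x e = x' e" "\<And>e. e \<in> A 0 \<Longrightarrow> b e = b' e"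
  shows "process x b k = process x' b' k"
  using assms(1)
proof (induction k)
  case 0
  have "restrict b (A 0) = restrict b' (A 0)" using assms(2) by (auto simp: restrict_def)
  then show ?case by simp
next
  case (Suc k)
  have "restrict x (S k) = restrict x' (S k)" "restrict x (A k) = restrict x' (A k)"
    using Suc.prems A_Suc(1)[of k] by (auto simp: restrict_def fun_eq_iff)
  moreover have "process x b k = process x' b' k" using Suc A_Suc(1)[of k] by simp
  ultimately show ?case by simp
qed

lemma side_cfg_neq:
  assumes "i \<in> items" shows "side_cfg True k i \<noteq> side_cfg False k i"
proof
  assume eq: "side_cfg True k i = side_cfg False k i"
  obtain sd sg lam mu where i: "i = (sd, sg, lam, mu)" by (metis surj_pair)
  let ?n = "int (lev k) + int L"
  have adj: "adj (?n, origin) (?n + 1, origin)" by (rule adj_horizontal[OF origin_vert])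
  define e where "e = {(?n, origin), (?n + 1, origin)}"
  have e: "e \<in> S k" unfolding e_def using L_pos by (intro edge_in_S adj) auto
  define f where "f = (if sd then e else flip ` e)"
  have f: "f \<in> S k" using e by (simp add: f_def)
  have "cfg (lev k) (Some True) lam mu e = thick lam mu"
    using L_pos unfolding e_def by (subst cfg_horizontal[OF adj]) auto
  then have 1: "cfg (lev k) (Some sd) lam mu f = thick lam mu" by (auto simp: f_def cfg_flip)
  have "cfg (lev k) None lam mu e = s"
    unfolding e_def by (subst cfg_horizontal[OF adj]) auto
  then have 2: "cfg (lev k) None lam mu f = s" by (auto simp: f_def cfg_flip)
  have "side_cfg True k i f = side_cfg False k i f" using eq by simp
  then have "thick lam mu = s" using f 1 2 by (cases sg) (auto simp: i)
  then show False using s_t by (auto simp: thick_def)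
qed

lemma admissible_copy_from:
  assumes "admissible x" "\<forall>e\<in>A k. fst (process x b k) e \<in> Lam"
  shows "admissible (copy_from x b k)"
  using assms by (auto simp: admissible_def copy_from_def)

lemma copy_from_Suc:
  assumes "e \<in> tube_edges K d"
  shows "copy_from x b (Suc k) e =
    (if e \<in> S k then swap_cfg k (snd (process x b k)) (restrict x (S k)) e else copy_from x b k e)"
  using A_Suc[of k] unfolding copy_from_def process_Suc_fst by auto

text \<open>If the second configuration shows the straight segment it receives the detour and its passage times
  grow by \<open>lam + mu\<close>; in the opposite case they shrink by this amount. The sign of the item decides which of
  the two events pays the debt.\<close>

lemma gap_step:
  assumes adm: "admissible x" "admissible (copy_from x b k)" "admissible (copy_from x b (Suc k))"
    and st: "snd (process x b k) = Some xs" and xs: "set xs \<subseteq> items" and M: "M \<le> lev k"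
    and gap: "gap x (copy_from x b k) (lev k) xs"
  shows "gap x (copy_from x b (Suc k)) (lev (Suc k)) (next_items k xs (restrict x (S k)))"
proof -
  let ?y = "copy_from x b k" and ?y' = "copy_from x b (Suc k)" and ?z = "restrict x (S k)"
  have lev: "lev k \<le> lev (Suc k)" by (rule lev_mono) simp
  have same: "gap x ?y' (lev (Suc k)) xs" if "swap_cfg k (Some xs) ?z = ?z"
  proof -
    have "?y' e = ?y e" if e: "e \<in> tube_edges K d" for e
      using copy_from_Suc[OF e, of x b k] \<open>swap_cfg k (Some xs) ?z = ?z\<close> st A_Suc(2)[of k]
      by (auto simp: copy_from_def)
    then have "T ?y' U v = T ?y U v" for U v by (intro dT_cong) auto
    then show ?thesis using gap_mono[OF gap lev] by (simp add: gap_def)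
  qed
  show ?thesis
  proof (cases "xs")
    case Nil
    then show ?thesis using same by simp
  next
    case (Cons i xs')
    obtain sd sg lam mu where i: "i = (sd, sg, lam, mu)" by (metis surj_pair)
    have lam: "lam \<in> Lam" "mu \<in> Lam" using "xs" Cons i by (auto simp: items_def)
    have neq: "side_cfg True k i \<noteq> side_cfg False k i" using "xs" Cons by (intro side_cfg_neq) auto
    show ?thesis
    proof (cases "\<exists>w. ?z = side_cfg w k i")
      case False
      then have "?z \<noteq> side_cfg True k i" "?z \<noteq> side_cfg False k i" by metis+
      then show ?thesis using same Cons by simp
    next
      case True
      then obtain w where w: "?z = side_cfg w k i" by blast
      have sw: "swap_cfg k (Some xs) ?z = side_cfg (\<not> w) k i" using w Cons by (cases w) auto
      have y: "?y e = cfg (lev k) (if sg = w then None else Some sd) lam mu e" if "e \<in> S k" for e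
        using that w A_Suc(2)[of k] i by (auto simp: copy_from_def restrict_def fun_eq_iff split: if_splits)
      have y': "?y' e = cfg (lev k) (if sg = w then Some sd else None) lam mu e" if "e \<in> S k" for e
        using that sw st S_subset[of k] i copy_from_Suc[of e x b k] by (auto split: if_splits)
      have off: "?y e = ?y' e" if "e \<in> tube_edges K d" "e \<notin> S k" for e
        using copy_from_Suc[OF that(1), of x b k] that by simp
      note nn = admissible_nonneg[OF adm(2)] admissible_nonneg[OF adm(3)]
      have I'R: "fst ` I' \<subseteq> {- int (lev k)..int (lev k)}" using box_levels(2)[OF M] by blast
      have T: "(int (lev (Suc k)) \<le> fst v \<longrightarrow> T ?y' I' v = T ?y I' v +
            (if sd then (if sg = w then lam + mu else - (lam + mu)) else 0)) \<and>
          (fst v \<le> - int (lev (Suc k)) \<longrightarrow> T ?y' I' v = T ?y I' v +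
            (if sd then 0 else (if sg = w then lam + mu else - (lam + mu))))"
        if v: "v \<in> tube_verts K d" for v
      proof (cases "sg = w")
        case True
        have "matches ?y k None lam mu" "matches ?y' k (Some sd) lam mu"
          using y y' True by (auto simp: matches_def)
        from swap_shell[OF nn this off lam I'(1,2) I'R v] show ?thesis using True by auto
      next
        case False
        have "matches ?y' k None lam mu" "matches ?y k (Some sd) lam mu"
          using y y' False by (auto simp: matches_def)
        from swap_shell[OF nn(2,1) this off[symmetric] lam I'(1,2) I'R v] show ?thesis using False by auto
      qed
      have nx: "next_items k xs ?z = (if w then xs' else i # xs)"
        using w Cons neq by (cases w) auto
      have g: "gap x ?y (lev (Suc k)) xs" by (rule gap_mono[OF gap lev])
      show ?thesis unfolding nx gap_def
      proof (intro ballI conjI impI)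
        fix v assume v: "v \<in> tube_verts K d"
        show "T x I v - T ?y' I' v = debt True (if w then xs' else i # xs)" if "int (lev (Suc k)) \<le> fst v"
          using g T[OF v] v that Cons i unfolding gap_def by (auto split: if_splits)
        show "T x I v - T ?y' I' v = debt False (if w then xs' else i # xs)" if "fst v \<le> - int (lev (Suc k))"
          using g T[OF v] v that Cons i unfolding gap_def by (auto split: if_splits)
      qed
    qed
  qed
qed

lemma next_items_items: "set xs \<subseteq> items \<Longrightarrow> set (next_items k xs z) \<subseteq> items"
  by (cases "xs") auto

lemma side_cfg_Lam: "i \<in> items \<Longrightarrow> e \<in> S k \<Longrightarrow> side_cfg w k i e \<in> Lam"
  by (cases i) (auto simp: items_def cfg_Lam)

lemma process_invariant:
  assumes x: "admissible x" and b: "\<forall>e\<in>A 0. b e \<in> Lam"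
  shows "(\<forall>e\<in>A k. fst (process x b k) e \<in> Lam) \<and>
    (\<forall>xs. snd (process x b k) = Some xs \<longrightarrow>
      set xs \<subseteq> items \<and> M \<le> lev k \<and> gap x (copy_from x b k) (lev k) xs)"
proof (induction k)
  case 0
  then show ?case using b by simp
next
  case (Suc k)
  let ?st = "snd (process x b k)" and ?z = "restrict x (S k)"
  have z: "\<forall>e\<in>S k. ?z e \<in> Lam" using x S_subset by (auto simp: admissible_def)
  have "\<forall>e\<in>S k. swap_cfg k ?st ?z e \<in> Lam"
  proof (cases "(k, ?st, ?z)" rule: swap_cfg.cases)
    case (1 k' i "xs" z')
    then have "i \<in> items" using Suc by auto
    then have "\<forall>e\<in>S k. side_cfg w k i e \<in> Lam" for w using side_cfg_Lam by blast
    then show ?thesis using 1 z by (auto simp: Transposition.transpose_def)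
  qed (use z in auto)
  then have fst: "\<forall>e\<in>A (Suc k). fst (process x b (Suc k)) e \<in> Lam"
    using Suc A_Suc[of k] unfolding process_Suc_fst by auto
  note adm = admissible_copy_from[OF x, of k b] admissible_copy_from[OF x fst]
  have "set xs \<subseteq> items \<and> M \<le> lev (Suc k) \<and> gap x (copy_from x b (Suc k)) (lev (Suc k)) xs"
    if st: "snd (process x b (Suc k)) = Some xs" for "xs"
  proof (cases ?st)
    case (Some xs')
    then have "xs = next_items k xs' ?z" using st unfolding process_Suc_snd by simp
    then show ?thesis
      using gap_step[OF x adm(1) adm(2) Some] Suc Some next_items_items[of xs' k ?z] lev_mono[of k "Suc k"]
      by auto
  next
    case None
    let ?c = "restrict x (A k)" and ?c' = "fst (process x b k)"
    have *: "M \<le> lev k" "?z = restrict (cfg (lev k) None t t) (S k)" "xs = plan k ?c ?c'"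
      using st None unfolding process_Suc_snd by (auto split: if_splits)
    have "copy_from x b (Suc k) e = copy_from x b k e" if "e \<in> tube_edges K d" for e
      using copy_from_Suc[OF that, of x b k] None A_Suc(2)[of k] by (auto simp: copy_from_def)
    then have eq: "copy_from x b (Suc k) e = (if e \<in> A k then ?c' e else x e)" if "e \<in> tube_edges K d" for e
      using that by (simp add: copy_from_def)
    have "matches x k None t t" using *(2) by (auto simp: matches_def restrict_def fun_eq_iff split: if_splits)
    then have "extends x (copy_from x b (Suc k)) k ?c ?c'"
      using x adm(2) eq A_subset[of k] by (auto simp: extends_def)
    then show ?thesis using plan[OF *(1)] *(1,3) lev_mono[of k "Suc k"] by auto
  qed
  then show ?case using fst by blast
qed

text \<open>An empty list of items stays empty, and without items nothing is swapped.\<close>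

lemma couple_eq_copy_from:
  assumes "snd (process x b k) = Some []" and e: "e \<in> tube_edges K d"
  shows "couple x b e = copy_from x b k e"
proof -
  have "snd (process x b j) = Some [] \<and> copy_from x b j e = copy_from x b k e" if "k \<le> j" for j
    using that
  proof (induction j rule: dec_induct)
    case (step n)
    have "copy_from x b (Suc n) e = copy_from x b n e"
      using copy_from_Suc[OF e, of x b n] A_Suc(2)[of n] conjunct1[OF step.IH] by (auto simp: copy_from_def)
    then show ?case using step unfolding process_Suc_snd by simp
  qed (use assms in simp)
  note st = this
  obtain l where l: "e \<in> A l" using A_exhausts[OF e] by blast
  then have "e \<in> A (max k l)" using A_mono[of l "max k l"] by auto
  then have "couple x b e = copy_from x b (max k l) e"
    by (simp only: couple_eq copy_from_def if_True)
  then show ?thesis using st[of "max k l"] by (simp only: max.cobounded1 simp_thms)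
qed

definition coalesce :: "config \<Rightarrow> config \<Rightarrow> bool" where
  "coalesce x y \<longleftrightarrow> (\<exists>N\<^sub>c :: real.
     (\<forall>v\<in>tube_verts K d. of_int (fst v) \<ge> N\<^sub>c \<longrightarrow> passage_time K d x I {v} = passage_time K d y I' {v}) \<and>
     (\<forall>t\<ge>N\<^sub>c. infected K d x I t = infected K d y I' t))"

lemma coalesce_if_no_debt:
  assumes x: "admissible x" and y: "admissible y" and gap: "gap x y n []"
  shows "coalesce x y"
proof -
  interpret x: fpp_config K d x by unfold_locales (rule admissible_nonneg[OF x])
  interpret y: fpp_config K d y by unfold_locales (rule admissible_nonneg[OF y])
  have px: "passage_time K d x I {v} = T x I v" if "v \<in> tube_verts K d" for v
    using I that by (intro x.passage_time_eq_dT) auto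
  have py: "passage_time K d y I' {v} = T y I' v" if "v \<in> tube_verts K d" for v
    using I' that by (intro y.passage_time_eq_dT) auto
  let ?V = "{v \<in> tube_verts K d. fst v \<in> {- int n..int n}}"
  define N where "N = Max (insert (real n) (T x I ` ?V \<union> T y I' ` ?V))"
  have fin: "finite (insert (real n) (T x I ` ?V \<union> T y I' ` ?V))"
    by (intro finite.insertI finite_UnI finite_imageI finite_tube_levels) auto
  have Nn: "real n \<le> N" unfolding N_def using fin by (rule Max_ge) simp
  have NV: "T x I v \<le> N \<and> T y I' v \<le> N" if "v \<in> ?V" for v
    unfolding N_def using that by (intro conjI Max_ge[OF fin]) blast+
  have eq: "T x I v = T y I' v" if "v \<in> tube_verts K d" "v \<notin> ?V" for v
    using gap that unfolding gap_def by fastforce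
  have "(\<forall>v\<in>tube_verts K d. of_int (fst v) \<ge> N \<longrightarrow> passage_time K d x I {v} = passage_time K d y I' {v})"
  proof (intro ballI impI)
    fix v assume v: "v \<in> tube_verts K d" "of_int (fst v) \<ge> N"
    then have "int n \<le> fst v" using Nn by linarith
    then show "passage_time K d x I {v} = passage_time K d y I' {v}"
      using gap v(1) px py by (auto simp: gap_def)
  qed
  moreover have "infected K d x I t = infected K d y I' t" if "t \<ge> N" for t
  proof -
    have "T x I v \<le> t \<longleftrightarrow> T y I' v \<le> t" if "v \<in> tube_verts K d" for v
      using NV[of v] eq[of v] that \<open>t \<ge> N\<close> by fastforce
    then show ?thesis using px py by (auto simp: infected_def)
  qed
  ultimately show ?thesis unfolding coalesce_def by blast
qed

end

section \<open>The list of items is worked off almost surely\<close>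

text \<open>An upper bound for the probability that a nonempty list survives \<open>j\<close> steps, if in each step its
  head is deleted or doubled with the same probability \<open>q\<close>, where \<open>q\<close> may be any number between
  \<open>\<epsilon> x\<close> and \<open>1 / 2\<close>. The maximum over \<open>q\<close> is attained at an end point.\<close>

primrec survival :: "('a \<Rightarrow> real) \<Rightarrow> nat \<Rightarrow> 'a list \<Rightarrow> real" where
  "survival \<epsilon> 0 xs = (if xs = [] then 0 else 1)"
| "survival \<epsilon> (Suc j) xs = (case xs of [] \<Rightarrow> 0 | x # ys \<Rightarrow>
     max ((survival \<epsilon> j ys + survival \<epsilon> j (x # x # ys)) / 2)
         ((1 - 2 * \<epsilon> x) * survival \<epsilon> j xs + \<epsilon> x * (survival \<epsilon> j ys + survival \<epsilon> j (x # x # ys))))"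

lemma survival_Nil [simp]: "survival \<epsilon> j [] = 0"
  by (cases j) auto

lemma survival_step:
  assumes "\<epsilon> x \<le> q" "q \<le> 1 / 2"
  shows "(1 - 2 * q) * survival \<epsilon> j (x # ys) + q * (survival \<epsilon> j ys + survival \<epsilon> j (x # x # ys))
    \<le> survival \<epsilon> (Suc j) (x # ys)"
proof -
  define a where "a = survival \<epsilon> j (x # ys)"
  define b where "b = survival \<epsilon> j ys + survival \<epsilon> j (x # x # ys)"
  have "(1 - 2 * q) * a + q * b = a + q * (b - 2 * a)" by (simp add: algebra_simps)
  also have "\<dots> \<le> max (b / 2) ((1 - 2 * \<epsilon> x) * a + \<epsilon> x * b)"
  proof (cases "0 \<le> b - 2 * a")
    case True
    then have "q * (b - 2 * a) \<le> 1 / 2 * (b - 2 * a)" using assms by (intro mult_right_mono) auto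
    then have "a + q * (b - 2 * a) \<le> b / 2" by (simp add: algebra_simps)
    then show ?thesis by simp
  next
    case False
    then have "q * (b - 2 * a) \<le> \<epsilon> x * (b - 2 * a)" using assms by (intro mult_right_mono_neg) auto
    then have "a + q * (b - 2 * a) \<le> (1 - 2 * \<epsilon> x) * a + \<epsilon> x * b" by (simp add: algebra_simps)
    then show ?thesis by simp
  qed
  finally show ?thesis by (simp add: a_def b_def)
qed

lemma survival_bounds:
  assumes "\<And>x. 0 < \<epsilon> x" "\<And>x. \<epsilon> x \<le> 1 / 2"
  shows "0 \<le> survival \<epsilon> j xs \<and> survival \<epsilon> j xs \<le> 1"
proof (induction j arbitrary: xs)
  case (Suc j)
  show ?case
  proof (cases xs)
    case (Cons x ys)
    let ?a = "survival \<epsilon> j xs" and ?b = "survival \<epsilon> j ys" and ?c = "survival \<epsilon> j (x # x # ys)"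
    note b = Suc.IH[of xs] Suc.IH[of ys] Suc.IH[of "x # x # ys"]
    have e: "0 \<le> \<epsilon> x" "0 \<le> 1 - 2 * \<epsilon> x" using assms(1,2)[of x] by auto
    have "(1 - 2 * \<epsilon> x) * ?a + \<epsilon> x * (?b + ?c) \<le> (1 - 2 * \<epsilon> x) * 1 + \<epsilon> x * 2"
      using b e by (intro add_mono mult_left_mono) auto
    then have "(1 - 2 * \<epsilon> x) * ?a + \<epsilon> x * (?b + ?c) \<le> 1" by simp
    moreover have "0 \<le> (?b + ?c) / 2" "(?b + ?c) / 2 \<le> 1" using b by auto
    ultimately show ?thesis using Cons by (simp add: le_max_iff_disj)
  qed simp
qed simp

lemma survival_decreasing:
  assumes "\<And>x. 0 < \<epsilon> x" "\<And>x. \<epsilon> x \<le> 1 / 2"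
  shows "survival \<epsilon> (Suc j) xs \<le> survival \<epsilon> j xs"
proof (induction j arbitrary: xs)
  case 0
  show ?case using survival_bounds[of \<epsilon> "Suc 0" xs] assms by (cases xs) auto
next
  case (Suc j)
  show ?case
  proof (cases xs)
    case (Cons x ys)
    have e: "0 \<le> \<epsilon> x" "0 \<le> 1 - 2 * \<epsilon> x" using assms(1,2)[of x] by auto
    have "survival \<epsilon> (Suc (Suc j)) xs =
      max ((survival \<epsilon> (Suc j) ys + survival \<epsilon> (Suc j) (x # x # ys)) / 2)
         ((1 - 2 * \<epsilon> x) * survival \<epsilon> (Suc j) xs
           + \<epsilon> x * (survival \<epsilon> (Suc j) ys + survival \<epsilon> (Suc j) (x # x # ys)))"
      by (subst survival.simps(2)) (simp only: Cons list.case)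
    also have "\<dots> \<le> max ((survival \<epsilon> j ys + survival \<epsilon> j (x # x # ys)) / 2)
         ((1 - 2 * \<epsilon> x) * survival \<epsilon> j xs + \<epsilon> x * (survival \<epsilon> j ys + survival \<epsilon> j (x # x # ys)))"
      by (intro max.mono add_mono mult_left_mono divide_right_mono Suc.IH e) auto
    also have "\<dots> = survival \<epsilon> (Suc j) xs" using Cons by simp
    finally show ?thesis .
  qed simp
qed

text \<open>The limit is a bounded harmonic function of the number of copies of the head, hence it vanishes.\<close>

lemma survival_tendsto_0:
  assumes \<epsilon>: "\<And>x. 0 < \<epsilon> x" "\<And>x. \<epsilon> x \<le> 1 / 2"
  shows "(\<lambda>j. survival \<epsilon> j xs) \<longlonglongrightarrow> 0"
proof -
  note bounds = survival_bounds[of \<epsilon>, OF \<epsilon>]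
  have "\<exists>l. (\<lambda>j. survival \<epsilon> j xs) \<longlonglongrightarrow> l" for xs
  proof -
    have "decseq (\<lambda>j. survival \<epsilon> j xs)" by (intro decseq_SucI survival_decreasing \<epsilon>)
    then show ?thesis using decseq_convergent[of "\<lambda>j. survival \<epsilon> j xs" 0] bounds by metis
  qed
  then obtain h where h: "\<And>xs. (\<lambda>j. survival \<epsilon> j xs) \<longlonglongrightarrow> h xs" by metis
  have h01: "0 \<le> h xs" "h xs \<le> 1" for xs
    using LIMSEQ_le_const[OF h] LIMSEQ_le_const2[OF h] bounds by blast+
  have h_Nil: "h [] = 0" using LIMSEQ_unique[OF h[of "[]"]] by simp
  have harmonic: "2 * h (x # ys) = h ys + h (x # x # ys)" for x ys
  proof -
    let ?m = "max ((h ys + h (x # x # ys)) / 2) ((1 - 2 * \<epsilon> x) * h (x # ys) + \<epsilon> x * (h ys + h (x # x # ys)))"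
    have "(\<lambda>j. survival \<epsilon> (Suc j) (x # ys)) \<longlonglongrightarrow> ?m"
      by (simp, intro tendsto_intros h) auto
    moreover have "(\<lambda>j. survival \<epsilon> (Suc j) (x # ys)) \<longlonglongrightarrow> h (x # ys)" using h LIMSEQ_Suc by blast
    ultimately have "h (x # ys) = ?m" by (rule LIMSEQ_unique[rotated])
    then consider "h (x # ys) = (h ys + h (x # x # ys)) / 2"
      | "h (x # ys) = (1 - 2 * \<epsilon> x) * h (x # ys) + \<epsilon> x * (h ys + h (x # x # ys))"
      by (metis max_def)
    then show ?thesis
    proof cases
      case 2
      then have "\<epsilon> x * (2 * h (x # ys)) = \<epsilon> x * (h ys + h (x # x # ys))" by (simp add: algebra_simps)
      then show ?thesis using \<epsilon>(1)[of x] by simp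
    qed simp
  qed
  have "h xs = 0" for xs
  proof (induction xs)
    case (Cons x ys)
    \<comment> \<open>As a function of the number of copies of the head, \<open>h\<close> is linear, and it is bounded by \<open>1\<close>.\<close>
    define g where "g n = h (replicate n x @ ys)" for n
    have g: "g (Suc (Suc n)) = 2 * g (Suc n) - g n" for n
      using harmonic[of x "replicate n x @ ys"] by (simp add: g_def)
    have "g n = real n * g 1 \<and> g (Suc n) = real (Suc n) * g 1" for n
      by (induction n) (use Cons in \<open>auto simp: g algebra_simps g_def[of 0]\<close>)
    then have lin: "real n * g 1 \<le> 1" for n using h01(2)[of "replicate n x @ ys"] by (metis g_def)
    have "g 1 = 0"
    proof (rule ccontr)
      assume "g 1 \<noteq> 0"
      then have "0 < g 1" using h01(1)[of "replicate 1 x @ ys"] unfolding g_def[symmetric] by simp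
      then obtain n :: nat where "1 < real n * g 1" using ex_less_of_nat_mult by blast
      then show False using lin[of n] by simp
    qed
    then show ?case by (simp add: g_def)
  qed (rule h_Nil)
  then show ?thesis using h[of xs] by simp
qed

context scheme begin

text \<open>Values outside the countable set \<open>Lam\<close> have probability \<open>0\<close>. They are replaced by \<open>t\<close>, so that
  every function of finitely many passage times becomes measurable.\<close>

definition disc :: "real \<Rightarrow> real" where
  "disc r = (if r \<in> Lam then r else t)"

lemma disc_Lam [simp]: "disc r \<in> Lam" "r \<in> Lam \<Longrightarrow> disc r = r"
  using t_Lam by (auto simp: disc_def)

definition discretize :: "config \<Rightarrow> config" where
  "discretize x = (\<lambda>e. disc (x e))"

end

locale random_scheme = scheme +
  fixes p :: "real pmf"
  assumes set_p: "set_pmf p = Lam"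
begin

definition B :: "nat \<Rightarrow> edge set" where
  "B k = A k - A 0"

lemma B_Suc: "B (Suc k) = B k \<union> S k" "B k \<inter> S k = {}" "finite (B k)"
  using A_Suc[of k] A_mono[of 0 k] finite_A[of k] by (auto simp: B_def)

lemma A_B: "A k = A 0 \<union> B k"
  using A_mono[of 0 k] by (auto simp: B_def)

abbreviation PX :: "nat \<Rightarrow> config pmf" where
  "PX k \<equiv> Pi_pmf (B k) undefined (\<lambda>_. p)"

abbreviation PS :: "nat \<Rightarrow> config pmf" where
  "PS k \<equiv> Pi_pmf (S k) undefined (\<lambda>_. p)"

definition join :: "config \<Rightarrow> config \<Rightarrow> config" where
  "join a c = (\<lambda>e. if e \<in> A 0 then disc (a e) else disc (c e))"

lemma admissible_join: "admissible (join a c)"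
  by (simp add: admissible_def join_def)

definition run :: "config \<Rightarrow> config \<Rightarrow> nat \<Rightarrow> config \<Rightarrow> config \<times> item list option" where
  "run a b k c = process (join a c) (discretize b) k"

lemma run_invariant:
  "(\<forall>e\<in>A k. fst (run a b k c) e \<in> Lam) \<and>
   (\<forall>xs. snd (run a b k c) = Some xs \<longrightarrow> set xs \<subseteq> items \<and> M \<le> lev k \<and>
      gap (join a c) (copy_from (join a c) (discretize b) k) (lev k) xs)"
  unfolding run_def by (intro process_invariant admissible_join) (simp add: discretize_def)

definition glue_cfg :: "nat \<Rightarrow> config \<times> config \<Rightarrow> config" where
  "glue_cfg k = (\<lambda>(f, g) e. if e \<in> B k then f e else g e)"

lemma PX_Suc: "PX (Suc k) = map_pmf (glue_cfg k) (pair_pmf (PX k) (PS k))"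
  unfolding B_Suc(1) glue_cfg_def
  by (rule Pi_pmf_union) (use B_Suc finite_S in auto)

lemma PS_D:
  assumes "g \<in> set_pmf (PS k)"
  shows "restrict g (S k) = g" "e \<in> S k \<Longrightarrow> disc (g e) = g e"
proof -
  have "g \<in> PiE_dflt (S k) undefined (\<lambda>_. Lam)"
    using assms set_Pi_pmf[OF finite_S, of k undefined "\<lambda>_. p"] set_p by simp
  then show "restrict g (S k) = g" "e \<in> S k \<Longrightarrow> disc (g e) = g e"
    by (auto simp: PiE_dflt_def restrict_def)
qed

lemma run_Suc:
  assumes g: "g \<in> set_pmf (PS k)"
  shows "fst (run a b (Suc k) (glue_cfg k (f, g))) =
      merge (A k) (S k) (fst (run a b k f), swap_cfg k (snd (run a b k f)) g)"
    and "snd (run a b (Suc k) (glue_cfg k (f, g))) =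
      next_state k (restrict (join a f) (A k)) (fst (run a b k f)) (snd (run a b k f)) g"
proof -
  let ?x = "join a (glue_cfg k (f, g))"
  have "?x e = join a f e" if "e \<in> A k" for e
    using that by (auto simp: join_def glue_cfg_def B_def)
  then have 1: "process ?x (discretize b) k = run a b k f" "restrict ?x (A k) = restrict (join a f) (A k)"
    unfolding run_def by (auto intro: process_cong simp: restrict_def fun_eq_iff)
  have "e \<notin> A 0" "e \<notin> B k" if "e \<in> S k" for e using that A_Suc[of k] A_mono[of 0 k] by (auto simp: B_def)
  then have "restrict ?x (S k) = restrict g (S k)"
    using PS_D(2)[OF g] by (auto simp: join_def glue_cfg_def restrict_def fun_eq_iff)
  then have 2: "restrict ?x (S k) = g" using PS_D(1)[OF g] by simp
  show "fst (run a b (Suc k) (glue_cfg k (f, g))) =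
      merge (A k) (S k) (fst (run a b k f), swap_cfg k (snd (run a b k f)) g)"
    unfolding run_def[of _ _ "Suc k"] process_Suc_fst 1 2 ..
  show "snd (run a b (Suc k) (glue_cfg k (f, g))) =
      next_state k (restrict (join a f) (A k)) (fst (run a b k f)) (snd (run a b k f)) g"
    unfolding run_def[of _ _ "Suc k"] process_Suc_snd 1 2 ..
qed

subsection \<open>Swaps preserve the product measure\<close>

definition swap_lines :: "vertex \<Rightarrow> vertex" where
  "swap_lines v = (fst v, Transposition.transpose origin unit1 (snd v))"

lemma swap_lines_simps [simp]:
  "fst (swap_lines v) = fst v" "swap_lines (swap_lines v) = v"
  "snd (swap_lines v) = Transposition.transpose origin unit1 (snd v)"
  by (auto simp: swap_lines_def)

text \<open>The permutation of the edges that turns a straight segment into one with a detour.\<close>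

definition exchange :: "nat \<Rightarrow> bool \<Rightarrow> edge \<Rightarrow> edge" where
  "exchange n sd e = (if in_seg n (Some sd) e \<and> (snd ` e = {origin} \<or> snd ` e = {unit1})
     then swap_lines ` e else e)"

lemma swap_lines_image: "fst ` swap_lines ` e = fst ` e"
  "snd ` swap_lines ` e = Transposition.transpose origin unit1 ` snd ` e"
  by (simp_all add: image_image)

lemma exchange_on_seg:
  "in_seg n (Some sd) e \<and> (snd ` e = {origin} \<or> snd ` e = {unit1}) \<Longrightarrow> exchange n sd e = swap_lines ` e"
  unfolding exchange_def by (rule if_P)

lemma exchange_exchange: "exchange n sd (exchange n sd e) = e"
proof -
  have "in_seg n (Some sd) (swap_lines ` e) = in_seg n (Some sd) e"
    unfolding in_seg_iff swap_lines_image ..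
  note seg = this
  show ?thesis
  proof (cases "in_seg n (Some sd) e \<and> (snd ` e = {origin} \<or> snd ` e = {unit1})")
    case True
    have "snd ` swap_lines ` e = {unit1} \<or> snd ` swap_lines ` e = {origin}"
      using True unfolding swap_lines_image by (elim conjE disjE) simp_all
    then have "exchange n sd (swap_lines ` e) = swap_lines ` swap_lines ` e"
      unfolding exchange_def seg using True by (simp only: disj_commute if_True simp_thms)
    moreover have "swap_lines ` swap_lines ` e = e" by (simp add: image_image)
    ultimately show ?thesis using exchange_on_seg[OF True] by simp
  next
    case False
    then show ?thesis by (simp only: exchange_def if_False)
  qed
qed

lemma exchange_S: "e \<in> S k \<Longrightarrow> exchange n sd e \<in> S k"
proof -
  assume e: "e \<in> S k"
  show ?thesis
  proof (cases "in_seg n (Some sd) e \<and> (snd ` e = {origin} \<or> snd ` e = {unit1})")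
    case True
    obtain u v where uv: "e = {u, v}" "adj u v" using e S_subset tube_edgeE by blast
    then have "snd u = snd v" using True by auto
    moreover have "snd u = origin \<or> snd u = unit1" using True uv by auto
    moreover have "swap_lines u = (fst u, Transposition.transpose origin unit1 (snd u))"
      "swap_lines v = (fst v, Transposition.transpose origin unit1 (snd v))"
      by (simp_all add: swap_lines_def)
    ultimately have "swap_lines u \<in> tube_verts K d" "swap_lines v \<in> tube_verts K d"
      "l1_dist d (swap_lines u) (swap_lines v) = l1_dist d u v"
      using origin_vert unit1_vert by (auto simp: l1_dist_def)
    then have "adj (swap_lines u) (swap_lines v)" using uv(2) unfolding adj_iff by (simp only: simp_thms)
    then have "swap_lines ` e \<in> tube_edges K d" using uv by simp
    then show ?thesis
      using e True unfolding exchange_def S_def A_def inner_edges_def by (simp add: swap_lines_image)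
  next
    case False
    then show ?thesis using e by (simp only: exchange_def if_False)
  qed
qed

lemma cfg_exchange: "cfg n None lam mu (exchange n sd e) = cfg n (Some sd) lam mu e"
proof (cases "in_seg n (Some sd) e \<and> (snd ` e = {origin} \<or> snd ` e = {unit1})")
  case True
  have x: "snd ` exchange n sd e = Transposition.transpose origin unit1 ` snd ` e"
    using exchange_on_seg[OF True] by (simp only: swap_lines_image)
  from True have seg: "in_seg n (Some sd) e" and "snd ` e = {origin} \<or> snd ` e = {unit1}" by blast+
  from this(2) show ?thesis
  proof
    assume 1: "snd ` e = {origin}"
    then have "snd ` exchange n sd e = {unit1}" unfolding x by simp
    then show ?thesis using 1 seg origin_neq_unit1 by (simp add: cfg_def)
  next
    assume 1: "snd ` e = {unit1}"
    then have "snd ` exchange n sd e = {origin}" unfolding x by simp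
    then show ?thesis using 1 seg origin_neq_unit1 by (simp add: cfg_def)
  qed
next
  case False
  then have "exchange n sd e = e" by (simp only: exchange_def if_False)
  moreover have "cfg n None lam mu e = cfg n (Some sd) lam mu e"
    unfolding cfg_def in_seg.simps(1) using False by presburger
  ultimately show ?thesis by simp
qed

lemma pmf_side_cfg:
  "pmf (PS k) (side_cfg w k (sd, sg, lam, mu)) = (\<Prod>e\<in>S k. pmf p (cfg (lev k) None lam mu e))"
proof -
  have "(\<Prod>e\<in>S k. pmf p (cfg (lev k) (Some sd) lam mu e)) = (\<Prod>e\<in>S k. pmf p (cfg (lev k) None lam mu e))"
    by (rule prod.reindex_bij_witness[of _ "exchange (lev k) sd" "exchange (lev k) sd"])
      (auto simp: exchange_exchange exchange_S cfg_exchange)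
  moreover have "pmf (PS k) (side_cfg w k (sd, sg, lam, mu)) =
      (\<Prod>e\<in>S k. pmf p (cfg (lev k) (if sg = w then None else Some sd) lam mu e))"
    by (subst pmf_Pi'[OF finite_S]) auto
  ultimately show ?thesis by auto
qed

lemma map_swap_cfg: "map_pmf (swap_cfg k st) (PS k) = PS k"
proof (cases "(k, st, undefined :: config)" rule: swap_cfg.cases)
  case (1 k' i xs z)
  let ?\<sigma> = "Transposition.transpose (side_cfg True k i) (side_cfg False k i)"
  obtain sd sg lam mu where i: "i = (sd, sg, lam, mu)" by (metis surj_pair)
  have "map_pmf ?\<sigma> (PS k) = PS k"
  proof (rule pmf_eqI)
    fix z
    have "pmf (map_pmf ?\<sigma> (PS k)) z = pmf (map_pmf ?\<sigma> (PS k)) (?\<sigma> (?\<sigma> z))" by simp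
    also have "\<dots> = pmf (PS k) (?\<sigma> z)" by (rule pmf_map_inj') simp
    also have "\<dots> = pmf (PS k) z"
      by (auto simp: Transposition.transpose_def i pmf_side_cfg simp del: side_cfg.simps)
    finally show "pmf (map_pmf ?\<sigma> (PS k)) z = pmf (PS k) z" .
  qed
  moreover have "swap_cfg k st = ?\<sigma>" using 1 by (auto simp: fun_eq_iff)
  ultimately show ?thesis by simp
qed (simp_all add: fun_eq_iff[symmetric] map_pmf_ident cong: map_pmf_cong)

text \<open>In each shell the second configuration is the image of the first one under the identity or a
  transposition of two equally likely configurations. This map is determined by the earlier shells, so
  conditionally on these the second configuration has the product law.\<close>

lemma run_preserves: "map_pmf (\<lambda>c. restrict (fst (run a b k c)) (B k)) (PX k) = PX k"
proof (induction k)
  case 0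
  then show ?case by (simp add: B_def restrict_def)
next
  case (Suc k)
  let ?\<Theta> = "\<lambda>f. restrict (fst (run a b k f)) (B k)" and ?st = "\<lambda>f. snd (run a b k f)"
  have step: "restrict (fst (run a b (Suc k) (glue_cfg k (f, g)))) (B (Suc k)) =
      glue_cfg k (?\<Theta> f, swap_cfg k (?st f) g)" if g: "g \<in> set_pmf (PS k)" for f g
  proof -
    have "swap_cfg k (?st f) g \<in> set_pmf (map_pmf (swap_cfg k (?st f)) (PS k))" using g by auto
    then have "swap_cfg k (?st f) g \<in> set_pmf (PS k)" by (simp add: map_swap_cfg)
    then have out: "swap_cfg k (?st f) g e = undefined" if "e \<notin> S k" for e
      using PS_D(1) that by (metis restrict_apply)
    have BA: "e \<in> A k" if "e \<in> B k" for e using that by (simp add: B_def)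
    show ?thesis
    proof (rule ext)
      fix e
      consider "e \<in> B k" "e \<in> A k" | "e \<in> S k" "e \<notin> A k" "e \<notin> B k" | "e \<notin> S k" "e \<notin> B k"
        using BA A_Suc(2)[of k] by blast
      then show "restrict (fst (run a b (Suc k) (glue_cfg k (f, g)))) (B (Suc k)) e =
          glue_cfg k (?\<Theta> f, swap_cfg k (?st f) g) e"
        unfolding run_Suc(1)[OF g] B_Suc(1)
        by cases (simp_all add: glue_cfg_def merge_def out)
    qed
  qed
  have "map_pmf (\<lambda>c. restrict (fst (run a b (Suc k) c)) (B (Suc k))) (PX (Suc k)) =
      bind_pmf (PX k) (\<lambda>f. map_pmf (\<lambda>g. restrict (fst (run a b (Suc k) (glue_cfg k (f, g)))) (B (Suc k))) (PS k))"
    unfolding PX_Suc pair_pmf_def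
    by (simp add: map_pmf_def bind_assoc_pmf bind_return_pmf)
  also have "\<dots> = bind_pmf (PX k) (\<lambda>f. map_pmf (\<lambda>g. glue_cfg k (?\<Theta> f, swap_cfg k (?st f) g)) (PS k))"
    by (intro bind_pmf_cong refl map_pmf_cong step)
  also have "\<dots> = bind_pmf (PX k) (\<lambda>f. map_pmf (\<lambda>g. glue_cfg k (?\<Theta> f, g)) (map_pmf (swap_cfg k (?st f)) (PS k)))"
    by (simp add: map_pmf_comp)
  also have "\<dots> = bind_pmf (map_pmf ?\<Theta> (PX k)) (\<lambda>f. map_pmf (\<lambda>g. glue_cfg k (f, g)) (PS k))"
    by (simp add: map_swap_cfg bind_map_pmf)
  also have "\<dots> = PX (Suc k)"
    unfolding Suc PX_Suc pair_pmf_def by (simp add: map_pmf_def bind_assoc_pmf bind_return_pmf)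
  finally show ?case .
qed

subsection \<open>Waiting times\<close>

text \<open>The probabilities of the two configurations of an item are bounded from below uniformly over
  the shells, because the number of edges of a shell is bounded.\<close>

definition shell_bound :: nat where
  "shell_bound = 2 ^ ((2 * (3 * L + 2)) * K ^ (d - 1))"

lemma card_S_le: "card (S k) \<le> shell_bound"
proof -
  define n where "n = int (lev k)"
  let ?R = "{n..n + 3 * int L + 1} \<union> {- (n + 3 * int L + 1)..- n}"
  let ?V = "?R \<times> ({..<d - 1} \<rightarrow>\<^sub>E {..<K})"
  have "S k \<subseteq> Pow ?V"
  proof
    fix e assume e: "e \<in> S k"
    obtain u v where uv: "e = {u, v}" "adj u v" using e S_subset tube_edgeE by blast
    have 1: "fst ` e \<subseteq> {- (n + 3 * int L + 1)..n + 3 * int L + 1}"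
      and 2: "e \<in> tube_edges K d" and 3: "e \<notin> inner_edges K d (lev k)"
      using e by (auto simp: S_def A_def inner_edges_def lev_Suc n_def)
    have "\<bar>fst u - fst v\<bar> \<le> 1" using uv(2) by (cases rule: adj_cases) auto
    moreover have "\<not> (fst ` e \<subseteq> {- n..n} \<and> fst ` e \<noteq> {- n} \<and> fst ` e \<noteq> {n})"
      using 2 3 by (auto simp: inner_edges_def n_def)
    ultimately have "n \<le> \<bar>fst u\<bar> \<and> n \<le> \<bar>fst v\<bar>"
      unfolding uv(1) by (auto simp: abs_if split: if_splits)
    then have "fst u \<in> ?R" "fst v \<in> ?R" using 1 uv(1) by (auto simp: abs_if split: if_splits)
    then show "e \<in> Pow ?V" using adjD[OF uv(2)] uv(1) by (auto simp: tube_verts_iff mem_Times_iff)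
  qed
  moreover have fin: "finite ?V" by (intro finite_cartesian_product finite_PiE) auto
  ultimately have "card (S k) \<le> 2 ^ card ?V"
    by (metis card_Pow card_mono finite_Pow_iff)
  also have "card ?R \<le> (3 * L + 2) + (3 * L + 2)"
    by (rule order_trans[OF card_Un_le]) simp
  then have "card ?R * K ^ (d - 1) \<le> (2 * (3 * L + 2)) * K ^ (d - 1)" by (intro mult_le_mono1) simp
  then have "card ?V \<le> (2 * (3 * L + 2)) * K ^ (d - 1)"
    by (simp only: card_cartesian_product card_PiE finite_lessThan prod_constant card_lessThan)
  then have "(2::nat) ^ card ?V \<le> shell_bound" unfolding shell_bound_def by (rule power_increasing) simp
  finally show ?thesis .
qed

definition min_weight :: "real \<Rightarrow> real \<Rightarrow> real" where
  "min_weight lam mu = min (1 / 2) (Min (pmf p ` {s, thick lam mu, lam, mu}) ^ shell_bound)"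

lemma min_weight_pos:
  assumes "lam \<in> Lam" "mu \<in> Lam" shows "0 < min_weight lam mu"
proof -
  have "0 < pmf p x" if "x \<in> {s, thick lam mu, lam, mu}" for x
    using that assms s_Lam thick_in set_p by (auto intro: pmf_positive)
  then show ?thesis unfolding min_weight_def by (auto intro!: zero_less_power)
qed

lemma min_weight_le:
  assumes "lam \<in> Lam" "mu \<in> Lam"
  shows "min_weight lam mu \<le> (\<Prod>e\<in>S k. pmf p (cfg (lev k) None lam mu e))"
proof -
  let ?m = "Min (pmf p ` {s, thick lam mu, lam, mu})"
  have m: "0 \<le> ?m" "?m \<le> 1"
    by (simp, rule order_trans[OF Min_le[of _ "pmf p s"]]) (auto simp: pmf_le_1)
  have "min_weight lam mu \<le> ?m ^ shell_bound" by (simp add: min_weight_def)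
  also have "\<dots> \<le> ?m ^ card (S k)" using m by (intro power_decreasing card_S_le)
  also have "\<dots> = (\<Prod>e\<in>S k. ?m)" by simp
  also have "\<dots> \<le> (\<Prod>e\<in>S k. pmf p (cfg (lev k) None lam mu e))"
    using m by (intro prod_mono conjI Min_le) (auto simp: cfg_def)
  finally show ?thesis .
qed

end

context random_scheme begin

definition eps :: "item \<Rightarrow> real" where
  "eps = (\<lambda>(sd, sg, lam, mu). if lam \<in> Lam \<and> mu \<in> Lam then min_weight lam mu else 1 / 2)"

lemma eps: "0 < eps i" "eps i \<le> 1 / 2"
  using min_weight_pos by (auto simp: eps_def split_beta min_weight_def)

text \<open>As long as no pads have appeared nothing is claimed, which is expressed by the trivial bound \<open>1\<close>.\<close>

definition risk :: "nat \<Rightarrow> item list option \<Rightarrow> real" where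
  "risk j st = (case st of None \<Rightarrow> 1 | Some xs \<Rightarrow> survival eps j xs)"

lemma risk_bounds: "0 \<le> risk j st" "risk j st \<le> 1"
  using survival_bounds[of eps, OF eps] by (auto simp: risk_def split: option.split)

lemma nn_integral_pmf_real:
  assumes "\<And>x. 0 \<le> f x" "\<And>x. f x \<le> (1::real)"
  shows "(\<integral>\<^sup>+x. ennreal (f x) \<partial>measure_pmf q) = ennreal (measure_pmf.expectation q f)"
  using assms by (intro nn_integral_eq_integral measure_pmf.integrable_const_bound[where B = 1]) auto

lemma risk_drift:
  assumes st: "\<And>xs. st = Some xs \<Longrightarrow> set xs \<subseteq> items"
  shows "(\<integral>\<^sup>+g. ennreal (risk j (next_state k C c' st g)) \<partial>PS k) \<le> ennreal (risk (Suc j) st)"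
proof (cases st)
  case None
  have "(\<integral>\<^sup>+g. ennreal (risk j (next_state k C c' st g)) \<partial>PS k) \<le> (\<integral>\<^sup>+g. 1 \<partial>PS k)"
    using risk_bounds by (intro nn_integral_mono) auto
  then show ?thesis using None by (simp add: risk_def measure_pmf.emeasure_space_1)
next
  case (Some xs)
  show ?thesis
  proof (cases xs)
    case Nil
    then show ?thesis using Some by (simp add: risk_def)
  next
    case (Cons i ys)
    obtain sd sg lam mu where i: "i = (sd, sg, lam, mu)" by (metis surj_pair)
    have items: "i \<in> items" using st[OF Some] Cons by auto
    then have lam: "lam \<in> Lam" "mu \<in> Lam" by (auto simp: items_def i)
    let ?F = "side_cfg True k i" and ?G = "side_cfg False k i"
    define q where "q = pmf (PS k) ?F"
    have qG: "pmf (PS k) ?G = q" unfolding q_def i by (simp only: pmf_side_cfg)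
    have neq: "?F \<noteq> ?G" using items by (rule side_cfg_neq)
    have q1: "eps i \<le> q" using min_weight_le[OF lam, of k] lam unfolding q_def i pmf_side_cfg by (simp add: eps_def)
    have "measure_pmf.prob (PS k) {?F, ?G} = 2 * q"
      using neq qG by (simp add: measure_measure_pmf_finite q_def)
    then have q2: "q \<le> 1 / 2" using measure_pmf.prob_le_1[of "PS k" "{?F, ?G}"] by simp
    let ?v = "survival eps j xs" and ?y = "survival eps j ys" and ?z = "survival eps j (i # i # ys)"
    have nx: "risk j (next_state k C c' st g) =
        ?v + ((?y - ?v) * indicator {?F} g + (?z - ?v) * indicator {?G} g)" for g
      using neq unfolding Some Cons risk_def by (auto simp: indicator_def)
    have "measure_pmf.expectation (PS k) (\<lambda>g. risk j (next_state k C c' st g)) =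
        ?v + ((?y - ?v) * q + (?z - ?v) * q)"
      unfolding nx
      by (subst Bochner_Integration.integral_add; (subst Bochner_Integration.integral_add)?)
        (auto simp: measure_pmf_single qG q_def measure_pmf.emeasure_eq_measure
          intro!: integrable_real_indicator Bochner_Integration.integrable_add)
    also have "\<dots> = (1 - 2 * q) * ?v + q * (?y + ?z)" by (simp add: algebra_simps)
    also have "\<dots> \<le> survival eps (Suc j) xs" unfolding Cons by (rule survival_step[where \<epsilon> = eps, OF q1 q2])
    also have "\<dots> = risk (Suc j) st" using Some by (simp add: risk_def)
    finally show ?thesis
      by (subst nn_integral_pmf_real) (auto intro: risk_bounds ennreal_leI)
  qed
qed

lemma nn_integral_PX_Suc:
  "(\<integral>\<^sup>+c. F (snd (run a b (Suc k) c)) \<partial>PX (Suc k)) =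
   (\<integral>\<^sup>+f. \<integral>\<^sup>+g. F (next_state k (restrict (join a f) (A k)) (fst (run a b k f)) (snd (run a b k f)) g) \<partial>PS k \<partial>PX k)"
  unfolding PX_Suc nn_integral_map_pmf nn_integral_pair_pmf'
  by (intro nn_integral_cong nn_integral_cong_AE) (auto simp: AE_measure_pmf_iff run_Suc(2))

lemma risk_step:
  "(\<integral>\<^sup>+c. ennreal (risk j (snd (run a b (Suc k) c))) \<partial>PX (Suc k))
    \<le> (\<integral>\<^sup>+c. ennreal (risk (Suc j) (snd (run a b k c))) \<partial>PX k)"
  unfolding nn_integral_PX_Suc[where F = "\<lambda>st. ennreal (risk j st)"]
  by (intro nn_integral_mono risk_drift) (use run_invariant in blast)

lemma risk_steps:
  "(\<integral>\<^sup>+c. ennreal (risk 0 (snd (run a b (k + j) c))) \<partial>PX (k + j))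
    \<le> (\<integral>\<^sup>+c. ennreal (risk j (snd (run a b k c))) \<partial>PX k)"
proof -
  have "(\<integral>\<^sup>+c. ennreal (risk l (snd (run a b (k + j) c))) \<partial>PX (k + j))
    \<le> (\<integral>\<^sup>+c. ennreal (risk (l + j) (snd (run a b k c))) \<partial>PX k)" for l
  proof (induction j arbitrary: l)
    case (Suc j)
    have "(\<integral>\<^sup>+c. ennreal (risk l (snd (run a b (k + Suc j) c))) \<partial>PX (k + Suc j))
      \<le> (\<integral>\<^sup>+c. ennreal (risk (Suc l) (snd (run a b (k + j) c))) \<partial>PX (k + j))"
      using risk_step[where k = "k + j"] by (simp only: add_Suc_right)
    also have "\<dots> \<le> (\<integral>\<^sup>+c. ennreal (risk (Suc l + j) (snd (run a b k c))) \<partial>PX k)" by (rule Suc.IH)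
    finally show ?case by simp
  qed simp
  from this[of 0] show ?thesis by simp
qed

definition waiting :: "config \<Rightarrow> config \<Rightarrow> nat \<Rightarrow> real" where
  "waiting a b k = measure_pmf.prob (PX k) {c. snd (run a b k c) = None}"

lemma waiting_Suc:
  assumes M: "M \<le> lev k"
  shows "waiting a b (Suc k) \<le> (1 - min_weight t t) * waiting a b k"
proof -
  let ?N = "\<lambda>st :: item list option. indicator {None} st :: ennreal"
  let ?w = "min_weight t t"
  have w: "0 < ?w" "?w \<le> 1" using min_weight_pos[OF t_Lam t_Lam] by (auto simp: min_weight_def)
  have em: "ennreal (waiting a b k) = (\<integral>\<^sup>+c. ?N (snd (run a b k c)) \<partial>PX k)" for k
  proof -
    have "ennreal (waiting a b k) = (\<integral>\<^sup>+c. indicator {c. snd (run a b k c) = None} c \<partial>PX k)"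
      by (simp add: waiting_def measure_pmf.emeasure_eq_measure)
    also have "\<dots> = (\<integral>\<^sup>+c. ?N (snd (run a b k c)) \<partial>PX k)"
      by (intro nn_integral_cong) (auto simp: indicator_def)
    finally show ?thesis .
  qed
  let ?z = "side_cfg True k (True, True, t, t)"
  have inner: "(\<integral>\<^sup>+g. ?N (next_state k C c' st g) \<partial>PS k) \<le> ennreal (1 - ?w) * ?N st" for C c' st
  proof (cases st)
    case None
    have "(\<integral>\<^sup>+g. ?N (next_state k C c' st g) \<partial>PS k) = (\<integral>\<^sup>+g. indicator (- {?z}) g \<partial>PS k)"
      using M None by (intro nn_integral_cong) (auto simp: indicator_def)
    also have "\<dots> = ennreal (measure_pmf.prob (PS k) (- {?z}))"
      by (simp add: measure_pmf.emeasure_eq_measure)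
    also have "measure_pmf.prob (PS k) (- {?z}) = 1 - pmf (PS k) ?z"
      using measure_pmf.prob_compl[of "{?z}" "PS k"] by (simp add: measure_pmf_single Compl_eq_Diff_UNIV)
    also have "ennreal (1 - pmf (PS k) ?z) \<le> ennreal (1 - ?w)"
      unfolding pmf_side_cfg by (intro ennreal_leI diff_left_mono min_weight_le t_Lam)
    finally show ?thesis using None by simp
  qed simp
  have "ennreal (waiting a b (Suc k)) \<le> (\<integral>\<^sup>+f. ennreal (1 - ?w) * ?N (snd (run a b k f)) \<partial>PX k)"
    unfolding em nn_integral_PX_Suc by (intro nn_integral_mono inner)
  also have "\<dots> = ennreal (1 - ?w) * ennreal (waiting a b k)"
    unfolding em by (simp add: nn_integral_cmult)
  also have "\<dots> = ennreal ((1 - ?w) * waiting a b k)"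
    using w by (simp add: ennreal_mult waiting_def)
  finally show ?thesis
    using w by (subst (asm) ennreal_le_iff) (auto simp: waiting_def)
qed

lemma waiting_tendsto_0: "(\<lambda>i. waiting a b (M + i)) \<longlonglongrightarrow> 0"
proof -
  let ?w = "min_weight t t"
  have w: "0 < ?w" "?w \<le> 1" using min_weight_pos[OF t_Lam t_Lam] by (auto simp: min_weight_def)
  have "waiting a b (M + i) \<le> (1 - ?w) ^ i" for i
  proof (induction i)
    case (Suc i)
    have "M \<le> lev (M + i)" by (simp add: lev_def)
    then have "waiting a b (M + Suc i) \<le> (1 - ?w) * waiting a b (M + i)"
      using waiting_Suc[of "M + i"] by simp
    also have "\<dots> \<le> (1 - ?w) * (1 - ?w) ^ i" using w Suc by (intro mult_left_mono) auto
    finally show ?case by simp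
  qed (simp add: waiting_def)
  then have le: "\<forall>\<^sub>F i in sequentially. waiting a b (M + i) \<le> (1 - ?w) ^ i" by (rule always_eventually[rule_format])
  have ge: "\<forall>\<^sub>F i in sequentially. 0 \<le> waiting a b (M + i)" by (simp add: waiting_def)
  have lim: "(\<lambda>i. (1 - ?w) ^ i) \<longlonglongrightarrow> 0" using w by (intro LIMSEQ_power_zero) auto
  show ?thesis by (rule tendsto_sandwich[OF ge le tendsto_const lim])
qed

text \<open>First the state becomes different from \<open>None\<close> with high probability; given the items at that time, the
  remaining risk tends to \<open>0\<close> by dominated convergence.\<close>

lemma unfinished_small:
  assumes "0 < \<delta>"
  shows "\<exists>k. measure_pmf.prob (PX k) {c. snd (run a b k c) \<noteq> Some []} \<le> \<delta>"
proof -
  obtain i where i: "waiting a b (M + i) < \<delta>"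
    using order_tendstoD(2)[OF waiting_tendsto_0 assms] eventually_happens'[OF sequentially_bot] by blast
  let ?k = "M + i"
  have "(\<lambda>j. measure_pmf.expectation (PX ?k) (\<lambda>c. risk j (snd (run a b ?k c))))
      \<longlonglongrightarrow> measure_pmf.expectation (PX ?k) (\<lambda>c. indicator {c. snd (run a b ?k c) = None} c)"
  proof (rule integral_dominated_convergence[where w = "\<lambda>_. 1"])
    show "AE c in PX ?k. (\<lambda>j. risk j (snd (run a b ?k c))) \<longlonglongrightarrow> indicator {c. snd (run a b ?k c) = None} c"
    proof (rule AE_I2)
      fix c
      show "(\<lambda>j. risk j (snd (run a b ?k c))) \<longlonglongrightarrow> indicator {c. snd (run a b ?k c) = None} c"
        using survival_tendsto_0[of eps, OF eps] by (cases "snd (run a b ?k c)") (auto simp: risk_def)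
    qed
  qed (use risk_bounds in auto)
  moreover have "measure_pmf.expectation (PX ?k) (\<lambda>c. indicator {c. snd (run a b ?k c) = None} c) < \<delta>"
    using i by (simp add: waiting_def)
  ultimately obtain j where j: "measure_pmf.expectation (PX ?k) (\<lambda>c. risk j (snd (run a b ?k c))) < \<delta>"
    using order_tendstoD(2) eventually_happens'[OF sequentially_bot] by blast
  have "ennreal (measure_pmf.prob (PX (?k + j)) {c. snd (run a b (?k + j) c) \<noteq> Some []}) =
      (\<integral>\<^sup>+c. indicator {c. snd (run a b (?k + j) c) \<noteq> Some []} c \<partial>PX (?k + j))"
    by (simp add: measure_pmf.emeasure_eq_measure)
  also have "\<dots> = (\<integral>\<^sup>+c. ennreal (risk 0 (snd (run a b (?k + j) c))) \<partial>PX (?k + j))"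
    by (intro nn_integral_cong) (auto simp: indicator_def risk_def split: option.split)
  also have "\<dots> \<le> (\<integral>\<^sup>+c. ennreal (risk j (snd (run a b ?k c))) \<partial>PX ?k)" by (rule risk_steps)
  also have "\<dots> = ennreal (measure_pmf.expectation (PX ?k) (\<lambda>c. risk j (snd (run a b ?k c))))"
    by (intro nn_integral_pmf_real risk_bounds)
  also have "\<dots> \<le> ennreal \<delta>" using j by (intro ennreal_leI) simp
  finally have "measure_pmf.prob (PX (?k + j)) {c. snd (run a b (?k + j) c) \<noteq> Some []} \<le> \<delta>"
    using assms by (subst (asm) ennreal_le_iff) auto
  then show ?thesis by blast
qed

end

section \<open>Extending couplings by kernels\<close>

lemma mem_prod_emb_iff:
  "J \<subseteq> I \<Longrightarrow> x \<in> prod_emb I (\<lambda>_. P) J (Pi\<^sub>E J F) \<longleftrightarrow> x \<in> space (Pi\<^sub>M I (\<lambda>_. P)) \<and> (\<forall>i\<in>J. x i \<in> F i)"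
  by (auto simp: prod_emb_def space_PiM PiE_iff)

lemma iid_law_in_prob_algebra:
  "prob_space P \<Longrightarrow> iid_law P A \<in> space (prob_algebra (iid_law P A))"
  by (auto simp: space_prob_algebra intro: prob_space_PiM)

text \<open>It suffices to compare the two measures on boxes, where both give products.\<close>

lemma iid_law_merge:
  assumes P: "prob_space P" and AB: "A \<inter> B = {}"
  shows "iid_law P A \<bind> (\<lambda>a. distr (iid_law P B) (iid_law P (A \<union> B)) (\<lambda>\<eta>. merge A B (a, \<eta>)))
    = iid_law P (A \<union> B)"
proof -
  let ?N = "iid_law P (A \<union> B)"
  let ?k = "\<lambda>a. distr (iid_law P B) ?N (\<lambda>\<eta>. merge A B (a, \<eta>))"
  note PA = iid_law_in_prob_algebra[OF P]
  have k: "?k \<in> iid_law P A \<rightarrow>\<^sub>M prob_algebra ?N"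
    by (rule measurable_distr_prob_space2[where M = "iid_law P B"])
      (use PA measurable_merge in \<open>auto simp: case_prod_beta'\<close>)
  interpret N: prob_space ?N by (intro prob_space_PiM P)
  interpret PB: prob_space "iid_law P B" by (intro prob_space_PiM P)
  have ne: "space (iid_law P A) \<noteq> {}" by (intro prob_space.not_empty prob_space_PiM P)
  have sets: "sets (iid_law P A \<bind> ?k) = sets ?N" by (rule sets_bind) (use ne in auto)
  show ?thesis
  proof (rule measure_eqI_PiM_infinite[symmetric])
    fix F :: "edge \<Rightarrow> real set" and J
    assume J: "finite J" "J \<subseteq> A \<union> B" and F: "\<And>i. i \<in> J \<Longrightarrow> F i \<in> sets P"
    let ?X = "prod_emb (A \<union> B) (\<lambda>_. P) J (Pi\<^sub>E J F)"
    let ?XA = "prod_emb A (\<lambda>_. P) (J \<inter> A) (Pi\<^sub>E (J \<inter> A) F)"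
    let ?XB = "prod_emb B (\<lambda>_. P) (J \<inter> B) (Pi\<^sub>E (J \<inter> B) F)"
    have X: "?X \<in> sets ?N" "?XA \<in> sets (iid_law P A)" using J F by (auto intro!: sets_PiM_I)
    have "emeasure (?k a) ?X = emeasure (iid_law P B) ?XB * indicator ?XA a" if a: "a \<in> space (iid_law P A)" for a
    proof -
      have m: "(\<lambda>\<eta>. merge A B (a, \<eta>)) \<in> iid_law P B \<rightarrow>\<^sub>M ?N"
        using measurable_compose[OF measurable_Pair1'[OF a] measurable_merge] by simp
      have mem: "merge A B (a, \<eta>) \<in> ?X \<longleftrightarrow> a \<in> ?XA \<and> \<eta> \<in> ?XB" if \<eta>: "\<eta> \<in> space (iid_law P B)" for \<eta>
      proof -
        have "merge A B (a, \<eta>) \<in> space ?N" using measurable_space[OF m \<eta>] .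
        moreover have "(\<forall>i\<in>J. merge A B (a, \<eta>) i \<in> F i) \<longleftrightarrow> (\<forall>i\<in>J \<inter> A. a i \<in> F i) \<and> (\<forall>i\<in>J \<inter> B. \<eta> i \<in> F i)"
          using J(2) AB by (auto simp: merge_def)
        ultimately show ?thesis using a \<eta> J by (simp add: mem_prod_emb_iff)
      qed
      have XB: "?XB \<subseteq> space (iid_law P B)" by (auto simp: mem_prod_emb_iff)
      have "(\<lambda>\<eta>. merge A B (a, \<eta>)) -` ?X \<inter> space (iid_law P B) = (if a \<in> ?XA then ?XB else {})"
        using mem subsetD[OF XB] by (cases "a \<in> ?XA") (simp_all add: set_eq_iff, blast+)
      then show ?thesis using X m by (simp add: emeasure_distr)
    qed
    then have "emeasure (iid_law P A \<bind> ?k) ?X = (\<integral>\<^sup>+a. emeasure (iid_law P B) ?XB * indicator ?XA a \<partial>iid_law P A)"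
      using emeasure_bind_prob_algebra[OF PA k X(1)] by (simp cong: nn_integral_cong)
    also have "\<dots> = emeasure (iid_law P B) ?XB * emeasure (iid_law P A) ?XA"
      by (rule nn_integral_cmult_indicator[OF X(2)])
    also have "\<dots> = (\<Prod>i\<in>J \<inter> B. emeasure P (F i)) * (\<Prod>i\<in>J \<inter> A. emeasure P (F i))"
      using J F P by (subst (1 2) emeasure_PiM_emb) auto
    also have "\<dots> = (\<Prod>i\<in>(J \<inter> B) \<union> (J \<inter> A). emeasure P (F i))"
      using J AB by (intro prod.union_disjoint[symmetric]) auto
    also have "(J \<inter> B) \<union> (J \<inter> A) = J" using J by auto
    also have "(\<Prod>i\<in>J. emeasure P (F i)) = emeasure ?N ?X"
      using J F P by (intro emeasure_PiM_emb[symmetric]) auto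
    finally show "emeasure ?N ?X = emeasure (iid_law P A \<bind> ?k) ?X" by simp
  qed (use sets N.finite_measure_axioms in auto)
qed

lemma merge_pair_measurable:
  "(\<lambda>(\<omega>, \<eta>). (merge A B (fst \<omega>, fst \<eta>), merge A B (snd \<omega>, snd \<eta>)))
    \<in> (iid_law P A \<Otimes>\<^sub>M iid_law P A) \<Otimes>\<^sub>M (iid_law P B \<Otimes>\<^sub>M iid_law P B)
      \<rightarrow>\<^sub>M iid_law P (A \<union> B) \<Otimes>\<^sub>M iid_law P (A \<union> B)"
  unfolding case_prod_beta'
  by (intro measurable_Pair measurable_compose[OF _ measurable_merge]) measurable

text \<open>Given the configurations on \<open>A\<close>, each marginal of the kernel is the fixed law on \<open>B\<close>, hence
  independent of them.\<close>

lemma coupling_extend_law: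
  assumes P: "prob_space P" and AB: "A \<inter> B = {}"
    and \<kappa>: "coupling_kernel P A B \<kappa>" and Q: "coupling (iid_law P A) (iid_law P A) Q"
  shows "coupling (iid_law P (A \<union> B)) (iid_law P (A \<union> B)) (extend_law P A B Q \<kappa>)"
    and "(\<lambda>\<omega>. distr (\<kappa> \<omega>) (iid_law P (A \<union> B) \<Otimes>\<^sub>M iid_law P (A \<union> B))
        (\<lambda>\<eta>. (merge A B (fst \<omega>, fst \<eta>), merge A B (snd \<omega>, snd \<eta>)))) \<in>
      Q \<rightarrow>\<^sub>M prob_algebra (iid_law P (A \<union> B) \<Otimes>\<^sub>M iid_law P (A \<union> B))"
proof -
  let ?A = "iid_law P A" and ?B = "iid_law P B" and ?C = "iid_law P (A \<union> B)"
  let ?g = "\<lambda>\<omega> \<eta>. (merge A B (fst \<omega>, fst \<eta>), merge A B (snd \<omega>, snd \<eta>))"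
  let ?k = "\<lambda>\<omega>. distr (\<kappa> \<omega>) (?C \<Otimes>\<^sub>M ?C) (?g \<omega>)"
  have sQ: "sets Q = sets (?A \<Otimes>\<^sub>M ?A)" and pQ: "prob_space Q" using Q by (auto simp: coupling_def)
  then have spQ: "space Q = space (?A \<Otimes>\<^sub>M ?A)" by (intro sets_eq_imp_space_eq)
  interpret Q: prob_space Q by (rule pQ)
  have k0: "?k \<in> ?A \<Otimes>\<^sub>M ?A \<rightarrow>\<^sub>M prob_algebra (?C \<Otimes>\<^sub>M ?C)"
    by (rule measurable_distr_prob_space2[where M = "?B \<Otimes>\<^sub>M ?B"])
      (use \<kappa> merge_pair_measurable in \<open>auto simp: coupling_kernel_def\<close>)
  then show k: "?k \<in> Q \<rightarrow>\<^sub>M prob_algebra (?C \<Otimes>\<^sub>M ?C)" using sQ by (simp cong: measurable_cong_sets)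
  have Qin: "Q \<in> space (prob_algebra Q)" using pQ by (simp add: space_prob_algebra)
  have marginal: "distr (Q \<bind> ?k) ?C sel = ?C" if sel: "sel = fst \<or> sel = snd"
    for sel :: "config \<times> config \<Rightarrow> config"
  proof -
    have selm: "sel \<in> M \<Otimes>\<^sub>M M \<rightarrow>\<^sub>M M" for M :: "config measure" using sel by auto
    have Qsel: "distr Q ?A sel = ?A" using sel Q by (auto simp: coupling_def)
    let ?h = "\<lambda>a. distr ?B ?C (\<lambda>\<eta>. merge A B (a, \<eta>))"
    have h: "?h \<in> ?A \<rightarrow>\<^sub>M subprob_algebra ?C"
      by (rule measurable_prob_algebraD, rule measurable_distr_prob_space2[where M = ?B])
        (use iid_law_in_prob_algebra[OF P] measurable_merge in \<open>auto simp: case_prod_beta'\<close>)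
    have "distr (Q \<bind> ?k) ?C sel = Q \<bind> (\<lambda>\<omega>. distr (?k \<omega>) ?C sel)"
      by (rule distr_bind[OF measurable_prob_algebraD[OF k] Q.not_empty selm])
    also have "\<dots> = Q \<bind> (\<lambda>\<omega>. ?h (sel \<omega>))"
    proof (rule bind_cong[OF refl])
      fix \<omega> assume "\<omega> \<in> space Q"
      then have \<omega>: "\<omega> \<in> space (?A \<Otimes>\<^sub>M ?A)" by (simp add: spQ)
      then have c: "coupling ?B ?B (\<kappa> \<omega>)" using \<kappa> by (simp add: coupling_kernel_def)
      then have s\<kappa>: "sets (\<kappa> \<omega>) = sets (?B \<Otimes>\<^sub>M ?B)" by (simp add: coupling_def)
      have \<kappa>sel: "distr (\<kappa> \<omega>) ?B sel = ?B" using c sel by (auto simp: coupling_def)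
      have g\<omega>: "?g \<omega> \<in> \<kappa> \<omega> \<rightarrow>\<^sub>M ?C \<Otimes>\<^sub>M ?C"
        using measurable_compose[OF measurable_Pair1'[OF \<omega>] merge_pair_measurable[of A B P]] s\<kappa>
        by (simp cong: measurable_cong_sets)
      have sel\<omega>: "sel \<omega> \<in> space ?A" using measurable_space[OF selm \<omega>] .
      have m: "(\<lambda>\<eta>. merge A B (sel \<omega>, \<eta>)) \<in> ?B \<rightarrow>\<^sub>M ?C"
        using measurable_compose[OF measurable_Pair1'[OF sel\<omega>] measurable_merge] by simp
      have "distr (?k \<omega>) ?C sel = distr (\<kappa> \<omega>) ?C (sel \<circ> ?g \<omega>)" by (rule distr_distr[OF selm g\<omega>])
      also have "sel \<circ> ?g \<omega> = (\<lambda>\<eta>. merge A B (sel \<omega>, \<eta>)) \<circ> sel" using sel by (elim disjE) (simp_all add: o_def)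
      also have "distr (\<kappa> \<omega>) ?C ((\<lambda>\<eta>. merge A B (sel \<omega>, \<eta>)) \<circ> sel) = distr (distr (\<kappa> \<omega>) ?B sel) ?C (\<lambda>\<eta>. merge A B (sel \<omega>, \<eta>))"
        using selm[of ?B] s\<kappa> by (intro distr_distr[symmetric] m) (simp cong: measurable_cong_sets)
      finally show "distr (?k \<omega>) ?C sel = ?h (sel \<omega>)" by (simp add: \<kappa>sel)
    qed
    also have "\<dots> = distr Q ?A sel \<bind> ?h"
      using selm[of ?A] sQ
      by (intro bind_distr[symmetric, OF _ h Q.not_empty]) (simp cong: measurable_cong_sets)
    also have "\<dots> = ?C" unfolding Qsel by (rule iid_law_merge[OF P AB])
    finally show ?thesis .
  qed
  have "Q \<bind> ?k \<in> space (prob_algebra (?C \<Otimes>\<^sub>M ?C))"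
    using measurable_space[OF measurable_bind_prob_space[OF measurable_ident_sets[OF refl] k]] Qin
    by (metis (no_types, lifting) id_apply)
  then show "coupling ?C ?C (extend_law P A B Q \<kappa>)"
    using marginal unfolding coupling_def extend_law_def by (simp add: space_prob_algebra)
qed

section \<open>The coupling kernel\<close>

locale random_law = random_scheme +
  fixes P :: "real measure"
  assumes P: "passage_distribution P"
    and p_eq: "measure_pmf p = distr P (count_space UNIV) disc"
    and disc_measurable: "disc \<in> P \<rightarrow>\<^sub>M count_space UNIV"
    and AE_Lam: "AE r in P. r \<in> Lam"
begin

lemma prob_P: "prob_space P" and sets_P: "sets P = sets borel" and space_P: "space P = UNIV"
  using P sets_eq_imp_space_eq[of P borel] by (auto simp: passage_distribution_def)

lemma countable_Lam: "countable Lam"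
  using set_p countable_set_pmf by metis

abbreviation outside :: "edge set" where
  "outside \<equiv> tube_edges K d - A 0"

abbreviation CS :: "edge set \<Rightarrow> config measure" where
  "CS J \<equiv> count_space (J \<rightarrow>\<^sub>E Lam)"

definition pattern :: "edge set \<Rightarrow> config \<Rightarrow> config" where
  "pattern J x = restrict (discretize x) J"

lemma countable_PiE_Lam: "finite J \<Longrightarrow> countable (J \<rightarrow>\<^sub>E Lam)"
  using countable_Lam by (intro countable_PiE) auto

lemma pattern_measurable:
  assumes "finite J" "J \<subseteq> E" shows "pattern J \<in> iid_law P E \<rightarrow>\<^sub>M CS J"
proof (subst measurable_count_space_eq_countable[OF countable_PiE_Lam[OF assms(1)]], intro conjI ballI)
  show "pattern J \<in> space (iid_law P E) \<rightarrow> J \<rightarrow>\<^sub>E Lam" by (auto simp: pattern_def discretize_def)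
  fix c assume c: "c \<in> J \<rightarrow>\<^sub>E Lam"
  have "pattern J -` {c} \<inter> space (iid_law P E) = {x \<in> space (iid_law P E). \<forall>e\<in>J. disc (x e) \<in> {c e}}"
    using c by (auto simp: pattern_def discretize_def fun_eq_iff PiE_iff extensional_def)
  also have "\<dots> \<in> sets (iid_law P E)"
  proof (rule sets.sets_Collect_finite_All[OF _ assms(1)])
    fix e assume "e \<in> J"
    then have "(\<lambda>x. x e) \<in> iid_law P E \<rightarrow>\<^sub>M P"
      using assms(2) by (intro measurable_component_singleton) auto
    then have "(\<lambda>x. disc (x e)) \<in> iid_law P E \<rightarrow>\<^sub>M count_space UNIV"
      by (rule measurable_compose[OF _ disc_measurable])
    then have "(\<lambda>x. disc (x e)) -` {c e} \<inter> space (iid_law P E) \<in> sets (iid_law P E)"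
      by (rule measurable_sets) simp
    also have "(\<lambda>x. disc (x e)) -` {c e} \<inter> space (iid_law P E) = {x \<in> space (iid_law P E). disc (x e) \<in> {c e}}" by auto
    finally show "{x \<in> space (iid_law P E). disc (x e) \<in> {c e}} \<in> sets (iid_law P E)" .
  qed
  finally show "pattern J -` {c} \<inter> space (iid_law P E) \<in> sets (iid_law P E)" .
qed

lemma pattern_count_space:
  assumes "finite J" "J \<subseteq> E" shows "pattern J \<in> iid_law P E \<rightarrow>\<^sub>M count_space UNIV"
  using measurable_compose[OF pattern_measurable[OF assms], of "\<lambda>x. x" "count_space UNIV"] by simp

lemma B_outside: "B k \<subseteq> outside"
  using A_subset by (auto simp: B_def)

lemma countable_tube_edges: "countable (tube_edges K d)"
proof -
  have "countable (\<Union>k. A k)" using finite_A by (intro countable_UN) (auto intro: countable_finite)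
  then show ?thesis by (rule countable_subset[rotated]) (use A_exhausts in blast)
qed

lemma AE_admissible:
  assumes "E \<subseteq> tube_edges K d"
  shows "AE x in iid_law P E. \<forall>e\<in>E. x e \<in> Lam"
proof (rule AE_ball_countable')
  show "countable E" by (rule countable_subset[OF assms countable_tube_edges])
  show "AE x in iid_law P E. x e \<in> Lam" if "e \<in> E" for e
    by (rule AE_PiM_component[OF _ that AE_Lam]) (rule prob_P)
qed

text \<open>This is the bridge between the infinite product of \<open>P\<close> and the finite products of its discrete
  version \<open>p\<close>, in which the coupling was analysed.\<close>

lemma pattern_law: "distr (iid_law P outside) (count_space UNIV) (pattern (B k)) = measure_pmf (PX k)"
proof (rule measure_eqI_countable_AE[where \<Omega> = "B k \<rightarrow>\<^sub>E Lam"])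
  have fin: "finite (B k)" by (rule B_Suc)
  note m = pattern_count_space[OF fin B_outside]
  show "AE x in distr (iid_law P outside) (count_space UNIV) (pattern (B k)). x \<in> B k \<rightarrow>\<^sub>E Lam"
    by (subst AE_distr_iff[OF m]) (auto simp: pattern_def discretize_def)
  show "AE x in PX k. x \<in> B k \<rightarrow>\<^sub>E Lam"
    using set_Pi_pmf[OF fin, of undefined "\<lambda>_. p"] set_p
    by (auto simp: AE_measure_pmf_iff PiE_dflt_def PiE_iff extensional_def)
  show "countable (B k \<rightarrow>\<^sub>E Lam)" by (rule countable_PiE_Lam[OF fin])
  fix c assume c: "c \<in> B k \<rightarrow>\<^sub>E Lam"
  have dm: "disc -` {r} \<in> sets P" for r using measurable_sets[OF disc_measurable, of "{r}"] by (simp add: space_P)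
  have "pattern (B k) -` {c} \<inter> space (iid_law P outside) =
      prod_emb outside (\<lambda>_. P) (B k) (\<Pi>\<^sub>E e\<in>B k. disc -` {c e})"
    using c B_outside[of k] by (auto simp: mem_prod_emb_iff pattern_def discretize_def fun_eq_iff PiE_iff extensional_def)
  then have "emeasure (distr (iid_law P outside) (count_space UNIV) (pattern (B k))) {c} =
      emeasure (iid_law P outside) (prod_emb outside (\<lambda>_. P) (B k) (\<Pi>\<^sub>E e\<in>B k. disc -` {c e}))"
    using m by (simp add: emeasure_distr)
  also have "\<dots> = (\<Prod>e\<in>B k. emeasure P (disc -` {c e}))"
    using prob_P B_outside fin dm by (intro emeasure_PiM_emb) auto
  also have "\<dots> = (\<Prod>e\<in>B k. emeasure (measure_pmf p) {c e})"
    using disc_measurable unfolding p_eq by (intro prod.cong refl) (simp add: emeasure_distr space_P)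
  also have "\<dots> = ennreal (\<Prod>e\<in>B k. pmf p (c e))"
    by (simp add: emeasure_pmf_single prod_ennreal)
  also have "\<dots> = emeasure (measure_pmf (PX k)) {c}"
    using c by (simp add: emeasure_pmf_single pmf_Pi'[OF fin] PiE_iff extensional_def)
  finally show "emeasure (distr (iid_law P outside) (count_space UNIV) (pattern (B k))) {c} = emeasure (measure_pmf (PX k)) {c}" .
qed auto

lemma run_pattern: "run a b k \<eta> = run (pattern (A 0) a) (pattern (A 0) b) k (pattern (B k) \<eta>)"
  unfolding run_def
proof (rule process_cong)
  fix e assume "e \<in> A k"
  then have "e \<in> A 0 \<or> e \<in> B k" using A_B by blast
  then show "join a \<eta> e = join (pattern (A 0) a) (pattern (B k) \<eta>) e"
    by (auto simp: join_def pattern_def discretize_def)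
qed (auto simp: discretize_def pattern_def)

lemma run_pattern_B: "run a b k (pattern (B k) \<eta>) = run a b k \<eta>"
  by (subst (1 2) run_pattern) (simp add: pattern_def discretize_def restrict_def cong: if_cong)

definition partner :: "config \<times> config \<Rightarrow> config \<Rightarrow> config" where
  "partner \<omega> \<eta> = restrict (couple (join (fst \<omega>) \<eta>) (discretize (snd \<omega>))) outside"

lemma partner_eq: "e \<in> B k \<Longrightarrow> partner \<omega> \<eta> e = fst (run (fst \<omega>) (snd \<omega>) k \<eta>) e"
  using couple_eq[of e k] A_subset[of k] by (auto simp: partner_def run_def B_def)

lemma partner_measurable:
  "(\<lambda>(\<omega>, \<eta>). partner \<omega> \<eta>) \<in>
    (iid_law P (A 0) \<Otimes>\<^sub>M iid_law P (A 0)) \<Otimes>\<^sub>M iid_law P outside \<rightarrow>\<^sub>M iid_law P outside"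
proof (rule measurable_PiM_single')
  fix e assume e: "e \<in> outside"
  then obtain k where k: "e \<in> B k" using A_exhausts by (auto simp: B_def)
  let ?M = "(iid_law P (A 0) \<Otimes>\<^sub>M iid_law P (A 0)) \<Otimes>\<^sub>M iid_law P outside"
  let ?C = "(CS (A 0) \<Otimes>\<^sub>M CS (A 0)) \<Otimes>\<^sub>M CS (B k)"
  have fin: "finite (A 0)" "finite (B k)" using finite_A B_Suc by auto
  note c = countable_PiE_Lam[OF fin(1)] countable_PiE_Lam[OF fin(2)]
  have C: "?C = count_space (((A 0 \<rightarrow>\<^sub>E Lam) \<times> (A 0 \<rightarrow>\<^sub>E Lam)) \<times> (B k \<rightarrow>\<^sub>E Lam))"
    using c by (simp add: pair_measure_countable countable_SIGMA)
  have 1: "(\<lambda>(\<omega>, \<eta>). ((pattern (A 0) (fst \<omega>), pattern (A 0) (snd \<omega>)), pattern (B k) \<eta>)) \<in> ?M \<rightarrow>\<^sub>M ?C"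
    unfolding case_prod_beta'
    by (intro measurable_Pair measurable_compose[OF _ pattern_measurable[OF fin(1) subset_refl]]
        measurable_compose[OF _ pattern_measurable[OF fin(2) B_outside]]) measurable
  have 2: "(\<lambda>((a, b), c). fst (run a b k c) e) \<in> ?C \<rightarrow>\<^sub>M P" unfolding C by (simp add: space_P)
  have "(case x of (\<omega>, \<eta>) \<Rightarrow> partner \<omega> \<eta>) e = (\<lambda>((a, b), c). fst (run a b k c) e)
        ((\<lambda>(\<omega>, \<eta>). ((pattern (A 0) (fst \<omega>), pattern (A 0) (snd \<omega>)), pattern (B k) \<eta>)) x)" for x
  proof -
    have "partner (fst x) (snd x) e = fst (run (pattern (A 0) (fst (fst x))) (pattern (A 0) (snd (fst x))) k
        (pattern (B k) (snd x))) e"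
      unfolding partner_eq[OF k] by (subst run_pattern) (rule refl)
    then show ?thesis by (simp only: case_prod_beta' fst_conv snd_conv)
  qed
  then show "(\<lambda>x. (case x of (\<omega>, \<eta>) \<Rightarrow> partner \<omega> \<eta>) e) \<in> ?M \<rightarrow>\<^sub>M P"
    using measurable_compose[OF 1 2] by (simp only:)
next
  have "partner \<omega> \<eta> \<in> outside \<rightarrow>\<^sub>E space P" for \<omega> \<eta>
    unfolding partner_def space_P restrict_PiE_iff by simp
  then show "(\<lambda>(\<omega>, \<eta>). partner \<omega> \<eta>) \<in>
      space ((iid_law P (A 0) \<Otimes>\<^sub>M iid_law P (A 0)) \<Otimes>\<^sub>M iid_law P outside) \<rightarrow> (outside \<rightarrow>\<^sub>E space P)"
    unfolding case_prod_beta' by (intro funcsetI)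
qed

text \<open>The coupling is deterministic: the second family is a measure preserving function of the first one
  and of the given configurations.\<close>

definition kernel :: "config \<times> config \<Rightarrow> (config \<times> config) measure" where
  "kernel \<omega> = distr (iid_law P outside) (iid_law P outside \<Otimes>\<^sub>M iid_law P outside) (\<lambda>\<eta>. (\<eta>, partner \<omega> \<eta>))"

text \<open>A box constrains only finitely many edges, and on these the partner is a function of finitely many
  coordinates whose law is known.\<close>

lemma partner_law:
  assumes \<omega>: "\<omega> \<in> space (iid_law P (A 0) \<Otimes>\<^sub>M iid_law P (A 0))"
  shows "distr (iid_law P outside) (iid_law P outside) (partner \<omega>) = iid_law P outside"
proof (rule measure_eqI_PiM_infinite)
  interpret prob_space "iid_law P outside" by (intro prob_space_PiM prob_P)
  have m: "partner \<omega> \<in> iid_law P outside \<rightarrow>\<^sub>M iid_law P outside"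
    using measurable_compose[OF measurable_Pair1'[OF \<omega>] partner_measurable] by simp
  show "finite_measure (distr (iid_law P outside) (iid_law P outside) (partner \<omega>))"
    by (intro prob_space.finite_measure prob_space_distr m)
  fix F :: "edge \<Rightarrow> real set" and J
  assume J: "finite J" "J \<subseteq> outside" and F: "\<And>i. i \<in> J \<Longrightarrow> F i \<in> sets P"
  let ?X = "prod_emb outside (\<lambda>_. P) J (Pi\<^sub>E J F)" and ?O = "iid_law P outside"
  have X: "?X \<in> sets ?O" using J F by (intro sets_PiM_I) auto
  have "\<exists>k. J \<subseteq> A k"
    using J
  proof (induction rule: finite_induct)
    case (insert e J)
    then obtain k l where "J \<subseteq> A k" "e \<in> A l" using A_exhausts[of e] by auto
    then have "insert e J \<subseteq> A (max k l)" using A_mono[of k "max k l"] A_mono[of l "max k l"] by auto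
    then show ?case ..
  qed simp
  then obtain k where k: "J \<subseteq> B k" using J by (auto simp: B_def)
  let ?E = "{c. \<forall>e\<in>J. c e \<in> F e}" and ?\<Theta> = "\<lambda>c. restrict (fst (run (fst \<omega>) (snd \<omega>) k c)) (B k)"
  note pm = pattern_count_space[OF B_Suc(3)[of k] B_outside[of k]]
  have law: "emeasure (measure_pmf (PX k)) Y = emeasure ?O (pattern (B k) -` Y \<inter> space ?O)" for Y
    using pm by (subst pattern_law[symmetric]) (simp add: emeasure_distr)
  have e1: "partner \<omega> -` ?X \<inter> space ?O = pattern (B k) -` (?\<Theta> -` ?E) \<inter> space ?O"
    using measurable_space[OF m] J k by (auto simp: mem_prod_emb_iff partner_eq[of _ k] run_pattern_B subset_eq)
  have e2: "AE x in ?O. x \<in> pattern (B k) -` ?E \<inter> space ?O \<longleftrightarrow> x \<in> ?X"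
    using AE_admissible[of outside] J k
    by (auto simp: mem_prod_emb_iff pattern_def discretize_def subset_eq elim!: eventually_mono)
  have "emeasure (distr ?O ?O (partner \<omega>)) ?X = emeasure (measure_pmf (PX k)) (?\<Theta> -` ?E)"
    using X m by (simp add: emeasure_distr e1 law)
  also have "\<dots> = emeasure (measure_pmf (map_pmf ?\<Theta> (PX k))) ?E" by simp
  also have "\<dots> = emeasure ?O (pattern (B k) -` ?E \<inter> space ?O)" unfolding run_preserves by (rule law)
  also have "\<dots> = emeasure ?O ?X"
    using X pm e2 by (intro emeasure_eq_AE measurable_sets[OF pm]) auto
  finally show "emeasure (distr ?O ?O (partner \<omega>)) ?X = emeasure ?O ?X" .
qed auto

lemma kernel_coupling: "coupling_kernel P (A 0) outside kernel"
  unfolding coupling_kernel_def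
proof (intro conjI ballI)
  let ?A = "iid_law P (A 0)" and ?O = "iid_law P outside"
  have m: "(\<lambda>(\<omega>, \<eta>). (\<eta>, partner \<omega> \<eta>)) \<in> (?A \<Otimes>\<^sub>M ?A) \<Otimes>\<^sub>M ?O \<rightarrow>\<^sub>M ?O \<Otimes>\<^sub>M ?O"
    using partner_measurable unfolding case_prod_beta' by (intro measurable_Pair) auto
  show "kernel \<in> ?A \<Otimes>\<^sub>M ?A \<rightarrow>\<^sub>M prob_algebra (?O \<Otimes>\<^sub>M ?O)"
    unfolding kernel_def
    by (rule measurable_distr_prob_space2[where M = ?O]) (use m iid_law_in_prob_algebra[OF prob_P] in auto)
  fix \<omega> assume \<omega>: "\<omega> \<in> space (?A \<Otimes>\<^sub>M ?A)"
  interpret O: prob_space ?O by (intro prob_space_PiM prob_P)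
  have m\<omega>: "(\<lambda>\<eta>. (\<eta>, partner \<omega> \<eta>)) \<in> ?O \<rightarrow>\<^sub>M ?O \<Otimes>\<^sub>M ?O"
    using measurable_compose[OF measurable_Pair1'[OF \<omega>] m] by simp
  have "distr (kernel \<omega>) ?O fst = distr ?O ?O (fst \<circ> (\<lambda>\<eta>. (\<eta>, partner \<omega> \<eta>)))"
    unfolding kernel_def by (rule distr_distr[OF measurable_fst m\<omega>])
  moreover have "distr (kernel \<omega>) ?O snd = distr ?O ?O (snd \<circ> (\<lambda>\<eta>. (\<eta>, partner \<omega> \<eta>)))"
    unfolding kernel_def by (rule distr_distr[OF measurable_snd m\<omega>])
  ultimately show "coupling ?O ?O (kernel \<omega>)"
    unfolding coupling_def using O.prob_space_distr[OF m\<omega>] partner_law[OF \<omega>]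
    by (auto simp: o_def distr_id kernel_def)
qed

end

context random_law begin

section \<open>Almost sure coalescence\<close>

text \<open>Coalescence is certified by the configurations in a finite box, whatever they are elsewhere, as long
  as they agree there. Such a certificate concerns countably many patterns only, so it gives a measurable event
  that is contained in the event of coalescence.\<close>

definition decided :: "nat \<Rightarrow> config \<Rightarrow> config \<Rightarrow> bool" where
  "decided k c c' \<longleftrightarrow> (\<forall>x y. admissible x \<longrightarrow> admissible y \<longrightarrow> (\<forall>e\<in>A k. x e = c e \<and> y e = c' e) \<longrightarrow>
     (\<forall>e\<in>tube_edges K d - A k. x e = y e) \<longrightarrow> coalesce x y)"

lemma decided_process:
  assumes x: "admissible x" and b: "\<forall>e\<in>A 0. b e \<in> Lam" and st: "snd (process x b k) = Some []"
    and c: "\<forall>e\<in>A k. c e = x e \<and> c' e = fst (process x b k) e"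
  shows "decided k c c'"
  unfolding decided_def
proof (intro allI impI)
  fix x' y' assume x': "admissible x'" and y': "admissible y'"
    and xy: "\<forall>e\<in>A k. x' e = c e \<and> y' e = c' e" "\<forall>e\<in>tube_edges K d - A k. x' e = y' e"
  have pr: "process x' b k = process x b k" using xy(1) c by (intro process_cong) auto
  then have "gap x' (copy_from x' b k) (lev k) []" using process_invariant[OF x' b, of k] st by simp
  moreover have "copy_from x' b k e = y' e" if "e \<in> tube_edges K d" for e
    using that xy c pr by (auto simp: copy_from_def)
  then have "T (copy_from x' b k) U v = T y' U v" for U v by (intro dT_cong) auto
  ultimately have "gap x' y' (lev k) []" by (simp add: gap_def)
  then show "coalesce x' y'" by (rule coalesce_if_no_debt[OF x' y'])
qed

definition success :: "config \<times> config \<Rightarrow> bool" where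
  "success z \<longleftrightarrow> (\<forall>e\<in>tube_edges K d. fst z e \<in> Lam) \<and> (\<forall>e\<in>tube_edges K d. snd z e \<in> Lam) \<and>
     (\<exists>k. (\<forall>e\<in>tube_edges K d - A k. fst z e = snd z e) \<and>
       decided k (pattern (A k) (fst z)) (pattern (A k) (snd z)))"

lemma success_coalesce:
  assumes "success (x, y)" shows "coalesce x y"
proof -
  have x: "admissible x" and y: "admissible y" using assms by (auto simp: success_def admissible_def)
  obtain k where k: "\<forall>e\<in>tube_edges K d - A k. x e = y e" "decided k (pattern (A k) x) (pattern (A k) y)"
    using assms by (auto simp: success_def)
  have "pattern (A k) z e = z e" if "e \<in> A k" "admissible z" for z e
    using that A_subset[of k] by (auto simp: admissible_def pattern_def discretize_def)
  then show ?thesis using k x y unfolding decided_def by metis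
qed

lemma success_measurable:
  "Measurable.pred (iid_law P (tube_edges K d) \<Otimes>\<^sub>M iid_law P (tube_edges K d)) success"
proof -
  let ?E = "tube_edges K d"
  let ?M = "iid_law P ?E \<Otimes>\<^sub>M iid_law P ?E"
  have L: "Lam \<in> sets P" unfolding sets_P by (rule sets.countable[OF _ countable_Lam]) simp
  have coord: "(\<lambda>z. fst z e) \<in> ?M \<rightarrow>\<^sub>M P" "(\<lambda>z. snd z e) \<in> ?M \<rightarrow>\<^sub>M P" if "e \<in> ?E" for e
    using that by (auto intro!: measurable_compose[OF measurable_fst measurable_component_singleton]
      measurable_compose[OF measurable_snd measurable_component_singleton])
  have "Measurable.pred ?M (\<lambda>z. fst z e \<in> Lam)" "Measurable.pred ?M (\<lambda>z. snd z e \<in> Lam)" if "e \<in> ?E" for e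
    using coord[OF that] L by (auto intro: pred_sets2)
  moreover have "Measurable.pred ?M (\<lambda>z. fst z e = snd z e)" if "e \<in> ?E" for e
  proof -
    have "(\<lambda>z. fst z e) \<in> borel_measurable ?M" "(\<lambda>z. snd z e) \<in> borel_measurable ?M"
      using coord[OF that] by (auto simp: sets_P cong: measurable_cong_sets)
    then show ?thesis by measurable
  qed
  moreover have "Measurable.pred ?M (\<lambda>z. decided k (pattern (A k) (fst z)) (pattern (A k) (snd z)))" for k
  proof -
    note c = countable_PiE_Lam[OF finite_A[of k]]
    have "(\<lambda>z. (pattern (A k) (fst z), pattern (A k) (snd z))) \<in> ?M \<rightarrow>\<^sub>M CS (A k) \<Otimes>\<^sub>M CS (A k)"
      using pattern_measurable[OF finite_A A_subset]
      by (intro measurable_Pair measurable_compose[OF measurable_fst] measurable_compose[OF measurable_snd])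
    then have "(\<lambda>z. (pattern (A k) (fst z), pattern (A k) (snd z))) \<in>
        ?M \<rightarrow>\<^sub>M count_space ((A k \<rightarrow>\<^sub>E Lam) \<times> (A k \<rightarrow>\<^sub>E Lam))"
      using c by (simp add: pair_measure_countable)
    from measurable_compose[OF this, of "\<lambda>(c, c'). decided k c c'" "count_space UNIV"] show ?thesis by simp
  qed
  ultimately show ?thesis
    unfolding success_def using countable_tube_edges
    by (intro pred_intros_logic pred_intros_countable pred_intros_countable_bounded) auto
qed

lemma AE_finished: "AE \<eta> in iid_law P outside. \<exists>k. snd (run a b k \<eta>) = Some []"
proof -
  let ?O = "iid_law P outside"
  let ?F = "\<lambda>k. {c. snd (run a b k c) \<noteq> Some []}"
  define G where "G k = pattern (B k) -` ?F k \<inter> space ?O" for k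
  note pm = pattern_count_space[OF B_Suc(3) B_outside]
  have G: "G k \<in> sets ?O" for k unfolding G_def by (rule measurable_sets[OF pm]) simp
  have em: "emeasure ?O (G k) = ennreal (measure_pmf.prob (PX k) (?F k))" for k
  proof -
    have "emeasure ?O (G k) = emeasure (measure_pmf (PX k)) (?F k)"
      using pm[of k] unfolding G_def by (subst pattern_law[symmetric]) (simp add: emeasure_distr)
    then show ?thesis by (simp add: measure_pmf.emeasure_eq_measure)
  qed
  have N: "(\<Inter>k. G k) \<in> sets ?O" using G by (intro sets.countable_INT) auto
  have "emeasure ?O (\<Inter>k. G k) \<le> 0 + ennreal \<delta>" if d: "0 < \<delta>" for \<delta>
  proof -
    obtain k where "measure_pmf.prob (PX k) (?F k) \<le> \<delta>" using unfinished_small[OF d] by blast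
    then have "emeasure ?O (G k) \<le> ennreal \<delta>" unfolding em by (rule ennreal_leI)
    moreover have "emeasure ?O (\<Inter>k. G k) \<le> emeasure ?O (G k)" by (rule emeasure_mono[OF _ G]) auto
    ultimately show ?thesis by simp
  qed
  then have "emeasure ?O (\<Inter>k. G k) \<le> 0" by (rule ennreal_le_epsilon)
  then have "emeasure ?O (\<Inter>k. G k) = 0" by simp
  then have "(\<Inter>k. G k) \<in> null_sets ?O" using N by (rule null_setsI)
  then show ?thesis
  proof (rule AE_I')
    show "{\<eta> \<in> space ?O. \<not> (\<exists>k. snd (run a b k \<eta>) = Some [])} \<subseteq> (\<Inter>k. G k)"
      unfolding G_def by (rule subsetI) (simp add: run_pattern_B)
  qed
qed

lemma AE_success:
  assumes \<omega>: "\<omega> \<in> space (iid_law P (A 0) \<Otimes>\<^sub>M iid_law P (A 0))"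
    and Lam: "\<forall>e\<in>A 0. fst \<omega> e \<in> Lam" "\<forall>e\<in>A 0. snd \<omega> e \<in> Lam"
  shows "AE \<eta> in iid_law P outside.
    success (merge (A 0) outside (fst \<omega>, \<eta>), merge (A 0) outside (snd \<omega>, partner \<omega> \<eta>))"
proof -
  have *: "success (merge (A 0) outside (fst \<omega>, \<eta>), merge (A 0) outside (snd \<omega>, partner \<omega> \<eta>))"
    if \<eta>: "\<forall>e\<in>outside. \<eta> e \<in> Lam" and k: "snd (run (fst \<omega>) (snd \<omega>) k \<eta>) = Some []" for \<eta> k
  proof -
    let ?x = "join (fst \<omega>) \<eta>" and ?b = "discretize (snd \<omega>)"
    let ?\<tau> = "merge (A 0) outside (fst \<omega>, \<eta>)" and ?\<tau>' = "merge (A 0) outside (snd \<omega>, partner \<omega> \<eta>)"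
    have b: "\<forall>e\<in>A 0. ?b e \<in> Lam" by (simp add: discretize_def)
    have x: "?\<tau> e = ?x e" if "e \<in> tube_edges K d" for e
      using that Lam(1) \<eta> by (auto simp: merge_def join_def)
    have y: "?\<tau>' e = couple ?x ?b e" if "e \<in> tube_edges K d" for e
    proof (cases "e \<in> A 0")
      case True
      then show ?thesis using Lam(2) couple_eq[OF True, of ?x ?b] by (simp add: merge_def discretize_def)
    next
      case False
      then show ?thesis using that by (simp add: merge_def partner_def)
    qed
    have cpl: "couple ?x ?b e = copy_from ?x ?b k e" if "e \<in> tube_edges K d" for e
      using couple_eq_copy_from[OF _ that] k unfolding run_def by blast
    have inv: "\<forall>e\<in>A k. fst (process ?x ?b k) e \<in> Lam"
      using process_invariant[OF admissible_join b, of k] by blast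
    have adm: "admissible (copy_from ?x ?b k)" by (rule admissible_copy_from[OF admissible_join inv])
    have 1: "?\<tau> e \<in> Lam" "?\<tau>' e \<in> Lam" if "e \<in> tube_edges K d" for e
      using x[OF that] y[OF that] cpl[OF that] that adm admissible_join[of "fst \<omega>" \<eta>]
      by (simp_all add: admissible_def)
    have 2: "?\<tau> e = ?\<tau>' e" if "e \<in> tube_edges K d - A k" for e
      using that x[of e] y[of e] cpl[of e] by (simp add: copy_from_def)
    have "decided k (pattern (A k) ?\<tau>) (pattern (A k) ?\<tau>')"
    proof (rule decided_process[OF admissible_join b])
      show "snd (process ?x ?b k) = Some []" using k by (simp add: run_def)
      show "\<forall>e\<in>A k. pattern (A k) ?\<tau> e = ?x e \<and> pattern (A k) ?\<tau>' e = fst (process ?x ?b k) e"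
      proof (intro ballI conjI)
        fix e assume e: "e \<in> A k"
        then have eE: "e \<in> tube_edges K d" using A_subset by blast
        show "pattern (A k) ?\<tau> e = ?x e" using e 1(1)[OF eE] x[OF eE] by (simp add: pattern_def discretize_def)
        show "pattern (A k) ?\<tau>' e = fst (process ?x ?b k) e"
          using e 1(2)[OF eE] y[OF eE] couple_eq[OF e] by (simp add: pattern_def discretize_def)
      qed
    qed
    then show ?thesis unfolding success_def fst_conv snd_conv using 1 2 by blast
  qed
  show ?thesis
    using AE_admissible[of outside] AE_finished[of "fst \<omega>" "snd \<omega>"] * by (auto elim!: AE_mp)
qed

lemma AE_coalesce:
  assumes Q: "coupling (iid_law P (A 0)) (iid_law P (A 0)) Q"
  shows "AE z in extend_law P (A 0) outside Q kernel. coalesce (fst z) (snd z)"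
proof -
  let ?A = "iid_law P (A 0)" and ?O = "iid_law P outside"
  let ?C = "iid_law P (A 0 \<union> outside)"
  have E: "A 0 \<union> outside = tube_edges K d" using A_subset by auto
  have Qs: "sets Q = sets (?A \<Otimes>\<^sub>M ?A)" "distr Q ?A fst = ?A" "distr Q ?A snd = ?A"
    using Q by (auto simp: coupling_def)
  let ?g = "\<lambda>\<omega> \<eta>. (merge (A 0) outside (fst \<omega>, fst \<eta>), merge (A 0) outside (snd \<omega>, snd \<eta>))"
  let ?k = "\<lambda>\<omega>. distr (kernel \<omega>) (?C \<Otimes>\<^sub>M ?C) (?g \<omega>)"
  have k: "?k \<in> Q \<rightarrow>\<^sub>M subprob_algebra (?C \<Otimes>\<^sub>M ?C)"
    by (rule measurable_prob_algebraD, rule coupling_extend_law(2)[OF prob_P _ kernel_coupling Q]) auto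
  have pred: "Measurable.pred (?C \<Otimes>\<^sub>M ?C) success" unfolding E by (rule success_measurable)
  have sel: "sel \<in> Q \<rightarrow>\<^sub>M ?A" if "sel = fst \<or> sel = snd" for sel
    using that Qs(1) by (auto cong: measurable_cong_sets)
  have A0: "AE x in ?A. \<forall>e\<in>A 0. x e \<in> Lam" by (rule AE_admissible[OF A_subset])
  have L1: "AE \<omega> in Q. \<forall>e\<in>A 0. fst \<omega> e \<in> Lam"
  proof (rule AE_distrD[OF sel])
    show "AE x in distr Q ?A fst. \<forall>e\<in>A 0. x e \<in> Lam" by (subst Qs(2)) (rule A0)
  qed simp
  have L2: "AE \<omega> in Q. \<forall>e\<in>A 0. snd \<omega> e \<in> Lam"
  proof (rule AE_distrD[OF sel])
    show "AE x in distr Q ?A snd. \<forall>e\<in>A 0. x e \<in> Lam" by (subst Qs(3)) (rule A0)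
  qed simp
  have main: "AE z in ?k \<omega>. success z"
    if \<omega>: "\<omega> \<in> space Q" and Lam: "\<forall>e\<in>A 0. fst \<omega> e \<in> Lam" "\<forall>e\<in>A 0. snd \<omega> e \<in> Lam" for \<omega>
  proof -
    have \<omega>': "\<omega> \<in> space (?A \<Otimes>\<^sub>M ?A)" using \<omega> sets_eq_imp_space_eq[OF Qs(1)] by simp
    have mp: "(\<lambda>\<eta>. (\<eta>, partner \<omega> \<eta>)) \<in> ?O \<rightarrow>\<^sub>M ?O \<Otimes>\<^sub>M ?O"
      using measurable_compose[OF measurable_Pair1'[OF \<omega>'] partner_measurable] by (intro measurable_Pair) auto
    have mg: "?g \<omega> \<in> ?O \<Otimes>\<^sub>M ?O \<rightarrow>\<^sub>M ?C \<Otimes>\<^sub>M ?C"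
      using measurable_compose[OF measurable_Pair1'[OF \<omega>'] merge_pair_measurable[of "A 0" outside P]] by simp
    have eq: "?k \<omega> = distr ?O (?C \<Otimes>\<^sub>M ?C) (?g \<omega> \<circ> (\<lambda>\<eta>. (\<eta>, partner \<omega> \<eta>)))"
      unfolding kernel_def by (rule distr_distr[OF mg mp])
    show ?thesis unfolding eq
    proof (subst AE_distr_iff)
      show "?g \<omega> \<circ> (\<lambda>\<eta>. (\<eta>, partner \<omega> \<eta>)) \<in> ?O \<rightarrow>\<^sub>M ?C \<Otimes>\<^sub>M ?C" by (rule measurable_comp[OF mp mg])
      show "{x \<in> space (?C \<Otimes>\<^sub>M ?C). success x} \<in> sets (?C \<Otimes>\<^sub>M ?C)" using pred by (simp add: pred_def)
      show "AE \<eta> in ?O. success ((?g \<omega> \<circ> (\<lambda>\<eta>. (\<eta>, partner \<omega> \<eta>))) \<eta>)"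
        using AE_success[OF \<omega>' Lam] by simp
    qed
  qed
  have "AE z in Q \<bind> ?k. success z"
    unfolding AE_bind[OF k pred] using L1 L2 AE_space by eventually_elim (rule main)
  then show ?thesis
    unfolding extend_law_def by (rule AE_mp) (auto intro!: AE_I2 intro: success_coalesce)
qed

end

context scheme begin

text \<open>The image of \<open>P\<close> under \<open>disc\<close> charges exactly the points of \<open>Lam\<close>, so it is a discrete probability
  measure.\<close>

lemma discrete_law:
  assumes P: "passage_distribution P" and Lam: "Lam = point_masses P" "measure P Lam = 1"
  shows "\<exists>p. random_law K d Lam s t L M I I' p P"
proof -
  interpret P: prob_space P using P by (simp add: passage_distribution_def)
  have sP: "sets P = sets borel" using P by (simp add: passage_distribution_def)
  then have spP: "space P = UNIV" using sets_eq_imp_space_eq[of P borel] by simp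
  have c: "countable Lam"
    by (rule countable_subset[OF _ P.countable_support]) (auto simp: Lam(1) point_masses_def)
  have cs: "X \<in> sets P" if "countable X" for X unfolding sP by (rule sets.countable[OF _ that]) simp
  have AE: "AE r in P. r \<in> Lam" using P.AE_prob_1[OF Lam(2)] .
  have dm: "disc \<in> P \<rightarrow>\<^sub>M count_space UNIV"
  proof (rule measurableI)
    fix X :: "real set"
    have "disc -` X \<inter> space P = (Lam \<inter> X) \<union> (if t \<in> X then space P - Lam else {})"
      by (auto simp: disc_def spP split: if_splits)
    moreover have "Lam \<inter> X \<in> sets P" "Lam \<in> sets P" using c by (auto intro: cs countable_subset[OF Int_lower1])
    ultimately show "disc -` X \<inter> space P \<in> sets P" by auto
  qed simp
  define D where "D = distr P (count_space UNIV) disc"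
  interpret D: prob_space D unfolding D_def by (rule P.prob_space_distr[OF dm])
  have sD: "sets D = UNIV" by (simp add: D_def)
  have mD: "measure D {r} = measure P (disc -` {r})" for r
    unfolding D_def using dm by (simp add: measure_distr spP)
  have pos: "measure D {r} \<noteq> 0" if "r \<in> Lam" for r
  proof -
    have "disc -` {r} \<in> sets P" using measurable_sets[OF dm, of "{r}"] by (simp add: spP)
    then have "measure P {r} \<le> measure P (disc -` {r})"
      by (intro P.finite_measure_mono) (use that in auto)
    then show ?thesis using that by (auto simp: mD Lam(1) point_masses_def)
  qed
  have zero: "measure D {r} = 0" if "r \<notin> Lam" for r
  proof -
    have "disc -` {r} = {}" using that disc_Lam(1) by blast
    then show ?thesis by (simp add: mD)
  qed
  have "AE x in D. x \<in> Lam" unfolding D_def by (subst AE_distr_iff[OF dm]) auto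
  then have "AE x in D. measure D {x} \<noteq> 0" by (rule AE_mp) (auto intro!: AE_I2 simp: pos)
  then have p: "measure_pmf (Abs_pmf D) = D"
    using sD D.prob_space_axioms by (intro Abs_pmf_inverse) simp
  have "set_pmf (Abs_pmf D) = Lam"
    unfolding set_pmf.rep_eq p using pos zero by auto
  then have "random_law K d Lam s t L M I I' (Abs_pmf D) P"
    using P p dm AE by unfold_locales (auto simp: D_def)
  then show ?thesis by blast
qed

end

theorem proposition6p2:
  fixes K d m :: nat and I I' :: "vertex set" and P :: "real measure"
  assumes "K \<ge> 2" and "d \<ge> 2"
    and "finite I" and "I \<noteq> {}" and "I \<subseteq> tube_verts K d"
    and "finite I'" and "I' \<noteq> {}" and "I' \<subseteq> tube_verts K d"
    and "passage_distribution P"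
    and "\<not> (\<exists>c. measure P {c} = 1)"
    and "measure P (point_masses P) = 1"
    and "(\<exists>(J :: nat set) (t :: nat \<Rightarrow> real) (n :: nat \<Rightarrow> int).
            finite J \<and> (\<forall>j\<in>J. t j \<in> point_masses P) \<and>
            odd (\<Sum>j\<in>J. n j) \<and> (\<Sum>j\<in>J. of_int (n j) * t j) = 0)
         \<or> (\<forall>x\<in>I. \<forall>y\<in>I'. even (graph_dist K d x y))"
  shows "\<exists>\<kappa>. coupling_kernel P (inner_edges K d m) (outer_edges K d m) \<kappa> \<and>
    (\<forall>Q. coupling (iid_law P (inner_edges K d m)) (iid_law P (inner_edges K d m)) Q \<longrightarrow>
      coupling (iid_law P (tube_edges K d)) (iid_law P (tube_edges K d))
        (extend_law P (inner_edges K d m) (outer_edges K d m) Q \<kappa>) \<and>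
      (AE (\<tau>, \<tau>') in extend_law P (inner_edges K d m) (outer_edges K d m) Q \<kappa>.
        \<exists>N\<^sub>c :: real.
          (\<forall>v\<in>tube_verts K d. of_int (fst v) \<ge> N\<^sub>c \<longrightarrow>
             passage_time K d \<tau> I {v} = passage_time K d \<tau>' I' {v}) \<and>
          (\<forall>t\<ge>N\<^sub>c. infected K d \<tau> I t = infected K d \<tau>' I' t)))"
proof -
  let ?Lam = "point_masses P"
  obtain s t where st: "s \<in> ?Lam" "t \<in> ?Lam" "s < t"
  proof -
    obtain r where r: "r \<in> ?Lam"
    proof (rule ccontr)
      assume "\<not> thesis"
      then have "?Lam = {}" using that by blast
      then show False using assms(11) by simp
    qed
    have "?Lam \<noteq> {r}" using assms(10,11) by metis
    then obtain r' where r': "r' \<in> ?Lam" "r' \<noteq> r" using r by blast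
    then show thesis using that[of r r'] that[of r' r] r by (cases "r < r'") auto
  qed
  define L where "L = nat \<lceil>2 * real ((d - 1) * K) * t / (t - s)\<rceil>"
  have "2 * real ((d - 1) * K) * t / (t - s) \<le> real L" unfolding L_def by linarith
  then have L: "2 * real ((d - 1) * K) * t \<le> real L * (t - s)" using st(3) by (simp add: pos_divide_le_eq)
  define M where "M = nat (Max ((\<lambda>v. \<bar>fst v\<bar>) ` (I \<union> I')))"
  have M: "fst v \<in> {- int M..int M}" if "v \<in> I \<union> I'" for v
  proof -
    have "\<bar>fst v\<bar> \<le> Max ((\<lambda>v. \<bar>fst v\<bar>) ` (I \<union> I'))" using that assms by (intro Max_ge) auto
    then have "\<bar>fst v\<bar> \<le> int M" unfolding M_def by linarith
    then show ?thesis by auto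
  qed
  interpret scheme K d ?Lam s t L m M I I'
  proof unfold_locales
    show "?Lam \<subseteq> {0..}" by (auto simp: point_masses_def)
    show "fst ` I \<subseteq> {- int M..int M}" "fst ` I' \<subseteq> {- int M..int M}" using M by blast+
  qed (fact assms st L)+
  obtain p where "random_law K d ?Lam s t L M I I' p P"
    using discrete_law[OF assms(9) refl assms(11)] by blast
  then interpret random_law K d ?Lam s t L m M I I' p P .
  have A0: "inner_edges K d m = A 0" by (simp add: A_def lev_def)
  have E: "A 0 \<union> outside = tube_edges K d" using A_subset by auto
  show ?thesis unfolding A0
  proof (intro exI[of _ kernel] conjI allI impI kernel_coupling)
    fix Q assume Q: "coupling (iid_law P (A 0)) (iid_law P (A 0)) Q"
    show "coupling (iid_law P (tube_edges K d)) (iid_law P (tube_edges K d)) (extend_law P (A 0) outside Q kernel)"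
      using coupling_extend_law(1)[OF prob_P _ kernel_coupling Q] E by auto
    show "AE (\<tau>, \<tau>') in extend_law P (A 0) outside Q kernel. \<exists>N\<^sub>c :: real.
          (\<forall>v\<in>tube_verts K d. of_int (fst v) \<ge> N\<^sub>c \<longrightarrow>
             passage_time K d \<tau> I {v} = passage_time K d \<tau>' I' {v}) \<and>
          (\<forall>t\<ge>N\<^sub>c. infected K d \<tau> I t = infected K d \<tau>' I' t)"
      using AE_coalesce[OF Q] by (simp only: coalesce_def case_prod_beta')
  qed
qed

end
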